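(* Suppose that $p=\frac{c+o(1)}{\log 2}\cdot\frac{\log n}{n}$ for some fixed $c\in(0,1)$. If $0<\varepsilon<\min\{c,1-c\}$, then with high probability $$n^{1-c-\varepsilon}\le a_t(\mathcal{G}(n,p))\le n^{1-c+\varepsilon}.$$
   Context: $\mathcal{G}(n,p)$ is the binomial random graph on vertex set $\{1,\dots,n\}$ in which each of the $\binom n2$ possible edges is present independently with probability $p$. "With high probability" means with probability tending to $1$ as $n\to\infty$; $o(1)$ denotes a quantity tending to $0$ as $n\to\infty$. $\log$ denotes the natural logarithm. Total acquisition number: in a graph $G$, every vertex initially has weight $1$. A total acquisition move transfers all the weight from a vertex $v$ onto an adjacent vertex $u$, allowed only if immediately before the move the weight on $u$ is at least the weight on $v$. A maximal sequence of such moves is an acquisition protocol, and the set of vertices with positive weight at its end is a residual set. $a_t(G)$ is the minimum possible size of a residual set. *)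

theory Defs
  imports "HOL-Probability.Probability"
begin

text \<open>A simple graph is a pair of a vertex set \<open>V\<close> and an edge set \<open>E \<subseteq> all_edges V\<close>.\<close>

definition all_edges :: "'a set \<Rightarrow> 'a set set" where
  "all_edges V = {e. e \<subseteq> V \<and> card e = 2}"

text \<open>The edge set of the binomial random graph on the vertex set \<open>{1..n}\<close>.\<close>

definition binomial_random_graph :: "nat \<Rightarrow> real \<Rightarrow> nat set set pmf" where
  "binomial_random_graph n p =
     map_pmf (\<lambda>X. {e \<in> all_edges {1..n}. X e})
       (Pi_pmf (all_edges {1..n}) False (\<lambda>_. bernoulli_pmf p))"

definition initial_weight :: "'a set \<Rightarrow> 'a \<Rightarrow> nat" where
  "initial_weight V v = (if v \<in> V then 1 else 0)"

text \<open>The pair \<open>(v, u)\<close> is the move of all the weight from \<open>v\<close> onto \<open>u\<close>. There must be some weight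
  to transfer: with empty moves admitted, a move sequence could always be prolonged wherever a
  weightless vertex has a neighbour, and maximality would be meaningless.\<close>

fun legal_move :: "'a set set \<Rightarrow> ('a \<Rightarrow> nat) \<Rightarrow> 'a \<times> 'a \<Rightarrow> bool" where
  "legal_move E w (v, u) \<longleftrightarrow> v \<noteq> u \<and> {v, u} \<in> E \<and> 0 < w v \<and> w v \<le> w u"

fun apply_move :: "('a \<Rightarrow> nat) \<Rightarrow> 'a \<times> 'a \<Rightarrow> ('a \<Rightarrow> nat)" where
  "apply_move w (v, u) = w(v := 0, u := w u + w v)"

fun legal_moves :: "'a set set \<Rightarrow> ('a \<Rightarrow> nat) \<Rightarrow> ('a \<times> 'a) list \<Rightarrow> bool" where
  "legal_moves E w [] \<longleftrightarrow> True"
| "legal_moves E w (m # ms) \<longleftrightarrow> legal_move E w m \<and> legal_moves E (apply_move w m) ms"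

definition acquisition_protocol :: "'a set \<Rightarrow> 'a set set \<Rightarrow> ('a \<times> 'a) list \<Rightarrow> bool" where
  "acquisition_protocol V E ms \<longleftrightarrow>
     legal_moves E (initial_weight V) ms \<and>
     \<not> (\<exists>m. legal_moves E (initial_weight V) (ms @ [m]))"

definition residual_set :: "'a set \<Rightarrow> ('a \<times> 'a) list \<Rightarrow> 'a set" where
  "residual_set V ms = {v \<in> V. 0 < foldl apply_move (initial_weight V) ms v}"

definition total_acquisition_number :: "'a set \<Rightarrow> 'a set set \<Rightarrow> nat" where
  "total_acquisition_number V E =
     (LEAST k. \<exists>ms. acquisition_protocol V E ms \<and> k = card (residual_set V ms))"

text \<open>On a finite graph an acquisition protocol exists, so the minimum is attained.\<close>

lemma length_legal_moves_le:
  assumes "legal_moves E w ms" "finite {v. 0 < w v}"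
  shows "length ms \<le> card {v. 0 < w v}"
  using assms
proof (induction ms arbitrary: w)
  case (Cons m ms)
  obtain v u where m: "m = (v, u)" by (cases m)
  have eq: "{x. 0 < apply_move w m x} = {x. 0 < w x} - {v}" and v: "v \<in> {x. 0 < w x}"
    using Cons.prems(1) by (auto simp: m)
  have "length ms \<le> card ({x. 0 < w x} - {v})"
    using Cons.IH[of "apply_move w m"] Cons.prems unfolding eq by simp
  also have "\<dots> < card {x. 0 < w x}"
    using Cons.prems(2) v by (rule card_Diff1_less)
  finally show ?case by simp
qed simp

lemma acquisition_protocol_exists:
  assumes "finite V"
  shows "\<exists>ms. acquisition_protocol V E ms"
proof -
  let ?P = "\<lambda>ms. legal_moves E (initial_weight V) ms"
  have "{v. 0 < initial_weight V v} = V" by (auto simp: initial_weight_def)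
  then have bound: "?P ms \<Longrightarrow> length ms \<le> card V" for ms
    using length_legal_moves_le[of E "initial_weight V" ms] assms by simp
  have "\<exists>ms. ?P ms \<and> (\<forall>ms'. ?P ms' \<longrightarrow> length ms' \<le> length ms)"
  proof (rule ex_has_greatest_nat[where k = "[]" and f = length and b = "Suc (card V)"])
    show "?P []" by simp
    show "\<forall>ms. ?P ms \<longrightarrow> length ms < Suc (card V)" using bound by (simp add: less_Suc_eq_le)
  qed
  then obtain ms where ms: "?P ms" and max: "\<And>ms'. ?P ms' \<Longrightarrow> length ms' \<le> length ms"
    by auto
  have "\<not> ?P (ms @ [m])" for m
    using max[of "ms @ [m]"] by auto
  with ms show ?thesis unfolding acquisition_protocol_def by blast
qed

end

theory Submission
  imports Defs "HOL-Real_Asymp.Real_Asymp"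
begin

text \<open>A move onto \<open>u\<close> at most doubles the weight of \<open>u\<close> and uses up a neighbour, so a vertex of degree \<open>d\<close>
  collects at most \<open>2 ^ d\<close>. With high probability a vertex has only boundedly many neighbours of degree above
  \<open>(c + \<epsilon>') log\<^sub>2 n\<close>, and the others contribute at most \<open>n\<^bsup>c + \<epsilon>'\<^esup>\<close> each. Hence no vertex collects more than
  \<open>n\<^bsup>c + \<epsilon>\<^esup>\<close>, which is the lower bound.

  For the upper bound fix a small set \<open>Y\<close> of vertices and expose the edges inside its complement \<open>V\<close> first.
  A subgraph \<open>H\<close> of \<open>V\<close> with almost full minimum degree is an expander, so the embedding argument of Friedman and
  Pippenger places in it a forest with about \<open>n\<^bsup>1 - c + \<epsilon>\<^esup>\<close> roots in which the weight of a vertex almost doubles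
  with each child, and Hall's theorem attaches to each of its linearly many vertices a prescribed bounded
  number of leaves. This covers \<open>V\<close> except for a small set \<open>U\<close>. The edges at \<open>Y\<close> are still random: almost all of \<open>U\<close>
  can be matched into \<open>Y\<close>, and \<open>Y\<close> into the forest. The vertices of \<open>U\<close> with few neighbours in \<open>Y\<close> are so sparse
  and spread out that each of them has many other neighbours, unless it had few neighbours in \<open>V\<close> to begin with;
  as \<open>1 / ln 2 > 1\<close>, at most \<open>n\<^bsup>1 - c\<^esup>\<close> vertices are exceptional in this sense.\<close>

text \<open>The difficulty is that there is no room to waste. Under perfect doubling a root of
  weight \<open>n powr c\<close> needs \<open>c * ln n / ln 2\<close> children, which is exactly the
  average degree. Giving up a little of the exponent \<open>c\<close> turns this equality into a
  gap, and all constants of the embedding are carved out of that gap. Exact doubling would also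
  demand exact weights. The number \<open>lam\<close> with \<open>lam ^ (h + 1) = lam + 1\<close>
  trades a slightly smaller factor per child for weight windows of ratio \<open>lam\<close>, into
  which bounded errors fit once every vertex owns a large constant number of leaves.

  The set \<open>Y\<close> is held back because the leaves are selected from the whole exposed
  graph, so nothing is known about the position of the uncovered vertices; the edges at
  \<open>Y\<close> are independent of that selection. Atypical degrees are too frequent for a union
  bound over single vertices. What is rare is that \<open>k\<close> atypical vertices are adjacent
  to one vertex, for a large constant \<open>k\<close>; hence the recurring bounds on such clusters,
  for high degrees in the lower bound and for low degrees in the upper bound.\<close>

definition nbr :: "'a set set \<Rightarrow> 'a \<Rightarrow> 'a set" where
  "nbr E v = {u. {v, u} \<in> E}"

abbreviation deg_in :: "'a set set \<Rightarrow> 'a \<Rightarrow> 'a set \<Rightarrow> real" where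
  "deg_in E v P \<equiv> real (card (nbr E v \<inter> P))"

lemma nbr_subset:
  assumes "E \<subseteq> all_edges V"
  shows "nbr E v \<subseteq> V" "v \<notin> nbr E v"
  using assms by (auto simp: nbr_def all_edges_def)

lemma finite_nbr: "E \<subseteq> all_edges V \<Longrightarrow> finite V \<Longrightarrow> finite (nbr E v)"
  using nbr_subset(1) finite_subset by metis

subsection \<open>Reachable weight functions\<close>

definition reach :: "'a set set \<Rightarrow> ('a \<Rightarrow> nat) \<Rightarrow> ('a \<Rightarrow> nat) \<Rightarrow> bool" where
  "reach E w w' \<longleftrightarrow> (\<exists>ms. legal_moves E w ms \<and> foldl apply_move w ms = w')"

lemma legal_moves_append:
  "legal_moves E w (ms @ ms') \<longleftrightarrow> legal_moves E w ms \<and> legal_moves E (foldl apply_move w ms) ms'"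
  by (induction ms arbitrary: w) auto

lemma reach_refl: "reach E w w"
  unfolding reach_def by (rule exI[of _ "[]"]) simp

lemma reach_trans: "reach E w w' \<Longrightarrow> reach E w' w'' \<Longrightarrow> reach E w w''"
  unfolding reach_def by (metis legal_moves_append foldl_append)

lemma reach_move:
  assumes "legal_move E w (v, u)"
  shows "reach E w (w(v := 0, u := w u + w v))"
  unfolding reach_def by (rule exI[of _ "[(v, u)]"]) (use assms in simp)

text \<open>Sources and targets are disjoint, so the moves can be made in any order: a waiting
  source keeps its weight and a target only gains, which preserves legality. Several sources may
  share a target.\<close>

lemma reach_batch:
  assumes "finite S"
    and "\<And>s. s \<in> S \<Longrightarrow> {s, \<phi> s} \<in> E \<and> \<phi> s \<notin> S \<and> 0 < w s \<and> w s \<le> w (\<phi> s)"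
  shows "reach E w (\<lambda>v. if v \<in> S then 0 else w v + (\<Sum>s\<in>{s\<in>S. \<phi> s = v}. w s))"
  using assms
proof (induction S rule: finite_induct)
  case empty
  then show ?case by (simp add: reach_refl)
next
  case (insert a S)
  let ?w = "\<lambda>v. if v \<in> S then 0 else w v + (\<Sum>s\<in>{s\<in>S. \<phi> s = v}. w s)"
  have r: "reach E w ?w"
    using insert.prems by (intro insert.IH) auto
  have pa: "\<phi> a \<notin> insert a S" "{a, \<phi> a} \<in> E" "0 < w a" "w a \<le> w (\<phi> a)"
    using insert.prems[of a] by auto
  have na: "{s \<in> S. \<phi> s = a} = {}"
    using insert.prems by auto
  have wa: "?w a = w a" unfolding na using insert.hyps by simp
  have le: "w a \<le> ?w (\<phi> a)" using pa by auto
  have "legal_move E ?w (a, \<phi> a)"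
    unfolding legal_move.simps wa using pa le by auto
  then have *: "reach E ?w (?w(a := 0, \<phi> a := ?w (\<phi> a) + ?w a))"
    by (rule reach_move)
  have **: "?w(a := 0, \<phi> a := ?w (\<phi> a) + ?w a) =
    (\<lambda>v. if v \<in> insert a S then 0 else w v + (\<Sum>s\<in>{s\<in>insert a S. \<phi> s = v}. w s))" (is "?l = ?r")
  proof
    fix v
    show "?l v = ?r v"
    proof (cases "v = \<phi> a")
      case True
      have "{s \<in> insert a S. \<phi> s = v} = insert a {s \<in> S. \<phi> s = v}" using True by auto
      then show ?thesis using True pa wa insert.hyps by auto
    next
      case False
      then have "{s \<in> insert a S. \<phi> s = v} = {s \<in> S. \<phi> s = v}" by auto
      then show ?thesis using False wa by auto
    qed
  qed
  show ?case by (rule reach_trans[OF r *[unfolded **]])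
qed

lemma support_foldl:
  "legal_moves E w ms \<Longrightarrow> {v. 0 < foldl apply_move w ms v} \<subseteq> {v. 0 < w v}"
proof (induction ms arbitrary: w)
  case (Cons m ms)
  obtain v u where m: "m = (v, u)" by (cases m)
  have "{x. 0 < apply_move w m x} \<subseteq> {x. 0 < w x}"
    using Cons.prems by (auto simp: m)
  with Cons.IH[of "apply_move w m"] Cons.prems show ?case by auto
qed simp

lemma support_initial: "{v. 0 < initial_weight V v} = V"
  by (auto simp: initial_weight_def)

text \<open>Maximality of protocols costs nothing here. Every legal sequence can be prolonged to a
  maximal one, because each move empties a vertex, and an emptied vertex never regains
  weight.\<close>

lemma total_acquisition_number_le:
  assumes "finite V" "reach E (initial_weight V) w"
  shows "total_acquisition_number V E \<le> card {v. 0 < w v}"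
proof -
  obtain ms where ms: "legal_moves E (initial_weight V) ms" "foldl apply_move (initial_weight V) ms = w"
    using assms(2) by (auto simp: reach_def)
  let ?P = "\<lambda>ms'. legal_moves E (initial_weight V) (ms @ ms')"
  have bound: "?P ms' \<Longrightarrow> length ms' \<le> card V" for ms'
    using length_legal_moves_le[of E "initial_weight V" "ms @ ms'"] assms(1) support_initial[of V] by simp
  have "\<exists>ms'. ?P ms' \<and> (\<forall>ms''. ?P ms'' \<longrightarrow> length ms'' \<le> length ms')"
  proof (rule ex_has_greatest_nat[where k = "[]" and f = length and b = "Suc (card V)"])
    show "?P []" using ms by simp
    show "\<forall>ms'. ?P ms' \<longrightarrow> length ms' < Suc (card V)" using bound by (simp add: less_Suc_eq_le)
  qed
  then obtain ms' where ms': "?P ms'" and max: "\<And>ms''. ?P ms'' \<Longrightarrow> length ms'' \<le> length ms'"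
    by auto
  have prot: "acquisition_protocol V E (ms @ ms')"
    unfolding acquisition_protocol_def using ms' max[of "ms' @ [m]" for m] by auto
  have "residual_set V (ms @ ms') \<subseteq> {v. 0 < w v}"
  proof -
    have "legal_moves E w ms'" using ms' ms by (simp add: legal_moves_append)
    from support_foldl[OF this] show ?thesis using ms by (auto simp: residual_set_def)
  qed
  moreover have "finite {v. 0 < w v}"
  proof (rule finite_subset[OF _ assms(1)])
    show "{v. 0 < w v} \<subseteq> V" using support_foldl[OF ms(1)] ms(2) support_initial[of V] by simp
  qed
  ultimately have "card (residual_set V (ms @ ms')) \<le> card {v. 0 < w v}" by (rule card_mono[rotated])
  moreover have "total_acquisition_number V E \<le> card (residual_set V (ms @ ms'))"
    unfolding total_acquisition_number_def by (rule Least_le) (use prot in blast)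
  ultimately show ?thesis by simp
qed

subsection \<open>An upper bound on acquired weight\<close>

text \<open>Each weightless neighbour was absorbed once, at most doubling the weight; if it has low degree
  then it brought weight at most \<open>2 ^ a\<close>.\<close>

definition weight_inv :: "'a set set \<Rightarrow> 'a set \<Rightarrow> nat \<Rightarrow> ('a \<Rightarrow> nat) \<Rightarrow> bool" where
  "weight_inv E Hi a w \<longleftrightarrow>
     (\<forall>v. w v \<le> 2 ^ card (nbr E v \<inter> {z. w z = 0}) \<and>
          w v \<le> 2 ^ card (nbr E v \<inter> {z. w z = 0} \<inter> Hi) *
            (1 + card (nbr E v \<inter> {z. w z = 0} - Hi) * 2 ^ a))"

text \<open>A move from \<open>v\<close> to \<open>u\<close> adds \<open>v\<close> to the weightless
  neighbours of \<open>u\<close>, so both bounds grow along with the weight of \<open>u\<close>: by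
  a factor 2 or, in the second bound for \<open>v\<close> outside \<open>Hi\<close>, by one more
  summand \<open>2 ^ a\<close>. The first bound is carried along because, applied to
  \<open>v\<close>, it supplies this \<open>2 ^ a\<close>.\<close>

lemma weight_inv_move:
  assumes E: "E \<subseteq> all_edges V" "finite V"
    and low: "\<And>v. v \<notin> Hi \<Longrightarrow> card (nbr E v) \<le> a"
    and inv: "weight_inv E Hi a w" and leg: "legal_move E w m"
  shows "weight_inv E Hi a (apply_move w m)"
proof -
  obtain v u where m: "m = (v, u)" by (cases m)
  have leg: "v \<noteq> u" "{v, u} \<in> E" "0 < w v" "w v \<le> w u" using leg by (auto simp: m)
  define Z where "Z = {z. w z = 0}"
  define w' where "w' = apply_move w m"
  have w': "w' = w(v := 0, u := w u + w v)" by (simp add: w'_def m)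
  have Z': "{z. w' z = 0} = insert v Z" using leg by (auto simp: w' Z_def)
  have fin: "finite (nbr E x)" for x using finite_nbr[OF E] .
  have vZ: "v \<notin> Z" using leg by (simp add: Z_def)
  have vu: "v \<in> nbr E u" using leg by (simp add: nbr_def insert_commute)
  have inv1: "w x \<le> 2 ^ card (nbr E x \<inter> Z)" for x using inv by (simp add: weight_inv_def Z_def)
  have inv2: "w x \<le> 2 ^ card (nbr E x \<inter> Z \<inter> Hi) * (1 + card (nbr E x \<inter> Z - Hi) * 2 ^ a)" for x
    using inv by (simp add: weight_inv_def Z_def)
  have g1: "w' x \<le> 2 ^ card (nbr E x \<inter> insert v Z)" for x
  proof (cases "x = u")
    case True
    have "nbr E u \<inter> insert v Z = insert v (nbr E u \<inter> Z)" using vu by auto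
    then have "card (nbr E u \<inter> insert v Z) = Suc (card (nbr E u \<inter> Z))"
      using fin vZ by simp
    moreover have "w' u \<le> 2 * w u" using leg by (simp add: w')
    ultimately show ?thesis using inv1[of u] True by simp
  next
    case False
    then have "w' x \<le> w x" by (simp add: w')
    also note inv1
    also have "(2::nat) ^ card (nbr E x \<inter> Z) \<le> 2 ^ card (nbr E x \<inter> insert v Z)"
      using fin by (intro power_increasing card_mono) auto
    finally show ?thesis .
  qed
  have g2: "w' x \<le> 2 ^ card (nbr E x \<inter> insert v Z \<inter> Hi) * (1 + card (nbr E x \<inter> insert v Z - Hi) * 2 ^ a)" for x
  proof (cases "x = u")
    case True
    show ?thesis
    proof (cases "v \<in> Hi")
      case vH: True
      have "nbr E u \<inter> insert v Z \<inter> Hi = insert v (nbr E u \<inter> Z \<inter> Hi)"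
        "nbr E u \<inter> insert v Z - Hi = nbr E u \<inter> Z - Hi" using vu vH by auto
      moreover have "w' u \<le> 2 * w u" using leg by (simp add: w')
      ultimately show ?thesis using inv2[of u] True fin vZ by simp
    next
      case vH: False
      have eq: "nbr E u \<inter> insert v Z \<inter> Hi = nbr E u \<inter> Z \<inter> Hi"
        "nbr E u \<inter> insert v Z - Hi = insert v (nbr E u \<inter> Z - Hi)" using vu vH by auto
      have c: "card (insert v (nbr E u \<inter> Z - Hi)) = Suc (card (nbr E u \<inter> Z - Hi))"
        using fin vZ by simp
      have "w v \<le> 2 ^ card (nbr E v \<inter> Z)" by (rule inv1)
      also have "\<dots> \<le> 2 ^ a"
        using fin low[OF vH] by (intro power_increasing order.trans[OF card_mono low[OF vH]]) auto
      also have "\<dots> \<le> 2 ^ card (nbr E u \<inter> Z \<inter> Hi) * 2 ^ a" by simp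
      finally have "w' u \<le> 2 ^ card (nbr E u \<inter> Z \<inter> Hi) * (1 + card (nbr E u \<inter> Z - Hi) * 2 ^ a)
        + 2 ^ card (nbr E u \<inter> Z \<inter> Hi) * 2 ^ a"
        using inv2[of u] leg by (simp add: w')
      also have "\<dots> = 2 ^ card (nbr E u \<inter> Z \<inter> Hi) * (1 + Suc (card (nbr E u \<inter> Z - Hi)) * 2 ^ a)"
        by (simp add: algebra_simps)
      finally show ?thesis unfolding True eq c .
    qed
  next
    case False
    then have "w' x \<le> w x" by (simp add: w')
    also note inv2
    also have "(2::nat) ^ card (nbr E x \<inter> Z \<inter> Hi) * (1 + card (nbr E x \<inter> Z - Hi) * 2 ^ a) \<le>
       2 ^ card (nbr E x \<inter> insert v Z \<inter> Hi) * (1 + card (nbr E x \<inter> insert v Z - Hi) * 2 ^ a)"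
      using fin by (intro mult_mono add_mono power_increasing card_mono) auto
    finally show ?thesis .
  qed
  show ?thesis unfolding weight_inv_def w'_def[symmetric] Z' using g1 g2 by blast
qed

lemma weight_inv_moves:
  assumes "E \<subseteq> all_edges V" "finite V" "\<And>v. v \<notin> Hi \<Longrightarrow> card (nbr E v) \<le> a"
    and "weight_inv E Hi a w" "legal_moves E w ms"
  shows "weight_inv E Hi a (foldl apply_move w ms)"
  using assms(4,5)
proof (induction ms arbitrary: w)
  case (Cons m ms)
  then show ?case using weight_inv_move[OF assms(1-3), where w=w and m=m] by simp
qed simp

lemma sum_weight_moves:
  assumes "E \<subseteq> all_edges V" "finite V" "legal_moves E w ms"
  shows "(\<Sum>v\<in>V. foldl apply_move w ms v) = (\<Sum>v\<in>V. w v)"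
  using assms(3)
proof (induction ms arbitrary: w)
  case (Cons m ms)
  obtain v u where m: "m = (v, u)" by (cases m)
  have vu: "v \<in> V" "u \<in> V" "v \<noteq> u" using Cons.prems assms(1) by (auto simp: m all_edges_def)
  have "(\<Sum>x\<in>V. apply_move w m x) = (\<Sum>x\<in>V. w x)"
  proof -
    have "(\<Sum>x\<in>V. g x) = g v + g u + (\<Sum>x\<in>V-{v,u}. g x)" for g :: "'a \<Rightarrow> nat"
      using vu assms(2) sum.subset_diff[of "{v,u}" V g] by simp
    from this[of "apply_move w m"] this[of w]
    show ?thesis using vu by (simp add: m)
  qed
  then show ?case using Cons by simp
qed simp

text \<open>The total weight \<open>card V\<close> is conserved and ends up on the residual
  vertices, each of which holds at most what \<open>weight_inv\<close> allows.\<close>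

lemma total_acquisition_number_ge:
  assumes E: "E \<subseteq> all_edges V" "finite V"
    and low: "\<And>v. v \<notin> Hi \<Longrightarrow> card (nbr E v) \<le> a"
    and K: "\<And>v. v \<in> V \<Longrightarrow> card (nbr E v \<inter> Hi) \<le> K"
    and deg: "\<And>v. v \<in> V \<Longrightarrow> card (nbr E v) \<le> b"
  shows "card V \<le> total_acquisition_number V E * (2 ^ K * (1 + b * 2 ^ a))"
proof -
  have "\<exists>ms. acquisition_protocol V E ms \<and> total_acquisition_number V E = card (residual_set V ms)"
    unfolding total_acquisition_number_def
    by (rule LeastI_ex) (use acquisition_protocol_exists[OF E(2), of E] in blast)
  then obtain ms where ms: "legal_moves E (initial_weight V) ms"
    and t: "total_acquisition_number V E = card (residual_set V ms)"
    by (auto simp: acquisition_protocol_def)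
  let ?w = "foldl apply_move (initial_weight V) ms"
  have "weight_inv E Hi a (initial_weight V)"
    unfolding weight_inv_def
  proof (intro allI conjI)
    fix v
    have le1: "initial_weight V v \<le> 1" by (simp add: initial_weight_def)
    then show "initial_weight V v \<le> 2 ^ card (nbr E v \<inter> {z. initial_weight V z = 0})"
      by (rule order.trans) simp
    have "(1::nat) * 1 \<le> 2 ^ i * (1 + j)" for i j :: nat
      by (rule mult_mono) auto
    with le1 show "initial_weight V v \<le> 2 ^ card (nbr E v \<inter> {z. initial_weight V z = 0} \<inter> Hi) *
        (1 + card (nbr E v \<inter> {z. initial_weight V z = 0} - Hi) * 2 ^ a)"
      by (metis mult_1 order.trans)
  qed
  then have inv: "weight_inv E Hi a ?w"
    using weight_inv_moves[OF E low] ms by blast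
  have le: "?w v \<le> 2 ^ K * (1 + b * 2 ^ a)" if v: "v \<in> V" for v
  proof -
    have "?w v \<le> 2 ^ card (nbr E v \<inter> {z. ?w z = 0} \<inter> Hi) * (1 + card (nbr E v \<inter> {z. ?w z = 0} - Hi) * 2 ^ a)"
      using inv by (simp add: weight_inv_def)
    also have "\<dots> \<le> 2 ^ K * (1 + b * 2 ^ a)"
    proof (intro mult_mono add_mono power_increasing)
      show "card (nbr E v \<inter> {z. ?w z = 0} \<inter> Hi) \<le> K"
        using finite_nbr[OF E] by (intro order.trans[OF card_mono K[OF v]]) auto
      show "card (nbr E v \<inter> {z. ?w z = 0} - Hi) \<le> b"
        using finite_nbr[OF E] by (intro order.trans[OF card_mono deg[OF v]]) auto
    qed auto
    finally show ?thesis .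
  qed
  have "card V = (\<Sum>v\<in>V. initial_weight V v)" by (simp add: initial_weight_def)
  also have "\<dots> = (\<Sum>v\<in>V. ?w v)" using sum_weight_moves[OF E ms] by simp
  also have "\<dots> = (\<Sum>v\<in>residual_set V ms. ?w v)"
    using E(2) by (intro sum.mono_neutral_right) (auto simp: residual_set_def)
  also have "\<dots> \<le> card (residual_set V ms) * (2 ^ K * (1 + b * 2 ^ a))"
    using le sum_bounded_above[of "residual_set V ms" ?w "2 ^ K * (1 + b * 2 ^ a)"]
    by (simp add: residual_set_def)
  finally show ?thesis using t by simp
qed

subsection \<open>Hall's theorem\<close>

text \<open>The induction of Halmos and Vaughan, split by whether some proper nonempty subfamily is
  tight.\<close>

lemma hall:
  assumes "finite I" "\<And>i. i \<in> I \<Longrightarrow> finite (A i)"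
    and "\<And>J. J \<subseteq> I \<Longrightarrow> card J \<le> card (\<Union>(A ` J))"
  shows "\<exists>f. inj_on f I \<and> (\<forall>i\<in>I. f i \<in> A i)"
  using assms
proof (induction "card I" arbitrary: I A rule: less_induct)
  case less
  note fin = less.prems(1) and finA = less.prems(2) and hall = less.prems(3)
  have finU: "J \<subseteq> I \<Longrightarrow> finite (\<Union>(A ` J))" for J
    using fin finA by (intro finite_UN_I) (auto intro: finite_subset)
  show ?case
  proof (cases "I = {}")
    case False
    show ?thesis
    proof (cases "\<exists>J. J \<subset> I \<and> J \<noteq> {} \<and> card (\<Union>(A ` J)) = card J")
      case True
      then obtain J where J: "J \<subset> I" "J \<noteq> {}" "card (\<Union>(A ` J)) = card J" by blast
      \<comment> \<open>A tight \<open>J\<close> uses up all of \<open>?N\<close>. The condition for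
        \<open>J \<union> K\<close> then yields the condition for \<open>K\<close> after
        \<open>?N\<close> has been removed.\<close>
      let ?N = "\<Union>(A ` J)"
      have JI: "J \<subseteq> I" using J by blast
      have finJ: "finite J" "finite ?N" using finite_subset[OF JI fin] finU[OF JI] by auto
      have "card J < card I" using J fin by (simp add: psubset_card_mono)
      then obtain f where f: "inj_on f J" "\<forall>i\<in>J. f i \<in> A i"
        using less.hyps[of J A] finJ finA hall JI by blast
      have "I - J \<subset> I" using J by blast
      then have "card (I - J) < card I" using fin by (simp add: psubset_card_mono)
      moreover have "card K \<le> card (\<Union>((\<lambda>i. A i - ?N) ` K))" if K: "K \<subseteq> I - J" for K
      proof -
        have finK: "finite K" using K fin finite_subset by blast
        have "card J + card K = card (J \<union> K)"
          using K finJ finK by (subst card_Un_disjoint) auto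
        also have "\<dots> \<le> card (\<Union>(A ` (J \<union> K)))" using J K by (intro hall) auto
        also have "\<Union>(A ` (J \<union> K)) = ?N \<union> \<Union>((\<lambda>i. A i - ?N) ` K)" by auto
        also have "card \<dots> = card ?N + card (\<Union>((\<lambda>i. A i - ?N) ` K))"
        proof (rule card_Un_disjoint)
          show "finite (\<Union>((\<lambda>i. A i - ?N) ` K))" using finK K finA by auto
        qed (use finJ in auto)
        finally show ?thesis using J by simp
      qed
      ultimately obtain g where g: "inj_on g (I - J)" "\<forall>i\<in>I-J. g i \<in> A i - ?N"
        using less.hyps[of "I - J" "\<lambda>i. A i - ?N"] fin finA by auto
      let ?h = "\<lambda>i. if i \<in> J then f i else g i"
      have "inj_on ?h I"
      proof (rule inj_onI)
        fix x y assume xy: "x \<in> I" "y \<in> I" "?h x = ?h y"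
        consider "x \<in> J" "y \<in> J" | "x \<notin> J" "y \<notin> J" | "x \<in> J" "y \<notin> J" | "x \<notin> J" "y \<in> J" by blast
        then show "x = y"
        proof cases
          case 3
          then have "f x \<in> ?N" "g y \<notin> ?N" using f(2) g(2) xy(1,2) by blast+
          then show ?thesis using 3 xy(3) by simp
        next
          case 4
          then have "f y \<in> ?N" "g x \<notin> ?N" using f(2) g(2) xy(1,2) by blast+
          then show ?thesis using 4 xy(3) by simp
        qed (use f g xy in \<open>auto simp: inj_on_def\<close>)
      qed
      moreover have "\<forall>i\<in>I. ?h i \<in> A i" using f g by auto
      ultimately show ?thesis by blast
    next
      case no: False
      \<comment> \<open>Without tight subfamilies every proper nonempty one has a surplus of at
        least one, so the element chosen for \<open>i\<close> can be withdrawn from all other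
        sets.\<close>
      obtain i where i: "i \<in> I" using False by blast
      have "card {i} \<le> card (\<Union>(A ` {i}))" using i by (intro hall) auto
      then have "A i \<noteq> {}" by auto
      then obtain a where a: "a \<in> A i" by blast
      have "card (I - {i}) < card I" using i fin by (meson card_Diff1_less)
      moreover have "card K \<le> card (\<Union>((\<lambda>j. A j - {a}) ` K))" if K: "K \<subseteq> I - {i}" for K
      proof (cases "K = {}")
        case False
        have "K \<subset> I" using K i by blast
        then have "card K < card (\<Union>(A ` K))" using no False hall[of K] by (metis le_neq_implies_less psubset_imp_subset)
        moreover have "\<Union>((\<lambda>j. A j - {a}) ` K) = \<Union>(A ` K) - {a}" by auto
        moreover have "card (\<Union>(A ` K)) - 1 \<le> card (\<Union>(A ` K) - {a})"
          by (metis card_Diff_singleton_if diff_le_self order_refl)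
        ultimately show ?thesis by (simp add: le_diff_conv less_diff_conv)
      qed simp
      ultimately obtain g where g: "inj_on g (I - {i})" "\<forall>j\<in>I-{i}. g j \<in> A j - {a}"
        using less.hyps[of "I - {i}" "\<lambda>j. A j - {a}"] fin finA by auto
      have "inj_on (g(i := a)) I"
        using g i unfolding inj_on_def by (auto split: if_splits) 
      moreover have "\<forall>j\<in>I. (g(i := a)) j \<in> A j" using g a by auto
      ultimately show ?thesis by blast
    qed
  qed simp
qed

text \<open>Reduction to \<open>hall\<close> by giving each \<open>x\<close> as many copies as it
  demands; \<open>own\<close> reads off which \<open>x\<close> a chosen element serves.\<close>

lemma hall_demands:
  assumes "finite X" "\<And>x. x \<in> X \<Longrightarrow> finite (A x)"
    and "\<And>J. J \<subseteq> X \<Longrightarrow> sum a J \<le> card (\<Union>(A ` J))"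
  shows "\<exists>M own. M \<subseteq> \<Union>(A ` X) \<and> own ` M \<subseteq> X \<and> (\<forall>v\<in>M. v \<in> A (own v)) \<and>
           (\<forall>x\<in>X. card {v\<in>M. own v = x} = a x)"
proof -
  define I where "I = (SIGMA x:X. {..<a x})"
  have finI: "finite I" using assms(1) by (simp add: I_def)
  have "card J \<le> card (\<Union>((A \<circ> fst) ` J))" if J: "J \<subseteq> I" for J
  proof -
    have J': "fst ` J \<subseteq> X" using J by (auto simp: I_def)
    then have finJ: "finite (fst ` J)" using assms(1) finite_subset by blast
    have "J \<subseteq> (SIGMA x:fst ` J. {..<a x})" using J by (force simp: I_def)
    then have "card J \<le> card (SIGMA x:fst ` J. {..<a x})" using finJ by (intro card_mono) auto
    also have "\<dots> = sum a (fst ` J)" using finJ by (subst card_SigmaI) auto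
    also have "\<dots> \<le> card (\<Union>(A ` fst ` J))" using J' by (rule assms(3))
    finally show ?thesis by (simp add: image_comp)
  qed
  then obtain f where f: "inj_on f I" "\<forall>i\<in>I. f i \<in> (A \<circ> fst) i"
    using hall[of I "A \<circ> fst"] finI assms(2) by (auto simp: I_def)
  define own where "own v = fst (inv_into I f v)" for v
  have own: "own (f i) = fst i" if "i \<in> I" for i
    using f that by (simp add: own_def)
  show ?thesis
  proof (intro exI conjI)
    show "f ` I \<subseteq> \<Union>(A ` X)" "own ` f ` I \<subseteq> X" "\<forall>v\<in>f ` I. v \<in> A (own v)"
      using f own by (auto simp: I_def) (force)?
    show "\<forall>x\<in>X. card {v\<in>f ` I. own v = x} = a x"
    proof
      fix x assume x: "x \<in> X"
      have "{v\<in>f ` I. own v = x} = f ` ({x} \<times> {..<a x})"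
        using own x by (auto simp: I_def)
      moreover have "{x} \<times> {..<a x} \<subseteq> I" using x by (auto simp: I_def)
      ultimately show "card {v\<in>f ` I. own v = x} = a x"
        using f(1) by (simp add: card_image inj_on_subset)
    qed
  qed
qed

subsection \<open>Extendable partial embeddings\<close>

text \<open>The invariant of the tree-embedding argument of Friedman and Pippenger: a placed vertex \<open>u \<in> X\<close> still needs
  \<open>f u\<close> children, and any other vertex must be able to get \<open>d\<close> of them.\<close>

definition demand :: "('a \<Rightarrow> nat) \<Rightarrow> nat \<Rightarrow> 'a set \<Rightarrow> 'a \<Rightarrow> nat" where
  "demand f d X u = (if u \<in> X then f u else d)"

definition extendable :: "('a \<Rightarrow> 'a set) \<Rightarrow> 'a set \<Rightarrow> nat \<Rightarrow> nat \<Rightarrow> 'a set \<Rightarrow> ('a \<Rightarrow> nat) \<Rightarrow> bool" where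
  "extendable N H m d X f \<longleftrightarrow>
     (\<forall>U\<subseteq>H. card U \<le> m \<longrightarrow> sum (demand f d X) U \<le> card (\<Union>(N ` U) - X))"

text \<open>The tight sets of the invariant. Their size is bounded by \<open>m / 2\<close> instead
  of \<open>m\<close> so that a union of two of them stays in the range covered by
  \<open>extendable\<close>.\<close>

definition critical :: "('a \<Rightarrow> 'a set) \<Rightarrow> 'a set \<Rightarrow> nat \<Rightarrow> nat \<Rightarrow> 'a set \<Rightarrow> ('a \<Rightarrow> nat) \<Rightarrow> 'a set \<Rightarrow> bool" where
  "critical N H m d X f U \<longleftrightarrow>
     U \<subseteq> H \<and> 2 * card U \<le> m \<and> sum (demand f d X) U = card (\<Union>(N ` U) - X)"

text \<open>Neighbourhoods grow by a factor \<open>k\<close>, but at most \<open>d\<close> children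
  per vertex are ever demanded. The surplus \<open>k - d\<close> pays for neighbours that the
  embedded forest already occupies.\<close>

locale expander =
  fixes N :: "'a \<Rightarrow> 'a set" and H :: "'a set" and m k d :: nat
  assumes finH: "finite H" and N_sub: "\<And>u. u \<in> H \<Longrightarrow> N u \<subseteq> H"
    and expand: "\<And>U. U \<subseteq> H \<Longrightarrow> card U \<le> m \<Longrightarrow> k * card U \<le> card (\<Union>(N ` U))"
    and dk: "d \<le> k" and m2: "2 \<le> m"
begin

lemma finN: "U \<subseteq> H \<Longrightarrow> finite (\<Union>(N ` U))"
  using finH N_sub by (metis UN_least finite_subset subset_iff)

lemma extendable_empty: "extendable N H m d {} f"
proof -
  have "sum (demand f d {}) U \<le> card (\<Union>(N ` U))" if "U \<subseteq> H" "card U \<le> m" for U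
    using order.trans[OF mult_le_mono1[OF dk, of "card U"] expand[OF that]]
    by (simp add: demand_def mult.commute)
  then show ?thesis by (simp add: extendable_def)
qed

text \<open>More than \<open>m / 2\<close> vertices have expansion to spare: beyond a demand of at
  most \<open>d\<close> each, they have \<open>k - d\<close> further neighbours each, and this is
  more than the occupied set \<open>X\<close> can take away.\<close>

lemma noncritical:
  assumes "\<And>x. x \<in> X \<Longrightarrow> f x \<le> d" "2 * card X < (k - d) * m" "U \<subseteq> H" "card U \<le> m" "m < 2 * card U"
    "finite X"
  shows "sum (demand f d X) U < card (\<Union>(N ` U) - X)"
proof -
  have "sum (demand f d X) U \<le> card U * d"
    using sum_bounded_above[of U "demand f d X" d] assms(1) by (auto simp: demand_def)
  moreover have "(k - d) * m \<le> (k - d) * (2 * card U)" using assms(5) by (intro mult_le_mono2) auto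
  then have "card X < (k - d) * card U" using assms(2) by linarith
  moreover have "(k - d) * card U + d * card U = k * card U" using dk by (metis add_mult_distrib le_add_diff_inverse2)
  ultimately have "sum (demand f d X) U + card X < k * card U" by (simp add: mult.commute)
  also have "\<dots> \<le> card (\<Union>(N ` U))" using expand assms by simp
  also have "\<dots> \<le> card (\<Union>(N ` U) - X) + card X"
    using card_Un_le[of "\<Union>(N ` U) - X" X] card_mono[of "(\<Union>(N ` U) - X) \<union> X" "\<Union>(N ` U)"]
      finN[OF assms(3)] assms(6) by force
  finally show ?thesis by simp
qed

context
  fixes X :: "'a set" and f :: "'a \<Rightarrow> nat"
  assumes X: "X \<subseteq> H" and fd: "\<And>x. x \<in> X \<Longrightarrow> f x \<le> d" and small: "2 * card X < (k - d) * m"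
    and ext: "extendable N H m d X f"
begin

lemma extendableD: "U \<subseteq> H \<Longrightarrow> card U \<le> m \<Longrightarrow> sum (demand f d X) U \<le> card (\<Union>(N ` U) - X)"
  using ext unfolding extendable_def by blast

lemma not_critical:
  "U \<subseteq> H \<Longrightarrow> card U \<le> m \<Longrightarrow> m < 2 * card U \<Longrightarrow> sum (demand f d X) U < card (\<Union>(N ` U) - X)"
  by (rule noncritical[OF fd small _ _ _ finite_subset[OF X finH]])

text \<open>Demand is additive while the number of free neighbours is submodular, so tightness
  passes to the union. By \<open>not_critical\<close>, a tight set of at most \<open>m\<close>
  vertices cannot have more than \<open>m / 2\<close>.\<close>

lemma critical_Un:
  assumes "critical N H m d X f U" "critical N H m d X f W"
  shows "critical N H m d X f (U \<union> W)"
proof -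
  let ?D = "sum (demand f d X)" and ?c = "\<lambda>U. card (\<Union>(N ` U) - X)"
  have U: "U \<subseteq> H" "2 * card U \<le> m" "?D U = ?c U" and W: "W \<subseteq> H" "2 * card W \<le> m" "?D W = ?c W"
    using assms by (auto simp: critical_def)
  have fin: "finite U" "finite W" using U W finH finite_subset by blast+
  have fN: "finite (\<Union>(N ` U) - X)" "finite (\<Union>(N ` W) - X)" using finN U W by auto
  have "card (U \<union> W) \<le> m" using U W card_Un_le[of U W] by linarith
  then have c: "card (U \<union> W) \<le> m" "U \<union> W \<subseteq> H" using U W by auto
  then have le: "?D (U \<union> W) \<le> ?c (U \<union> W)" by (intro extendableD)
  have "card (U \<inter> W) \<le> m" using U card_mono[OF fin(1), of "U \<inter> W"] by auto
  then have le': "?D (U \<inter> W) \<le> ?c (U \<inter> W)" using U by (intro extendableD) auto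
  have "?c (U \<union> W) + ?c (U \<inter> W) \<le> card ((\<Union>(N ` U) - X) \<union> (\<Union>(N ` W) - X)) + card ((\<Union>(N ` U) - X) \<inter> (\<Union>(N ` W) - X))"
    using fN by (intro add_mono card_mono) auto
  also have "\<dots> = ?c U + ?c W" by (rule card_Un_Int[OF fN, symmetric])
  also have "\<dots> = ?D (U \<union> W) + ?D (U \<inter> W)" using sum.union_inter[OF fin, of "demand f d X"] U W by simp
  finally have eq: "?D (U \<union> W) = ?c (U \<union> W)" using le le' by linarith
  have "2 * card (U \<union> W) \<le> m"
  proof (rule ccontr)
    assume "\<not> 2 * card (U \<union> W) \<le> m"
    then have "m < 2 * card (U \<union> W)" by simp
    from not_critical[OF c(2,1) this] eq show False by simp
  qed
  with eq c show ?thesis by (simp add: critical_def)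
qed

lemma critical_Union:
  assumes "finite C" "\<And>U. U \<in> C \<Longrightarrow> critical N H m d X f U"
  shows "critical N H m d X f (\<Union>C)"
  using assms
proof (induction C rule: finite_induct)
  case empty
  then show ?case by (simp add: critical_def)
next
  case (insert U C)
  then show ?case using critical_Un by simp
qed

lemma finite_critical: "finite {U. critical N H m d X f U \<and> P U}"
  by (rule finite_subset[of _ "Pow H"]) (use finH in \<open>auto simp: critical_def\<close>)

text \<open>Placing \<open>y\<close> can only violate the invariant on a critical set with \<open>y\<close> in its neighbourhood; the union of all
  critical sets is again critical, hence too small to block every candidate.\<close>

lemma extendable_insert:
  assumes y: "y \<in> H" "y \<notin> X" and g: "g \<le> d"
    and f': "\<And>x. x \<in> X \<Longrightarrow> f' x \<le> f x" "f' y = g"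
    and nc: "\<And>U. critical N H m d X f U \<Longrightarrow> y \<in> \<Union>(N ` U) \<Longrightarrow>
       sum (demand f' d (insert y X)) U < sum (demand f d X) U"
  shows "extendable N H m d (insert y X) f'"
  unfolding extendable_def
proof (intro allI impI)
  fix U assume U: "U \<subseteq> H" "card U \<le> m"
  let ?D = "sum (demand f d X)" and ?D' = "sum (demand f' d (insert y X))"
  have le: "?D' U \<le> ?D U" using f' g y by (intro sum_mono) (auto simp: demand_def)
  have D: "?D U \<le> card (\<Union>(N ` U) - X)" using U by (intro extendableD)
  show "?D' U \<le> card (\<Union>(N ` U) - insert y X)"
  proof (cases "y \<in> \<Union>(N ` U)")
    case False
    then have "\<Union>(N ` U) - insert y X = \<Union>(N ` U) - X" by auto
    then show ?thesis using le D by simp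
  next
    case True
    have "\<Union>(N ` U) - insert y X = (\<Union>(N ` U) - X) - {y}" by auto
    moreover have "y \<in> \<Union>(N ` U) - X" using True y by simp
    ultimately have c: "card (\<Union>(N ` U) - X) = Suc (card (\<Union>(N ` U) - insert y X))"
      using finN[OF U(1)] by (metis card_Suc_Diff1 finite_Diff)
    show ?thesis
    proof (cases "critical N H m d X f U")
      case crit: True
      then show ?thesis using nc[OF crit True] c by (simp add: critical_def)
    next
      case False
      have "?D U < card (\<Union>(N ` U) - X)"
      proof (cases "m < 2 * card U")
        case True
        from not_critical[OF U this] show ?thesis .
      next
        case nm: False
        with False U have "?D U \<noteq> card (\<Union>(N ` U) - X)" by (simp add: critical_def)
        with D show ?thesis by simp
      qed
      then show ?thesis using le c by simp
    qed
  qed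
qed

text \<open>\<open>W\<close> collects the critical sets that are not relieved when the demand of
  \<open>s\<close> drops. If \<open>W\<close> blocked every free neighbour of \<open>s\<close>,
  adding \<open>s\<close> to it would raise the demand but not the number of free neighbours. For
  critical sets containing \<open>s\<close>, the loss of \<open>y\<close> is balanced by the child
  that \<open>s\<close> no longer needs.\<close>

lemma extend_child:
  assumes s: "s \<in> X" "1 \<le> f s" and g: "g \<le> d"
  shows "\<exists>y\<in>N s - X. extendable N H m d (insert y X) (f(s := f s - 1, y := g))"
proof -
  define W where "W = \<Union>{U. critical N H m d X f U \<and> s \<notin> U}"
  have critW: "critical N H m d X f W"
    unfolding W_def by (rule critical_Union[OF finite_critical]) auto
  have sW: "s \<notin> W" by (auto simp: W_def)
  have W: "W \<subseteq> H" "2 * card W \<le> m" "finite W" using critW finH finite_subset by (auto simp: critical_def)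
  have "\<not> N s - X \<subseteq> \<Union>(N ` W)"
  proof
    assume sub: "N s - X \<subseteq> \<Union>(N ` W)"
    have "card (insert s W) \<le> m" using W sW m2 by simp
    then have "sum (demand f d X) (insert s W) \<le> card (\<Union>(N ` insert s W) - X)"
      using W(1) s(1) X by (intro extendableD) auto
    also have "\<Union>(N ` insert s W) - X = \<Union>(N ` W) - X" using sub by auto
    also have "card \<dots> = sum (demand f d X) W" using critW by (simp add: critical_def)
    finally show False using W sW s by (simp add: demand_def)
  qed
  then obtain y where y: "y \<in> N s" "y \<notin> X" "y \<notin> \<Union>(N ` W)" by blast
  have sy: "s \<noteq> y" using y s by auto
  have "extendable N H m d (insert y X) (f(s := f s - 1, y := g))"
  proof (rule extendable_insert)
    show "y \<in> H" using y s X N_sub by blast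
    fix U assume U: "critical N H m d X f U" "y \<in> \<Union>(N ` U)"
    have "s \<in> U" using U y by (auto simp: W_def)
    have UH: "U \<subseteq> H" "finite U" using U finH finite_subset by (auto simp: critical_def)
    show "sum (demand (f(s := f s - 1, y := g)) d (insert y X)) U < sum (demand f d X) U"
      using UH \<open>s \<in> U\<close> s g sy y by (intro sum_strict_mono_ex1) (auto simp: demand_def intro!: bexI[of _ s])
  qed (use y g sy in auto)
  then show ?thesis using y by blast
qed

text \<open>The union of all critical sets has at most \<open>m / 2\<close> vertices and, being
  tight, at most \<open>d * m / 2\<close> free neighbours. Together with \<open>X\<close> these do
  not exhaust \<open>H\<close>, and any other vertex is a safe root.\<close>

lemma extend_root:
  assumes "2 * card X + d * m < 2 * card H" and g: "g \<le> d"
  shows "\<exists>y\<in>H - X. extendable N H m d (insert y X) (f(y := g))"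
proof -
  define W where "W = \<Union>{U. critical N H m d X f U \<and> True}"
  have critW: "critical N H m d X f W"
    unfolding W_def by (rule critical_Union[OF finite_critical]) auto
  have W: "W \<subseteq> H" "2 * card W \<le> m" using critW by (auto simp: critical_def)
  have finX: "finite X" using X finH finite_subset by blast
  have "card (\<Union>(N ` W) - X) = sum (demand f d X) W" using critW by (simp add: critical_def)
  also have "\<dots> \<le> card W * d"
    using sum_bounded_above[of W "demand f d X" d] fd by (auto simp: demand_def)
  finally have "2 * card (\<Union>(N ` W) - X) \<le> (2 * card W) * d" by simp
  also have "\<dots> \<le> m * d" using W by (intro mult_le_mono1)
  finally have "2 * card ((\<Union>(N ` W) - X) \<union> X) < 2 * card H"
    using assms(1) card_Un_le[of "\<Union>(N ` W) - X" X] by (simp add: mult.commute)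
  then have "\<not> H \<subseteq> (\<Union>(N ` W) - X) \<union> X"
    using card_mono[of "(\<Union>(N ` W) - X) \<union> X" H] finN[OF W(1)] finX by auto
  then obtain y where y: "y \<in> H" "y \<notin> X" "y \<notin> \<Union>(N ` W)" by blast
  have "extendable N H m d (insert y X) (f(y := g))"
  proof (rule extendable_insert)
    fix U assume U: "critical N H m d X f U" "y \<in> \<Union>(N ` U)"
    then have "y \<in> \<Union>(N ` W)" by (auto simp: W_def)
    then show "sum (demand (f(y := g)) d (insert y X)) U < sum (demand f d X) U" using y by simp
  qed (use y g in auto)
  then show ?thesis using y by blast
qed

end

end

subsection \<open>Forests of weight classes\<close>

text \<open>A vertex of class \<open>t\<close> will collect a weight in \<open>[\<beta> \<lambda>\<^sup>t, \<beta> \<lambda>\<^sup>t\<^sup>+\<^sup>1)\<close>. Since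
  \<open>\<lambda> ^ t = \<lambda> ^ (t - h) + \<lambda> ^ (t - h - 1)\<close>, it does so by absorbing a child of class \<open>t - h - 1\<close> when it has itself
  reached class \<open>t - h\<close>, and windows of the same relative width are preserved. For large \<open>h\<close> each child
  multiplies the weight by almost 2.\<close>

inductive forest :: "'a set set \<Rightarrow> nat \<Rightarrow> 'a set \<Rightarrow> nat \<Rightarrow> 'a set \<Rightarrow> ('a \<Rightarrow> nat) \<Rightarrow> bool" for E h R t where
  forest_roots: "forest E h R t R (\<lambda>_. t)"
| forest_child: "forest E h R t X cls \<Longrightarrow> s \<in> X \<Longrightarrow> h < cls s \<Longrightarrow> y \<notin> X \<Longrightarrow> {s, y} \<in> E \<Longrightarrow>
    forest E h R t (insert y X) (cls(s := cls s - h, y := cls s - h - 1))"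

text \<open>How often \<open>h\<close> can be subtracted from a class that still exceeds
  \<open>h\<close>. The \<open>t - 1\<close> ensures that class \<open>h\<close> itself counts as
  finished.\<close>

definition child_count :: "nat \<Rightarrow> nat \<Rightarrow> nat" where
  "child_count h t = (t - 1) div h"

lemma child_count_step: "h < t \<Longrightarrow> 0 < h \<Longrightarrow> child_count h t = Suc (child_count h (t - h))"
proof -
  assume "h < t" "0 < h"
  then have *: "t - 1 = (t - h - 1) + h" by simp
  show ?thesis unfolding child_count_def by (subst *) (use \<open>0 < h\<close> in simp)
qed

lemma child_count_small: "t \<le> h \<Longrightarrow> child_count h t = 0"
  by (cases t) (auto simp: child_count_def)

lemma child_count_mono: "s \<le> t \<Longrightarrow> child_count h s \<le> child_count h t"
  by (simp add: child_count_def div_le_mono)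

lemma forest_basics:
  assumes "forest E h R t X cls" "finite R"
  shows "finite X \<and> R \<subseteq> X \<and> (\<forall>x\<in>X. cls x \<le> t)"
  using assms
proof (induction rule: forest.induct)
  case (forest_child X cls s y)
  then have "cls s \<le> t" by blast
  then show ?case using forest_child by auto
qed auto

lemma class_split:
  fixes lam :: real
  assumes "lam ^ (h + 1) = lam + 1" "h < t"
  shows "lam ^ (t - h) + lam ^ (t - h - 1) = lam ^ t"
proof -
  obtain i where t: "t = h + 1 + i" using assms(2) by (metis Suc_eq_plus1 Suc_leI le_Suc_ex)
  have "lam ^ t = (lam + 1) * lam ^ i" unfolding t power_add[of lam "h + 1"] assms(1) ..
  then show ?thesis by (simp add: t algebra_simps)
qed

text \<open>Each growth step splits \<open>lam ^ cls s\<close> into two terms with the same sum. For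
  \<open>lam > 1\<close> every term is at least 1, so the conserved sum bounds the number of
  vertices; it is also the approximate total weight in units of \<open>\<beta>\<close>.\<close>

lemma forest_sum:
  fixes lam :: real
  assumes "forest E h R t X cls" "finite R" "lam ^ (h + 1) = lam + 1"
  shows "(\<Sum>x\<in>X. lam ^ cls x) = card R * lam ^ t"
  using assms(1)
proof (induction rule: forest.induct)
  case (forest_child X cls s y)
  have fin: "finite X" using forest_basics[OF forest_child(1) assms(2)] by simp
  have sy: "s \<noteq> y" using forest_child by auto
  let ?c = "cls(s := cls s - h, y := cls s - h - 1)"
  have "(\<Sum>x\<in>insert y X. lam ^ ?c x) = lam ^ (cls s - h - 1) + (\<Sum>x\<in>X. lam ^ ?c x)"
    using fin forest_child(4) by simp
  also have "(\<Sum>x\<in>X. lam ^ ?c x) = lam ^ (cls s - h) + (\<Sum>x\<in>X-{s}. lam ^ ?c x)"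
    using fin forest_child(2) sy by (subst sum.remove[of X s]) auto
  also have "(\<Sum>x\<in>X-{s}. lam ^ ?c x) = (\<Sum>x\<in>X-{s}. lam ^ cls x)"
    using forest_child(4) by (intro sum.cong) auto
  also have "lam ^ (cls s - h - 1) + (lam ^ (cls s - h) + (\<Sum>x\<in>X-{s}. lam ^ cls x)) =
      lam ^ cls s + (\<Sum>x\<in>X-{s}. lam ^ cls x)"
    using class_split[OF assms(3) forest_child(3)] by simp
  also have "\<dots> = (\<Sum>x\<in>X. lam ^ cls x)" using fin forest_child(2) by (simp add: sum.remove[of X s])
  finally show ?case by (simp only: forest_child.IH)
qed simp

text \<open>The forest is dismantled in reverse order of growth. The window of \<open>y\<close> ends
  where that of \<open>s\<close> begins, so the move is legal, and the two windows add up to the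
  window that \<open>s\<close> had before the split.\<close>

lemma forest_collapse:
  fixes lam \<beta> :: real
  assumes "forest E h R t X cls" "finite R" "lam ^ (h + 1) = lam + 1" "1 < lam" "0 < \<beta>"
    and "\<And>x. x \<in> X \<Longrightarrow> \<beta> * lam ^ cls x \<le> real (w x) \<and> real (w x) < \<beta> * lam ^ (cls x + 1)"
  shows "\<exists>w'. reach E w w' \<and> {v. 0 < w' v} \<subseteq> R \<union> ({v. 0 < w v} - X)"
  using assms(1,6)
proof (induction arbitrary: w rule: forest.induct)
  case forest_roots
  show ?case by (rule exI[of _ w]) (use reach_refl in auto)
next
  case (forest_child X cls s y)
  let ?c = "cls(s := cls s - h, y := cls s - h - 1)"
  have sy: "s \<noteq> y" using forest_child by auto
  define t' where "t' = cls s - h - 1"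
  have t': "cls s - h = t' + 1" using forest_child(3) by (simp add: t'_def)
  have y: "\<beta> * lam ^ t' \<le> w y" "w y < \<beta> * lam ^ (t' + 1)"
    using forest_child.prems[of y] by (auto simp: t'_def)
  have s: "\<beta> * lam ^ (t' + 1) \<le> w s" "w s < \<beta> * lam ^ (t' + 2)"
    using forest_child.prems[of s] forest_child(2) sy t' by auto
  have pos: "0 < \<beta> * lam ^ t'" using assms(4,5) by simp
  let ?w = "w(y := 0, s := w s + w y)"
  have "real (w y) \<le> real (w s)" using y s by linarith
  then have "w y \<le> w s" by simp
  moreover have "0 < w y" using y pos by linarith
  ultimately have leg: "legal_move E w (y, s)"
    using forest_child(5) sy by (auto simp: insert_commute)
  have split: "lam ^ (t' + 1) + lam ^ t' = lam ^ cls s"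
    using class_split[OF assms(3) forest_child(3)] t' by simp
  have split': "lam ^ (t' + 2) + lam ^ (t' + 1) = lam ^ (cls s + 1)"
    using arg_cong[OF split, of "\<lambda>z. z * lam"] by (simp add: algebra_simps)
  have "\<beta> * lam ^ cls x \<le> real (?w x) \<and> real (?w x) < \<beta> * lam ^ (cls x + 1)" if x: "x \<in> X" for x
  proof (cases "x = s")
    case True
    have "\<beta> * lam ^ cls s = \<beta> * lam ^ (t' + 1) + \<beta> * lam ^ t'" by (simp add: split[symmetric] algebra_simps)
    moreover have "\<beta> * lam ^ (cls s + 1) = \<beta> * lam ^ (t' + 2) + \<beta> * lam ^ (t' + 1)"
      by (simp only: split'[symmetric] distrib_left)
    moreover have "real (?w s) = real (w s) + real (w y)" using sy by simp
    ultimately show ?thesis unfolding True using y s by linarith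
  next
    case False
    then have "x \<noteq> y" using x forest_child(4) by auto
    then show ?thesis using False forest_child.prems[of x] x by simp
  qed
  from forest_child.IH[OF this] obtain w' where w': "reach E ?w w'" "{v. 0 < w' v} \<subseteq> R \<union> ({v. 0 < ?w v} - X)"
    by blast
  have "{v. 0 < ?w v} - X \<subseteq> {v. 0 < w v} - insert y X"
    using sy forest_child(2) by auto
  with w' reach_trans[OF reach_move[OF leg]] show ?case by blast
qed

context expander
begin

text \<open>All roots are placed before any child, each reserving \<open>child_count h t\<close>
  children and \<open>a\<close> leaves. When the class of a vertex drops by \<open>h\<close>, its
  \<open>child_count\<close> drops by one, so the demand follows the class; once no class exceeds
  \<open>h\<close>, exactly the \<open>a\<close> leaves are still owed. By
  \<open>forest_sum\<close>, \<open>s1\<close> and \<open>s2\<close> cover every intermediate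
  forest.\<close>

lemma exists_forest:
  fixes lam :: real
  assumes N: "\<And>u. u \<in> H \<Longrightarrow> N u \<subseteq> nbr E u"
    and lam: "lam ^ (h + 1) = lam + 1" "1 < lam" and h: "0 < h"
    and d: "child_count h t + a \<le> d"
    and s1: "2 * (real r * lam ^ t) < real ((k - d) * m)"
    and s2: "2 * (real r * lam ^ t) + real (d * m) < 2 * real (card H)"
  shows "\<exists>R X cls. card R = r \<and> finite R \<and> forest E h R t X cls \<and> X \<subseteq> H \<and> (\<forall>x\<in>X. cls x \<le> h) \<and>
    extendable N H m d X (\<lambda>_. a)"
proof -
  have size: "2 * card X < (k - d) * m" "2 * card X + d * m < 2 * card H" if "real (card X) \<le> r * lam ^ t" for X :: "'a set"
  proof -
    have "2 * real (card X) < real ((k - d) * m)" "2 * real (card X) + real (d * m) < 2 * real (card H)"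
      using that s1 s2 by linarith+
    then show "2 * card X < (k - d) * m" "2 * card X + d * m < 2 * card H"
      by (metis of_nat_less_iff of_nat_mult of_nat_numeral, metis of_nat_add of_nat_less_iff of_nat_mult of_nat_numeral)
  qed
  have lt: "1 \<le> lam ^ t" using lam by simp
  let ?g = "child_count h t + a"
  have "\<exists>R\<subseteq>H. card R = j \<and> extendable N H m d R (\<lambda>_. ?g)" if "j \<le> r" for j
    using that
  proof (induction j)
    case 0
    show ?case by (rule exI[of _ "{}"]) (simp add: extendable_empty)
  next
    case (Suc j)
    then obtain R where R: "R \<subseteq> H" "card R = j" "extendable N H m d R (\<lambda>_. ?g)" by auto
    have "real (card R) \<le> real r * 1" using R Suc by simp
    also have "\<dots> \<le> r * lam ^ t" using lt by (intro mult_left_mono) auto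
    finally have "real (card R) \<le> r * lam ^ t" .
    from extend_root[OF R(1) _ size(1)[OF this] R(3) size(2)[OF this] d]
    obtain y where y: "y \<in> H - R" "extendable N H m d (insert y R) ((\<lambda>_. ?g)(y := ?g))" using d by auto
    have "(\<lambda>_. ?g)(y := ?g) = (\<lambda>_. ?g)" by auto
    moreover have "card (insert y R) = Suc j" using y R finH finite_subset by fastforce
    ultimately show ?case using y R by (intro exI[of _ "insert y R"]) auto
  qed
  then obtain R where R: "R \<subseteq> H" "card R = r" "extendable N H m d R (\<lambda>_. ?g)" by blast
  have finR: "finite R" using R finH finite_subset by blast
  have "\<exists>X cls. forest E h R t X cls \<and> X \<subseteq> H \<and> (\<forall>x\<in>X. cls x \<le> h) \<and>
      extendable N H m d X (\<lambda>x. child_count h (cls x) + a)"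
    if "forest E h R t X cls" "X \<subseteq> H" "extendable N H m d X (\<lambda>x. child_count h (cls x) + a)" for X cls
    using that
  proof (induction "card H - card X" arbitrary: X cls rule: less_induct)
    case less
    note X = less.prems
    show ?case
    proof (cases "\<forall>x\<in>X. cls x \<le> h")
      case False
      then obtain s where s: "s \<in> X" "h < cls s" by auto
      have b: "finite X" "\<And>x. x \<in> X \<Longrightarrow> cls x \<le> t" using forest_basics[OF X(1) finR] by auto
      have "real (card X) = (\<Sum>x\<in>X. 1)" by simp
      also have "\<dots> \<le> (\<Sum>x\<in>X. lam ^ cls x)" using lam by (intro sum_mono) auto
      also have "\<dots> = r * lam ^ t" using forest_sum[OF X(1) finR lam(1)] R by simp
      finally have sz: "real (card X) \<le> r * lam ^ t" .
      let ?f = "\<lambda>x. child_count h (cls x) + a"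
      let ?y = "child_count h (cls s - h - 1) + a"
      have fd: "?f x \<le> d" if "x \<in> X" for x
        using child_count_mono[OF b(2)[OF that], of h] d by simp
      have "?y \<le> ?f s" using child_count_mono[of "cls s - h - 1" "cls s" h] by simp
      then have yd: "?y \<le> d" using fd[OF s(1)] by simp
      have "1 \<le> ?f s" using child_count_step[OF s(2) h] by simp
      from extend_child[OF X(2) fd size(1)[OF sz] X(3) s(1) this yd]
      obtain y where y: "y \<in> N s - X" "extendable N H m d (insert y X) (?f(s := ?f s - 1, y := ?y))" by auto
      let ?c = "cls(s := cls s - h, y := cls s - h - 1)"
      have "?f(s := ?f s - 1, y := ?y) = (\<lambda>x. child_count h (?c x) + a)"
        using child_count_step[OF s(2) h] by auto
      moreover have "forest E h R t (insert y X) ?c"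
        using y N[of s] s X by (intro forest_child) (auto simp: nbr_def)
      moreover have yH: "insert y X \<subseteq> H" using y N_sub[of s] s X by auto
      moreover have "card H - card (insert y X) < card H - card X"
        using b y card_mono[OF finH yH] by simp
      ultimately show ?thesis using less.hyps[of "insert y X" ?c] y(2) by simp
    qed (use X in blast)
  qed
  from this[OF forest_roots R(1,3)] obtain X cls where X: "forest E h R t X cls" "X \<subseteq> H" "\<forall>x\<in>X. cls x \<le> h"
    "extendable N H m d X (\<lambda>x. child_count h (cls x) + a)" by auto
  have "extendable N H m d X (\<lambda>_. a)"
  proof -
    have "demand (\<lambda>x. child_count h (cls x) + a) d X = demand (\<lambda>_. a) d X"
      using X(3) child_count_small by (auto simp: demand_def)
    then show ?thesis using X(4) by (simp add: extendable_def)
  qed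
  then show ?thesis using X R finR by blast
qed

end

subsection \<open>Absorbing the uncovered vertices\<close>

text \<open>The moves are made in four parallel batches. First every \<open>v \<in> F\<close> moves to \<open>\<tau> v\<close>, while each \<open>y \<in> Yg\<close> receives
  the leaf \<open>\<tau> y\<close>, so that \<open>y\<close> can afterwards absorb a vertex of \<open>U - D\<close> which has already grown to weight 2. Then
  \<open>U - D\<close> moves to \<open>Yg\<close>, then the untouched leaves to their owners, and at last, when the owners are heavy enough,
  the touched leaves and \<open>Yg\<close>. Since \<open>\<tau>\<close> hits each owner together with its leaves at most once, the final weight
  of an owner differs from its number of leaves by at most 6.\<close>

lemma absorb_uncovered:
  fixes E :: "'a set set"
  assumes fin: "finite V" and V: "V = X \<union> Lf \<union> U \<union> Y"
    and disj: "X \<inter> Lf = {}" "X \<inter> U = {}" "X \<inter> Y = {}" "Lf \<inter> U = {}" "Lf \<inter> Y = {}" "U \<inter> Y = {}"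
    and own: "\<And>v. v \<in> Lf \<Longrightarrow> own v \<in> X \<and> {v, own v} \<in> E"
    and size: "\<And>x. x \<in> X \<Longrightarrow> 5 \<le> card {v\<in>Lf. own v = x}"
    and sub: "Yg \<subseteq> Y" "D \<subseteq> U" "F \<subseteq> D \<union> (Y - Yg)"
    and tauF: "\<And>v. v \<in> F \<Longrightarrow> {v, \<tau> v} \<in> E \<and> \<tau> v \<in> X \<union> Lf \<union> (U - D)"
    and tauY: "\<And>y. y \<in> Yg \<Longrightarrow> {y, \<tau> y} \<in> E \<and> \<tau> y \<in> Lf"
    and tau_inj: "inj_on (\<lambda>v. if \<tau> v \<in> Lf then own (\<tau> v) else \<tau> v) (F \<union> Yg)"
    and psi: "inj_on \<psi> (U - D)" "\<And>u. u \<in> U - D \<Longrightarrow> {u, \<psi> u} \<in> E \<and> \<psi> u \<in> Yg"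
    and chi: "inj_on \<rho> Yg" "\<And>y. y \<in> Yg \<Longrightarrow> {y, \<rho> y} \<in> E \<and> \<rho> y \<in> X"
  shows "\<exists>w. reach E (initial_weight V) w \<and>
    (\<forall>x\<in>X. card {v\<in>Lf. own v = x} \<le> w x \<and> w x \<le> card {v\<in>Lf. own v = x} + 6) \<and>
    {v. 0 < w v} \<subseteq> X \<union> ((D \<union> (Y - Yg)) - F)"
proof -
  have finS: "finite X" "finite Lf" "finite U" "finite Y" "finite Yg" "finite F"
  proof -
    have "Yg \<subseteq> V" "F \<subseteq> V" using V sub by auto
    then show "finite X" "finite Lf" "finite U" "finite Y" "finite Yg" "finite F"
      using fin V finite_subset by auto
  qed
  \<comment> \<open>Injectivity of \<open>g\<close> is stronger than that of \<open>\<tau>\<close>: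
    no owner is disturbed twice, be it directly or through its leaves.\<close>
  define g where "g v = (if \<tau> v \<in> Lf then own (\<tau> v) else \<tau> v)" for v
  have ginj: "inj_on g (F \<union> Yg)" using tau_inj unfolding g_def .
  have tinj: "inj_on \<tau> (F \<union> Yg)"
    by (rule inj_onI) (metis (no_types, lifting) g_def ginj inj_on_def)
  have dj: "\<And>v. v \<in> X \<Longrightarrow> v \<notin> Lf \<and> v \<notin> U \<and> v \<notin> Y \<and> v \<notin> Yg \<and> v \<notin> F"
    "\<And>v. v \<in> Lf \<Longrightarrow> v \<notin> X \<and> v \<notin> U \<and> v \<notin> Y \<and> v \<notin> Yg \<and> v \<notin> F"
    "\<And>v. v \<in> U \<Longrightarrow> v \<notin> X \<and> v \<notin> Lf \<and> v \<notin> Y \<and> v \<notin> Yg"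
    "\<And>v. v \<in> Yg \<Longrightarrow> v \<notin> X \<and> v \<notin> Lf \<and> v \<notin> U \<and> v \<notin> F"
    using disj sub by blast+
  have FY: "F \<inter> Yg = {}" using sub disj by blast

  define S1 where "S1 = F \<union> \<tau> ` Yg"
  \<comment> \<open>The two kinds of sources are oriented oppositely: a vertex of \<open>F\<close>
    moves along \<open>\<tau>\<close>, whereas for \<open>y \<in> Yg\<close> the source is
    \<open>\<tau> y\<close> and the target is \<open>y\<close>.\<close>
  define \<phi>1 where "\<phi>1 v = (if v \<in> F then \<tau> v else inv_into Yg \<tau> v)" for v
  have FL: "F \<inter> Lf = {}" "F \<inter> X = {}" "F \<inter> (U - D) = {}" using sub disj by blast+
  have tY: "\<tau> ` Yg \<subseteq> Lf" using tauY by auto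
  have p1Y: "\<phi>1 (\<tau> y) = y" if "y \<in> Yg" for y
    using that tinj FL tY by (auto simp: \<phi>1_def inj_on_Un intro!: inv_into_f_f)
  have tFS: "\<tau> v \<notin> S1" if "v \<in> F" for v
  proof -
    have "\<tau> v \<notin> F" using tauF[OF that] FL by auto
    moreover have "\<tau> v \<noteq> \<tau> y" if y: "y \<in> Yg" for y
      using inj_onD[OF tinj, of v y] \<open>v \<in> F\<close> y FY by blast
    ultimately show ?thesis by (auto simp: S1_def)
  qed
  have YS1: "y \<notin> S1" if "y \<in> Yg" for y
    using that FY tY dj unfolding S1_def by blast
  have S1V: "S1 \<subseteq> V" using sub tY V by (auto simp: S1_def)
  have leg1: "{s, \<phi>1 s} \<in> E \<and> \<phi>1 s \<notin> S1 \<and> 0 < initial_weight V s \<and> initial_weight V s \<le> initial_weight V (\<phi>1 s)"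
    if s: "s \<in> S1" for s
  proof (cases "s \<in> F")
    case True
    then have "\<tau> s \<in> V" using tauF[OF True] V by auto
    then show ?thesis using True tauF[OF True] tFS[OF True] s S1V by (auto simp: \<phi>1_def initial_weight_def)
  next
    case False
    then obtain y where y: "y \<in> Yg" "s = \<tau> y" using s by (auto simp: S1_def)
    then show ?thesis using p1Y[OF y(1)] tauY[OF y(1)] YS1[OF y(1)] s S1V sub V
      by (auto simp: initial_weight_def insert_commute)
  qed
  define w1 where "w1 = (\<lambda>v. if v \<in> S1 then 0 else initial_weight V v + (\<Sum>s\<in>{s\<in>S1. \<phi>1 s = v}. initial_weight V s))"
  have finS1: "finite S1" using S1V fin finite_subset by blast
  have r1: "reach E (initial_weight V) w1"
    unfolding w1_def using leg1 by (intro reach_batch[OF finS1]) blast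
  have w1: "w1 v = (if v \<in> S1 then 0 else if v \<in> \<tau> ` F \<union> Yg then 2 else 1)" if v: "v \<in> V" for v
  proof -
    have c: "(\<Sum>s\<in>{s\<in>S1. \<phi>1 s = v}. initial_weight V s) = card {s\<in>S1. \<phi>1 s = v}"
      using S1V by (subst card_eq_sum, intro sum.cong) (auto simp: initial_weight_def)
    have c1: "{s\<in>S1. \<phi>1 s = v} = {f}" if "f \<in> F" "v = \<tau> f" for f
    proof -
      have "s = f" if s: "s \<in> S1" "\<phi>1 s = v" for s
      proof (cases "s \<in> F")
        case True
        then show ?thesis using s \<open>v = \<tau> f\<close> \<open>f \<in> F\<close> tinj by (auto simp: \<phi>1_def inj_on_def)
      next
        case False
        then obtain y where y: "y \<in> Yg" "s = \<tau> y" using s by (auto simp: S1_def)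
        then have "\<tau> f = y" using p1Y s \<open>v = \<tau> f\<close> by simp
        then show ?thesis using tauF[OF \<open>f \<in> F\<close>] dj(4)[OF y(1)] by auto
      qed
      then show ?thesis using that by (auto simp: S1_def \<phi>1_def)
    qed
    have c2: "{s\<in>S1. \<phi>1 s = v} = {\<tau> v}" if y: "v \<in> Yg"
    proof -
      have "s = \<tau> v" if s: "s \<in> S1" "\<phi>1 s = v" for s
      proof (cases "s \<in> F")
        case True
        then have "\<tau> s = v" using s by (simp add: \<phi>1_def)
        then show ?thesis using tauF[OF True] dj(4)[OF y] by auto
      next
        case False
        then obtain y' where "y' \<in> Yg" "s = \<tau> y'" using s by (auto simp: S1_def)
        then show ?thesis using p1Y s by simp
      qed
      then show ?thesis using p1Y[OF y] y by (auto simp: S1_def)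
    qed
    have c3: "{s\<in>S1. \<phi>1 s = v} = {}" if "v \<notin> \<tau> ` F \<union> Yg"
    proof -
      have "\<phi>1 s \<in> \<tau> ` F \<union> Yg" if "s \<in> S1" for s
      proof (cases "s \<in> F")
        case True
        then show ?thesis by (simp add: \<phi>1_def)
      next
        case False
        then obtain y where "y \<in> Yg" "s = \<tau> y" using \<open>s \<in> S1\<close> by (auto simp: S1_def)
        then show ?thesis using p1Y by simp
      qed
      then show ?thesis using that by auto
    qed
    have "card {s\<in>S1. \<phi>1 s = v} = (if v \<in> \<tau> ` F \<union> Yg then 1 else 0)"
    proof (cases "v \<in> \<tau> ` F \<union> Yg")
      case True
      then consider f where "f \<in> F" "v = \<tau> f" | "v \<in> Yg" by blast
      then show ?thesis
      proof cases
        case 1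
        then show ?thesis using c1[OF 1] True by (simp only: card.insert card.empty) simp
      next
        case 2
        then show ?thesis using c2[OF 2] True by (simp only: card.insert card.empty) simp
      qed
    next
      case False
      then show ?thesis using c3[OF False] by (simp only: card.empty if_False)
    qed
    with c show ?thesis using v unfolding w1_def by (auto simp: initial_weight_def)
  qed
  have w1_out: "w1 v = 0" if "v \<notin> V" for v
  proof -
    have "\<phi>1 s \<in> V" if "s \<in> S1" for s using leg1[OF that] by (auto simp: initial_weight_def split: if_splits)
    then have "{s\<in>S1. \<phi>1 s = v} = {}" using \<open>v \<notin> V\<close> by auto
    then show ?thesis using that unfolding w1_def by (simp only: sum.empty) (simp add: initial_weight_def)
  qed

  define S2 where "S2 = U - D"
  have S2: "w1 u = 1 \<or> w1 u = 2" if "u \<in> S2" for u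
    using that w1[of u] V FL tY dj(3)[of u] sub(2) by (auto simp: S2_def S1_def)
  have w1Y: "w1 y = 2" if "y \<in> Yg" for y using w1[of y] that YS1[OF that] sub V by auto
  define w2 where "w2 = (\<lambda>v. if v \<in> S2 then 0 else w1 v + (\<Sum>s\<in>{s\<in>S2. \<psi> s = v}. w1 s))"
  have r2: "reach E w1 w2"
    unfolding w2_def
  proof (rule reach_batch)
    fix s assume s: "s \<in> S2"
    have "\<psi> s \<notin> S2" using psi(2)[of s] s dj(4)[of "\<psi> s"] by (auto simp: S2_def)
    then show "{s, \<psi> s} \<in> E \<and> \<psi> s \<notin> S2 \<and> 0 < w1 s \<and> w1 s \<le> w1 (\<psi> s)"
      using S2[OF s] w1Y[of "\<psi> s"] psi(2)[of s] s by (auto simp: S2_def)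
  qed (use finS S2_def in auto)
  have w2Y: "2 \<le> w2 y \<and> w2 y \<le> 4" if y: "y \<in> Yg" for y
  proof -
    have "(\<Sum>s\<in>{s\<in>S2. \<psi> s = y}. w1 s) \<le> 2"
    proof (cases "\<exists>u\<in>S2. \<psi> u = y")
      case True
      then obtain u where u: "u \<in> S2" "\<psi> u = y" by blast
      then have "{s\<in>S2. \<psi> s = y} = {u}" using psi(1) by (auto simp: S2_def inj_on_def)
      then show ?thesis using S2[OF u(1)] by auto
    next
      case False
      then have none: "{s\<in>S2. \<psi> s = y} = {}" by blast
      show ?thesis unfolding none by simp
    qed
    moreover have "y \<notin> S2" using dj(4)[OF y] by (auto simp: S2_def)
    ultimately show ?thesis using w1Y[OF y] by (simp add: w2_def)
  qed
  have w2o: "w2 v = w1 v" if "v \<notin> S2" "v \<notin> Yg" for v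
  proof -
    have "{s\<in>S2. \<psi> s = v} = {}" using psi(2) that by (auto simp: S2_def)
    then show ?thesis using that(1) unfolding w2_def by (simp only: sum.empty if_False add_0_right)
  qed

  have LS2: "v \<notin> S2 \<and> v \<notin> Yg" if "v \<in> Lf \<or> v \<in> X" for v using that dj(1)[of v] dj(2)[of v] by (auto simp: S2_def)
  have w1X: "w1 x = (if x \<in> \<tau> ` F then 2 else 1)" if "x \<in> X" for x
  proof -
    have "x \<notin> S1" "x \<notin> Yg" using dj(1)[OF that] tY unfolding S1_def by blast+
    then show ?thesis using w1[of x] that V by auto
  qed
  have w1L: "w1 v = (if v \<in> \<tau> ` Yg then 0 else if v \<in> \<tau> ` F then 2 else 1)" if "v \<in> Lf" for v
  proof -
    have "v \<notin> F" "v \<notin> Yg" using dj(2)[OF that] by blast+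
    then show ?thesis using w1[of v] that V by (auto simp: S1_def)
  qed
  define S3 where "S3 = {v\<in>Lf. w1 v = 1}"
  define w3 where "w3 = (\<lambda>v. if v \<in> S3 then 0 else w2 v + (\<Sum>s\<in>{s\<in>S3. own s = v}. w2 s))"
  have r3: "reach E w2 w3"
    unfolding w3_def
  proof (rule reach_batch)
    fix s assume s: "s \<in> S3"
    then have sL: "s \<in> Lf" by (simp add: S3_def)
    have "own s \<notin> S3" using dj(1)[of "own s"] own[OF sL] by (auto simp: S3_def)
    moreover have "w2 s = 1" using w2o[of s] LS2[of s] sL s by (simp add: S3_def)
    moreover have "1 \<le> w2 (own s)" using w2o[of "own s"] LS2[of "own s"] own[OF sL] w1X[of "own s"] by auto
    ultimately show "{s, own s} \<in> E \<and> own s \<notin> S3 \<and> 0 < w2 s \<and> w2 s \<le> w2 (own s)"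
      using own[OF sL] by auto
  qed (use finS S3_def in auto)
  have w3X: "w3 x = w1 x + card {s\<in>S3. own s = x}" if x: "x \<in> X" for x
  proof -
    have "w2 s = 1" if "s \<in> S3" for s using that w2o[of s] LS2[of s] by (auto simp: S3_def)
    then have "(\<Sum>s\<in>{s\<in>S3. own s = x}. w2 s) = card {s\<in>S3. own s = x}" by simp
    moreover have "x \<notin> S3" using dj(1)[OF x] by (auto simp: S3_def)
    ultimately show ?thesis using w2o[of x] LS2[of x] x by (simp add: w3_def)
  qed
  have w3o: "w3 v = (if v \<in> S3 then 0 else w2 v)" if "v \<notin> X" for v
  proof -
    have "{s\<in>S3. own s = v} = {}" using own that by (auto simp: S3_def)
    then show ?thesis unfolding w3_def by (simp only: sum.empty) simp
  qed

  \<comment> \<open>For an owner \<open>x\<close>: its leaves given away to \<open>Yg\<close>, its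
    leaves raised to weight 2, and whether \<open>x\<close> itself was raised to weight 2.\<close>
  define Z where "Z x = {v\<in>Lf. own v = x \<and> v \<in> \<tau> ` Yg}" for x
  define T where "T x = {v\<in>Lf. own v = x \<and> v \<in> \<tau> ` F}" for x
  define e where "e x = card ({x} \<inter> \<tau> ` F)" for x
  have finZT: "finite (Z x)" "finite (T x)" for x using finS by (auto simp: Z_def T_def)
  have YF: "\<tau> ` Yg \<inter> \<tau> ` F = {}" using tinj FY by (auto simp: inj_on_def)
  have hit: "card (Z x) + card (T x) + e x \<le> 1" if x: "x \<in> X" for x
  proof -
    let ?J = "{i\<in>F\<union>Yg. g i = x}"
    have "card ?J \<le> 1"
    proof (rule card_le_Suc0_iff_eq[THEN iffD2, folded One_nat_def])
      show "\<forall>a1\<in>?J. \<forall>a2\<in>?J. a1 = a2" using ginj by (auto simp: inj_on_def)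
    qed (use finS in auto)
    moreover have "Z x \<union> T x \<union> ({x} \<inter> \<tau> ` F) \<subseteq> \<tau> ` ?J"
      using dj(1)[OF x] by (auto simp: Z_def T_def g_def)
    then have "card (Z x \<union> T x \<union> ({x} \<inter> \<tau> ` F)) \<le> card (\<tau> ` ?J)"
      using finS by (intro card_mono) auto
    moreover have "card (\<tau> ` ?J) \<le> card ?J" using finS by (intro card_image_le) auto
    moreover have "card (Z x \<union> T x \<union> ({x} \<inter> \<tau> ` F)) = card (Z x) + card (T x) + e x"
    proof -
      have "Z x \<inter> T x = {}" using YF by (auto simp: Z_def T_def)
      moreover have "(Z x \<union> T x) \<inter> ({x} \<inter> \<tau> ` F) = {}" using dj(1)[OF x] by (auto simp: Z_def T_def)
      ultimately show ?thesis unfolding e_def using finZT finS by (simp add: card_Un_disjoint)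
    qed
    ultimately show ?thesis by linarith
  qed
  have L1: "S3 = {v\<in>Lf. v \<notin> \<tau> ` Yg \<and> v \<notin> \<tau> ` F}"
    unfolding S3_def using w1L by (intro Collect_cong) (auto split: if_splits)
  have L2: "{v\<in>Lf. w1 v = 2} = {v\<in>Lf. v \<in> \<tau> ` F}"
    using w1L YF by (intro Collect_cong conj_cong refl) (auto split: if_splits)
  have ones: "card {s\<in>S3. own s = x} + card (Z x) + card (T x) = card {v\<in>Lf. own v = x}" if x: "x \<in> X" for x
  proof -
    have "{v\<in>Lf. own v = x} = {s\<in>S3. own s = x} \<union> (Z x \<union> T x)"
      unfolding L1 Z_def T_def by blast
    moreover have "{s\<in>S3. own s = x} \<inter> (Z x \<union> T x) = {}"
      unfolding L1 Z_def T_def by blast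
    moreover have "Z x \<inter> T x = {}" using YF by (auto simp: Z_def T_def)
    moreover have "finite {s\<in>S3. own s = x}" using finS by (simp add: S3_def)
    ultimately show ?thesis using finZT by (simp add: card_Un_disjoint)
  qed
  have w1e: "w1 x = 1 + e x" if "x \<in> X" for x using w1X[OF that] by (auto simp: e_def)
  \<comment> \<open>All but at most one of the five or more leaves have been absorbed by now. This
    is enough, as nothing left to be absorbed weighs more than 4.\<close>
  have w3X4: "4 \<le> w3 x" if x: "x \<in> X" for x
    using w3X[OF x] w1e[OF x] hit[OF x] ones[OF x] size[OF x] by linarith

  define S4 where "S4 = {v\<in>Lf. w1 v = 2} \<union> Yg"
  define \<phi>4 where "\<phi>4 v = (if v \<in> Lf then own v else \<rho> v)" for v
  define w4 where "w4 = (\<lambda>v. if v \<in> S4 then 0 else w3 v + (\<Sum>s\<in>{s\<in>S4. \<phi>4 s = v}. w3 s))"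
  have YL: "y \<notin> Lf" if "y \<in> Yg" for y using dj(4)[OF that] by blast
  have p4X: "\<phi>4 s \<in> X" if "s \<in> S4" for s
    using that own chi(2) YL by (auto simp: S4_def \<phi>4_def)
  have XS4: "x \<notin> S4" if "x \<in> X" for x using dj(1)[OF that] by (auto simp: S4_def)
  have w3Y: "w3 y = w2 y" if y: "y \<in> Yg" for y
    using w3o[of y] dj(4)[OF y] by (auto simp: S3_def)
  have w3T: "w3 v = 2" if "v \<in> Lf" "w1 v = 2" for v
    using w3o[of v] w2o[of v] LS2[of v] that dj(2)[of v] by (auto simp: S3_def)
  have r4: "reach E w3 w4"
    unfolding w4_def
  proof (rule reach_batch)
    fix s assume s: "s \<in> S4"
    have "{s, \<phi>4 s} \<in> E" using s own chi(2) YL by (auto simp: S4_def \<phi>4_def)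
    moreover have "2 \<le> w3 s \<and> w3 s \<le> 4" using s w3T w3Y w2Y by (auto simp: S4_def)
    ultimately show "{s, \<phi>4 s} \<in> E \<and> \<phi>4 s \<notin> S4 \<and> 0 < w3 s \<and> w3 s \<le> w3 (\<phi>4 s)"
      using w3X4[OF p4X[OF s]] XS4[OF p4X[OF s]] by linarith
  qed (use finS S4_def in auto)
  \<comment> \<open>The deviation from the leaf count consists of the initial weight 1 of
    \<open>x\<close>, at most 4 from a vertex of \<open>Yg\<close>, and at most one unit up or down
    caused by \<open>\<tau>\<close>.\<close>
  have w4X: "card {v\<in>Lf. own v = x} \<le> w4 x \<and> w4 x \<le> card {v\<in>Lf. own v = x} + 6" if x: "x \<in> X" for x
  proof -
    have eq: "{s\<in>S4. \<phi>4 s = x} = T x \<union> {y\<in>Yg. \<rho> y = x}"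
      unfolding S4_def L2 \<phi>4_def T_def using YL by auto
    have "(\<Sum>s\<in>{s\<in>S4. \<phi>4 s = x}. w3 s) = (\<Sum>s\<in>T x. w3 s) + (\<Sum>s\<in>{y\<in>Yg. \<rho> y = x}. w3 s)"
      unfolding eq using finZT finS YL by (intro sum.union_disjoint) (auto simp: T_def)
    also have "(\<Sum>s\<in>T x. w3 s) = 2 * card (T x)"
    proof -
      have "w3 s = 2" if "s \<in> T x" for s using that L2 w3T unfolding T_def by blast
      then show ?thesis by simp
    qed
    finally have eq2: "(\<Sum>s\<in>{s\<in>S4. \<phi>4 s = x}. w3 s) = 2 * card (T x) + (\<Sum>s\<in>{y\<in>Yg. \<rho> y = x}. w3 s)" .
    have "(\<Sum>s\<in>{y\<in>Yg. \<rho> y = x}. w3 s) \<le> 4"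
    proof (cases "\<exists>y\<in>Yg. \<rho> y = x")
      case True
      then obtain y where y: "y \<in> Yg" "\<rho> y = x" by blast
      then have "{y\<in>Yg. \<rho> y = x} = {y}" using chi(1) by (auto simp: inj_on_def)
      then show ?thesis using w2Y[OF y(1)] w3Y[OF y(1)] by simp
    next
      case False
      then have none: "{y\<in>Yg. \<rho> y = x} = {}" by blast
      show ?thesis unfolding none by simp
    qed
    moreover have "w4 x = w3 x + (2 * card (T x) + (\<Sum>s\<in>{y\<in>Yg. \<rho> y = x}. w3 s))"
      using XS4[OF x] eq2 by (simp add: w4_def)
    ultimately show ?thesis
      using w3X[OF x] w1e[OF x] hit[OF x] ones[OF x] by linarith
  qed
  have w4o: "w4 v = (if v \<in> S4 then 0 else w3 v)" if "v \<notin> X" for v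
  proof -
    have "{s\<in>S4. \<phi>4 s = v} = {}" using p4X that by auto
    then show ?thesis unfolding w4_def by (simp only: sum.empty) simp
  qed
  have supp: "v \<in> X \<union> ((D \<union> (Y - Yg)) - F)" if v: "0 < w4 v" for v
  proof (rule ccontr)
    assume n: "v \<notin> X \<union> ((D \<union> (Y - Yg)) - F)"
    have nX: "v \<notin> X" using n by simp
    have v3: "0 < w3 v" "v \<notin> S4" using v w4o[OF nX] by (auto split: if_splits)
    have v2: "0 < w2 v" "v \<notin> S3" using v3 w3o[OF nX] by (auto split: if_splits)
    have vS2: "v \<notin> S2" using v2 by (auto simp: w2_def)
    have nY: "v \<notin> Yg" using v3 by (simp add: S4_def)
    have v1: "0 < w1 v" using v2 w2o[OF vS2 nY] by simp
    have "v \<in> V" using v1 w1_out by force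
    then have "v \<in> Lf \<or> v \<in> F" using n nX vS2 nY V by (auto simp: S2_def)
    moreover have "v \<notin> F" using v1 w1[OF \<open>v \<in> V\<close>] by (auto simp: S1_def)
    ultimately have vL: "v \<in> Lf" by blast
    have "w1 v = 1 \<or> w1 v = 2" using w1L[OF vL] v1 by (auto split: if_splits)
    then show False using vL v2(2) v3(2) by (auto simp: S3_def S4_def)
  qed
  have "reach E (initial_weight V) w4" using r1 r2 r3 r4 reach_trans by metis
  then show ?thesis using w4X supp by blast
qed

subsection \<open>Edge counts and pseudo-randomness\<close>

definition between :: "'a set \<Rightarrow> 'a set \<Rightarrow> 'a set set" where
  "between S T = (\<lambda>(s, t). {s, t}) ` (S \<times> T)"

lemma between_subset: "S \<subseteq> V \<Longrightarrow> T \<subseteq> V \<Longrightarrow> S \<inter> T = {} \<Longrightarrow> between S T \<subseteq> all_edges V"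
  by (auto simp: between_def all_edges_def card_insert_if)

lemma inj_between: "S \<inter> T = {} \<Longrightarrow> inj_on (\<lambda>(s, t). {s, t}) (S \<times> T)"
  by (auto simp: inj_on_def doubleton_eq_iff)

lemma card_between: "S \<inter> T = {} \<Longrightarrow> card (between S T) = card S * card T"
  by (simp add: between_def card_image inj_between card_cartesian_product)

lemma sum_nbr_between:
  assumes "finite S" "finite T" "S \<inter> T = {}"
  shows "(\<Sum>s\<in>S. card (nbr E s \<inter> T)) = card (E \<inter> between S T)"
proof -
  have "(\<Sum>s\<in>S. card (nbr E s \<inter> T)) = card (SIGMA s:S. nbr E s \<inter> T)"
    using assms by (subst card_SigmaI) auto
  also have "\<dots> = card ((\<lambda>(s, t). {s, t}) ` (SIGMA s:S. nbr E s \<inter> T))"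
    by (rule card_image[symmetric], rule inj_on_subset[OF inj_between[OF assms(3)]]) auto
  also have "(\<lambda>(s, t). {s, t}) ` (SIGMA s:S. nbr E s \<inter> T) = E \<inter> between S T"
    by (auto simp: between_def nbr_def)
  finally show ?thesis .
qed

lemma sum_nbr_inside:
  assumes "finite W" "E \<subseteq> all_edges V"
  shows "(\<Sum>w\<in>W. card (nbr E w \<inter> W)) \<le> 2 * card (E \<inter> all_edges W)"
proof -
  let ?S = "SIGMA w:W. nbr E w \<inter> W" and ?f = "\<lambda>(s, t). {s, t} :: 'a set"
  have fin: "finite ?S" using assms(1) by auto
  have finE: "finite (E \<inter> all_edges W)"
    using assms(1) by (auto simp: all_edges_def intro: finite_subset[of _ "Pow W"])
  have "(\<Sum>w\<in>W. card (nbr E w \<inter> W)) = card ?S"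
    using assms by (subst card_SigmaI) auto
  also have "?S = (\<Union>e\<in>E \<inter> all_edges W. {p\<in>?S. ?f p = e})"
    using assms(2) by (auto simp: nbr_def all_edges_def)
  also have "card \<dots> \<le> (\<Sum>e\<in>E \<inter> all_edges W. card {p\<in>?S. ?f p = e})"
    using finE by (rule card_UN_le)
  also have "\<dots> \<le> (\<Sum>e\<in>E \<inter> all_edges W. 2)"
  proof (rule sum_mono)
    fix e assume "e \<in> E \<inter> all_edges W"
    then obtain x y where xy: "e = {x, y}" by (auto simp: all_edges_def card_2_iff)
    have "{p\<in>?S. ?f p = e} \<subseteq> {(x, y), (y, x)}"
    proof
      fix p assume p: "p \<in> {p\<in>?S. ?f p = e}"
      obtain s t where st: "p = (s, t)" by (cases p)
      then have "{s, t} = {x, y}" using p xy by simp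
      then show "p \<in> {(x, y), (y, x)}" unfolding st doubleton_eq_iff by blast
    qed
    then have "card {p\<in>?S. ?f p = e} \<le> card {(x, y), (y, x)}" by (rule card_mono[rotated]) simp
    also have "\<dots> \<le> 2" by (rule card_insert_le_m1) auto
    finally show "card {p\<in>?S. ?f p = e} \<le> 2" .
  qed
  finally show ?thesis by simp
qed

definition sparse :: "'a set set \<Rightarrow> 'a set \<Rightarrow> real \<Rightarrow> real \<Rightarrow> bool" where
  "sparse E V s b \<longleftrightarrow>
     (\<forall>W\<subseteq>V. real (card W) \<le> s \<longrightarrow> real (card (E \<inter> all_edges W)) \<le> b * real (card W))"

text \<open>Expansion in contrapositive form, used with \<open>b\<close> of order
  \<open>ln n\<close> and \<open>b'\<close> only slightly larger. The property
  \<open>sparse\<close>, applied to \<open>U \<union> T\<close>, would miss such a bound by a factor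
  of order \<open>ln n\<close>.\<close>

definition scattered :: "'a set set \<Rightarrow> 'a set \<Rightarrow> real \<Rightarrow> real \<Rightarrow> real \<Rightarrow> bool" where
  "scattered E V s b b' \<longleftrightarrow>
     (\<forall>U\<subseteq>V. \<forall>T\<subseteq>V. U \<inter> T = {} \<and> U \<noteq> {} \<and> b * real (card U) \<le> s \<and> real (card T) \<le> b * real (card U) \<longrightarrow>
        real (card (E \<inter> between U T)) \<le> b' * real (card U))"

definition dense :: "'a set set \<Rightarrow> 'a set \<Rightarrow> real \<Rightarrow> real \<Rightarrow> real \<Rightarrow> bool" where
  "dense E V q r b \<longleftrightarrow>
     (\<forall>Q\<subseteq>V. \<forall>P\<subseteq>V. Q \<inter> P = {} \<and> q \<le> real (card Q) \<and> r \<le> real (card P) \<longrightarrow>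
        b * real (card Q) \<le> real (card (E \<inter> between Q P)))"

text \<open>Deleting vertices of low degree one after the other must stop early: otherwise the first \<open>q\<close> deleted
  vertices would send too few edges to the rest.\<close>

lemma dense_core:
  assumes fin: "finite V" and E: "E \<subseteq> all_edges V"
    and dense: "dense E V (real q) (real (card V) - real q) b" and q: "0 < q" "q \<le> card V" and k: "k < b"
  shows "\<exists>H\<subseteq>V. card (V - H) < q \<and> (\<forall>v\<in>H. k \<le> deg_in E v H)"
proof -
  let ?P = "\<lambda>W. W \<subseteq> V \<and> card (V - W) \<le> q \<and> (\<Sum>v\<in>V-W. deg_in E v W) \<le> k * real (card (V - W))"
  have "?P V" by simp
  then obtain W where W: "?P W" and min: "\<And>W'. ?P W' \<Longrightarrow> card W \<le> card W'"
    using ex_has_least_nat[of ?P V card] by blast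
  have finW: "finite W" "finite (V - W)" using W fin finite_subset by auto
  have lt: "card (V - W) < q"
  proof (rule ccontr)
    assume "\<not> ?thesis"
    then have c: "card (V - W) = q" using W by auto
    have cW: "card W = card V - q" using W c fin by (simp add: card_Diff_subset finW) (metis card_mono diff_diff_cancel)
    have "b * real (card (V - W)) \<le> real (card (E \<inter> between (V - W) W))"
    proof -
      have "V - W \<subseteq> V \<and> W \<subseteq> V \<and> (V - W) \<inter> W = {} \<and> real q \<le> real (card (V - W)) \<and>
          real (card V) - real q \<le> real (card W)"
        using W c cW q by auto
      then show ?thesis using dense unfolding dense_def by blast
    qed
    also have "\<dots> = (\<Sum>v\<in>V-W. deg_in E v W)"
      by (subst sum_nbr_between[symmetric]) (use finW in auto)
    also have "\<dots> \<le> k * real (card (V - W))" using W by blast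
    finally show False using k c q by simp
  qed
  moreover have "k \<le> deg_in E v W" if v: "v \<in> W" for v
  proof (rule ccontr)
    assume n: "\<not> ?thesis"
    let ?W = "W - {v}"
    have eq: "V - ?W = insert v (V - W)" using v W by auto
    have "(\<Sum>x\<in>V-?W. deg_in E x ?W) =
       deg_in E v ?W + (\<Sum>x\<in>V-W. deg_in E x ?W)"
      unfolding eq using finW v by simp
    also have "\<dots> \<le> k + (\<Sum>x\<in>V-W. deg_in E x W)"
    proof (rule add_mono)
      have "deg_in E v ?W \<le> deg_in E v W"
        using finW by (intro of_nat_mono card_mono) auto
      then show "deg_in E v ?W \<le> k" using n by simp
      show "(\<Sum>x\<in>V-W. deg_in E x ?W) \<le> (\<Sum>x\<in>V-W. deg_in E x W)"
        using finW by (intro sum_mono of_nat_mono card_mono) auto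
    qed
    also have "\<dots> \<le> k + k * real (card (V - W))" using W by simp
    also have "\<dots> = k * real (card (V - ?W))" unfolding eq using finW v by (simp add: algebra_simps)
    finally have "?P ?W" using W lt eq finW v by auto
    from min[OF this] show False using card_Diff1_less[OF finW(1) v] by simp
  qed
  moreover have "W \<subseteq> V" using W by simp
  ultimately show ?thesis by blast
qed

text \<open>If \<open>U\<close> had too few neighbours, its degrees of at least \<open>k\<close>
  would have to be spent on edges into a set for which \<open>scattered\<close> allows
  \<open>b'\<close> per vertex, and on edges inside \<open>U\<close>, counted twice, of which
  \<open>sparse\<close> allows \<open>\<epsilon>\<close> per vertex.\<close>

lemma core_expands:
  assumes fin: "finite V" and E: "E \<subseteq> all_edges V" and H: "H \<subseteq> V"
    and deg: "\<And>v. v \<in> H \<Longrightarrow> k \<le> deg_in E v H"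
    and sparse: "sparse E V s \<epsilon>" and scat: "scattered E V s' b b'" and gap: "b' + 2 * \<epsilon> < k"
    and U: "U \<subseteq> H" "real (card U) \<le> s" "b * real (card U) \<le> s'"
  shows "b * real (card U) \<le> real (card (\<Union>u\<in>U. nbr E u \<inter> H))"
proof (cases "U = {}")
  case False
  show ?thesis
  proof (rule ccontr)
    let ?N = "\<Union>u\<in>U. nbr E u \<inter> H"
    assume n: "\<not> ?thesis"
    have finU: "finite U" "finite H"
      using finite_subset[OF U(1) finite_subset[OF H fin]] finite_subset[OF H fin] by auto
    have finN: "finite ?N" using finU finite_nbr[OF E fin] by auto
    have "k * card U \<le> (\<Sum>u\<in>U. deg_in E u H)"
      using sum_mono[of U "\<lambda>_. k" "\<lambda>u. deg_in E u H"] deg U by (simp add: subset_iff mult.commute)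
    also have "\<dots> \<le> (\<Sum>u\<in>U. deg_in E u (?N - U) + deg_in E u U)"
    proof (rule sum_mono)
      fix u assume "u \<in> U"
      then have "nbr E u \<inter> H \<subseteq> nbr E u \<inter> (?N - U) \<union> nbr E u \<inter> U" by auto
      then have "card (nbr E u \<inter> H) \<le> card (nbr E u \<inter> (?N - U) \<union> nbr E u \<inter> U)"
        using finite_nbr[OF E fin] by (intro card_mono) auto
      also have "\<dots> \<le> card (nbr E u \<inter> (?N - U)) + card (nbr E u \<inter> U)" by (rule card_Un_le)
      finally show "deg_in E u H \<le> deg_in E u (?N - U) + deg_in E u U"
        by linarith
    qed
    also have "\<dots> = real (card (E \<inter> between U (?N - U))) + real (\<Sum>u\<in>U. card (nbr E u \<inter> U))"
      using sum_nbr_between[of U "?N - U" E] finU finN by (simp add: sum.distrib flip: of_nat_sum)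
    also have "\<dots> \<le> b' * card U + 2 * (\<epsilon> * card U)"
    proof (rule add_mono)
      have "card (?N - U) \<le> card ?N" using finN by (intro card_mono) auto
      then have "real (card (?N - U)) \<le> b * real (card U)" using n by linarith
      moreover have "?N - U \<subseteq> V" "U \<subseteq> V" using U H by auto
      ultimately show "real (card (E \<inter> between U (?N - U))) \<le> b' * card U"
        using scat U(3) False unfolding scattered_def by (meson Diff_disjoint)
      have "real (card (E \<inter> all_edges U)) \<le> \<epsilon> * card U"
        using sparse U H unfolding sparse_def by blast
      then show "real (\<Sum>u\<in>U. card (nbr E u \<inter> U)) \<le> 2 * (\<epsilon> * card U)"
        using sum_nbr_inside[OF finU(1) E] by linarith
    qed
    also have "\<dots> = (b' + 2 * \<epsilon>) * card U" by (simp add: algebra_simps)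
    also have "\<dots> < k * card U" using gap False finU by (simp add: card_gt_0_iff)
    finally show False by simp
  qed
qed simp

text \<open>Hall's condition after \<open>g\<close> has identified up to \<open>a\<close> vertices
  at a time. If the image were smaller than \<open>I\<close>, there would be at most
  \<open>a * card I\<close> targets, and \<open>I\<close> with its targets would be a small set with
  more edges than \<open>sparse\<close> admits.\<close>

lemma match_sparse:
  assumes fin: "finite V" and E: "E \<subseteq> all_edges V" and sparse: "sparse E V s \<epsilon>" and eps: "0 \<le> \<epsilon>"
    and I: "I \<subseteq> V" "real (card I) * (1 + real a) \<le> s"
    and T: "\<And>i. i \<in> I \<Longrightarrow> T i \<subseteq> nbr E i" "\<And>i. i \<in> I \<Longrightarrow> \<gamma> \<le> real (card (T i))"
    and g: "\<And>z. card {v\<in>\<Union>(T ` I). g v = z} \<le> a"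
    and \<gamma>: "2 * \<epsilon> * (1 + real a) < \<gamma>"
  shows "card I \<le> card (g ` \<Union>(T ` I))"
proof (cases "I = {}")
  case False
  show ?thesis
  proof (rule ccontr)
    assume n: "\<not> ?thesis"
    define N where "N = \<Union>(T ` I)"
    define W where "W = I \<union> N"
    have TN: "T i \<subseteq> N" if "i \<in> I" for i using that by (auto simp: N_def)
    have NV: "N \<subseteq> V" unfolding N_def using T(1) nbr_subset(1)[OF E] by blast
    have finI: "finite I" "finite N" "finite W" using finite_subset[OF I(1) fin] finite_subset[OF NV fin] by (auto simp: W_def)
    have "N = (\<Union>z\<in>g ` N. {v\<in>N. g v = z})" by auto
    then have "card N \<le> (\<Sum>z\<in>g ` N. card {v\<in>N. g v = z})"
      using card_UN_le[of "g ` N" "\<lambda>z. {v\<in>N. g v = z}"] finI by simp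
    also have "\<dots> \<le> card (g ` N) * a" using sum_bounded_above[of "g ` N" "\<lambda>z. card {v\<in>N. g v = z}" a] g unfolding N_def[symmetric] by simp
    also have "\<dots> \<le> card I * a" using n unfolding N_def[symmetric] by (intro mult_le_mono1) simp
    finally have cN: "card N \<le> card I * a" .
    have "card W \<le> card I + card N" unfolding W_def by (rule card_Un_le)
    then have "card W \<le> card I * (1 + a)" using cN by simp
    then have cW: "real (card W) \<le> real (card I) * (1 + real a)"
      by (metis of_nat_1 of_nat_add of_nat_le_iff of_nat_mult)
    then have "real (card W) \<le> s" using I by linarith
    then have sp: "real (card (E \<inter> all_edges W)) \<le> \<epsilon> * real (card W)"
      using sparse Un_least[OF I(1) NV] unfolding sparse_def W_def by blast
    have "\<gamma> * card I \<le> (\<Sum>i\<in>I. real (card (T i)))"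
      using sum_mono[of I "\<lambda>_. \<gamma>"] T by (simp add: mult.commute)
    also have "\<dots> \<le> (\<Sum>i\<in>I. deg_in E i W)"
      using T(1) TN finI by (intro sum_mono of_nat_mono card_mono Int_greatest) (auto simp: W_def)
    also have "\<dots> \<le> (\<Sum>i\<in>W. deg_in E i W)"
      using finI by (intro sum_mono2) (auto simp: W_def)
    also have "\<dots> = real (\<Sum>i\<in>W. card (nbr E i \<inter> W))" by simp
    also have "\<dots> \<le> 2 * (\<epsilon> * real (card W))"
      using sum_nbr_inside[OF finI(3) E] sp by linarith
    also have "\<dots> \<le> 2 * (\<epsilon> * (real (card I) * (1 + real a)))"
      using cW eps by (intro mult_left_mono) auto
    also have "\<dots> = (2 * \<epsilon> * (1 + real a)) * card I" by simp
    also have "\<dots> < \<gamma> * card I" using \<gamma> False finI by (simp add: card_gt_0_iff)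
    finally show False by simp
  qed
qed simp

text \<open>When \<open>g\<close> maps each leaf to its owner, this finds targets in pairwise
  different owner groups; with \<open>g = id\<close> it is an ordinary matching.\<close>

lemma matching_sparse:
  assumes fin: "finite V" and E: "E \<subseteq> all_edges V" and sparse: "sparse E V s \<epsilon>" and eps: "0 \<le> \<epsilon>"
    and I: "I \<subseteq> V" "real (card I) * (1 + real a) \<le> s"
    and T: "\<And>i. i \<in> I \<Longrightarrow> T i \<subseteq> nbr E i" "\<And>i. i \<in> I \<Longrightarrow> \<gamma> \<le> real (card (T i))"
    and g: "\<And>z. card {v\<in>\<Union>(T ` I). g v = z} \<le> a"
    and \<gamma>: "2 * \<epsilon> * (1 + real a) < \<gamma>"
  shows "\<exists>\<tau>. inj_on (\<lambda>i. g (\<tau> i)) I \<and> (\<forall>i\<in>I. \<tau> i \<in> T i)"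
proof -
  have finI: "finite I" by (rule finite_subset[OF I(1) fin])
  have finT: "finite (T i)" if "i \<in> I" for i by (rule finite_subset[OF T(1)[OF that] finite_nbr[OF E fin]])
  have "card J \<le> card (\<Union>((\<lambda>i. g ` T i) ` J))" if J: "J \<subseteq> I" for J
  proof -
    have "real (card J) * (1 + real a) \<le> real (card I) * (1 + real a)"
      using J finI by (intro mult_right_mono of_nat_mono card_mono) auto
    then have s: "real (card J) * (1 + real a) \<le> s" using I(2) by linarith
    have gJ: "card {v\<in>\<Union>(T ` J). g v = z} \<le> a" for z
    proof -
      have "card {v\<in>\<Union>(T ` J). g v = z} \<le> card {v\<in>\<Union>(T ` I). g v = z}"
        using J finI finT by (intro card_mono) auto
      then show ?thesis using g[of z] by linarith
    qed
    have "card J \<le> card (g ` \<Union>(T ` J))"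
      using J I T by (intro match_sparse[OF fin E sparse eps _ s _ _ gJ \<gamma>]) auto
    then show ?thesis by (simp add: image_UN)
  qed
  then obtain f where f: "inj_on f I" "\<forall>i\<in>I. f i \<in> g ` T i"
    using hall[of I "\<lambda>i. g ` T i"] finI finT by auto
  then have "\<forall>i\<in>I. \<exists>t. t \<in> T i \<and> f i = g t" by blast
  then obtain \<tau> where "\<forall>i\<in>I. \<tau> i \<in> T i \<and> f i = g (\<tau> i)" by metis
  then show ?thesis using f(1) by (intro exI[of _ \<tau>]) (auto simp: inj_on_def)
qed

section \<open>Combining forest and leaves into a core structure\<close>

lemma reach_mono: "E \<subseteq> E' \<Longrightarrow> reach E w w' \<Longrightarrow> reach E' w w'"
proof -
  assume E: "E \<subseteq> E'"
  have "legal_moves E w ms \<Longrightarrow> legal_moves E' w ms" for ms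
  proof (induction ms arbitrary: w)
    case (Cons m ms)
    then show ?case using E by (cases m) auto
  qed simp
  then show "reach E w w' \<Longrightarrow> reach E' w w'" by (auto simp: reach_def)
qed

lemma sum_between:
  fixes lo hi :: "'a \<Rightarrow> nat"
  assumes "finite X" "\<And>x. x \<in> X \<Longrightarrow> lo x \<le> hi x" "sum lo X \<le> N" "N \<le> sum hi X"
  shows "\<exists>a. (\<forall>x\<in>X. lo x \<le> a x \<and> a x \<le> hi x) \<and> sum a X = N"
  using assms
proof (induction X arbitrary: N rule: finite_induct)
  case (insert x X)
  have le: "sum lo X \<le> sum hi X" using insert.prems by (intro sum_mono) auto
  \<comment> \<open>What is left for \<open>X\<close> if \<open>x\<close> takes its minimum, clamped
    to the range that \<open>X\<close> can realise.\<close>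
  define M where "M = max (sum lo X) (min (sum hi X) (N - lo x))"
  have "sum lo X \<le> M" "M \<le> sum hi X" using le by (auto simp: M_def)
  then obtain a where a: "\<forall>y\<in>X. lo y \<le> a y \<and> a y \<le> hi y" "sum a X = M"
    using insert.IH[of M] insert.prems by auto
  have N: "lo x + sum lo X \<le> N" "N \<le> hi x + sum hi X" using insert by auto
  have "lo x \<le> N - M" "N - M \<le> hi x" "M \<le> N"
    using N le insert.prems(1)[of x] by (auto simp: M_def max_def min_def)
  moreover have "sum (a(x := N - M)) X = sum a X"
    using insert.hyps by (intro sum.cong) auto
  then have "sum (a(x := N - M)) (insert x X) = (N - M) + M"
    using insert.hyps a(2) by simp
  ultimately show ?case using a insert.hyps by (intro exI[of _ "a(x := N - M)"]) auto
qed auto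

text \<open>The interface between the two rounds. The forest on \<open>X\<close> is hidden behind
  its only later use: weights on \<open>X\<close> close to the leaf counts collapse onto at most
  \<open>r\<close> vertices, whatever the weights elsewhere are. The numbers 5 and 6 are those of
  \<open>absorb_uncovered\<close>, and \<open>A\<close> bounds the size of the groups in the
  matchings.\<close>

definition core_structure ::
  "'a set set \<Rightarrow> 'a set \<Rightarrow> nat \<Rightarrow> nat \<Rightarrow> nat \<Rightarrow> 'a set \<Rightarrow> 'a set \<Rightarrow> ('a \<Rightarrow> 'a) \<Rightarrow> bool" where
  "core_structure E V r u A X Lf own \<longleftrightarrow>
     X \<subseteq> V \<and> Lf \<subseteq> V \<and> X \<inter> Lf = {} \<and> card (V - X - Lf) = u \<and>
     (\<forall>v\<in>Lf. own v \<in> X \<and> {v, own v} \<in> E) \<and>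
     (\<forall>x\<in>X. 5 \<le> card {v\<in>Lf. own v = x} \<and> card {v\<in>Lf. own v = x} \<le> A) \<and>
     (\<forall>w. (\<forall>x\<in>X. card {v\<in>Lf. own v = x} \<le> w x \<and> w x \<le> card {v\<in>Lf. own v = x} + 6) \<longrightarrow>
        (\<exists>R w'. finite R \<and> card R \<le> r \<and> reach E w w' \<and> {v. 0 < w' v} \<subseteq> R \<union> ({v. 0 < w v} - X)))"

text \<open>A vertex \<open>x\<close> of the forest gets about \<open>B * lam ^ cls x\<close>
  leaves, so \<open>B\<close> is the \<open>\<beta>\<close> of \<open>forest_collapse\<close> and
  there are about \<open>B * s\<close> leaves in total. A large \<open>B\<close> makes the windows
  wide enough for constant errors.\<close>

lemma exists_core_structure:
  fixes lam B q b :: real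
  assumes fin: "finite V" and E: "E \<subseteq> all_edges V" and H: "H \<subseteq> V"
    and lam: "lam ^ (h + 1) = lam + 1" "1 < lam" and h: "0 < h"
    and expand: "\<And>U. U \<subseteq> H \<Longrightarrow> card U \<le> m \<Longrightarrow> k * card U \<le> card (\<Union>u\<in>U. nbr E u \<inter> H)"
    and dk: "d \<le> k" and m2: "2 \<le> m" and d: "child_count h t + A \<le> d"
    and s_def: "s = real r * lam ^ t"
    and s1: "2 * s < real ((k - d) * m)" and s2: "2 * s + real (d * m) < 2 * real (card H)"
    and B: "13 \<le> B * (lam - 1)" and A: "2 * B + 6 \<le> real A"
    and u: "(B + 2) * s \<le> real (card V) - real u" "real (card V) - real u \<le> (B + 3) * s"
    and dense: "dense E V q (real u) b" "0 < b"
    and mid: "s + real A * q \<le> real (k * m)"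
  shows "\<exists>X Lf own. core_structure E V r u A X Lf own \<and> s / 2 \<le> real (card X) \<and> real (card X) \<le> s"
proof -
  interpret expander "\<lambda>u. nbr E u \<inter> H" H m k d
    by unfold_locales (use finite_subset[OF H fin] expand dk m2 in auto)
  obtain R X cls where R: "card R = r" "finite R" and fo: "forest E h R t X cls" and XH: "X \<subseteq> H"
    and cls: "\<And>x. x \<in> X \<Longrightarrow> cls x \<le> h" and ext: "extendable (\<lambda>u. nbr E u \<inter> H) H m d X (\<lambda>_. A)"
    using exists_forest[of E lam h t A r] lam h d s1 s2 unfolding s_def by auto
  have XV: "X \<subseteq> V" using XH H by blast
  have finX: "finite X" by (rule finite_subset[OF XV fin])
  have sX: "(\<Sum>x\<in>X. lam ^ cls x) = s" using forest_sum[OF fo R(2) lam(1)] R(1) s_def by simp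
  have Bpos: "0 < B" using B lam by (smt (verit) mult_nonpos_nonneg)
  have lamh: "lam ^ h \<le> 2"
  proof -
    have "lam * lam ^ h = lam + 1" using lam(1) by simp
    also have "\<dots> \<le> lam * 2" using lam(2) by simp
    finally show ?thesis using lam(2) by simp
  qed
  have lc: "1 \<le> lam ^ cls x" "lam ^ cls x \<le> 2" if "x \<in> X" for x
  proof -
    show "1 \<le> lam ^ cls x" using lam by simp
    have "lam ^ cls x \<le> lam ^ h" using cls[OF that] lam by (intro power_increasing) auto
    then show "lam ^ cls x \<le> 2" using lamh by simp
  qed
  have cX: "real (card X) \<le> s" "s \<le> 2 * real (card X)"
  proof -
    have "real (card X) = (\<Sum>x\<in>X. 1)" by simp
    also have "\<dots> \<le> s" unfolding sX[symmetric] using lc by (intro sum_mono) auto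
    finally show "real (card X) \<le> s" .
    have "s \<le> (\<Sum>x\<in>X. 2)" unfolding sX[symmetric] using lc by (intro sum_mono) auto
    then show "s \<le> 2 * real (card X)" by simp
  qed
  define lo where "lo x = nat \<lceil>B * lam ^ cls x\<rceil>" for x
  have lo: "B * lam ^ cls x \<le> real (lo x)" "real (lo x) \<le> B * lam ^ cls x + 1" if "x \<in> X" for x
  proof -
    have "0 \<le> B * lam ^ cls x" using Bpos lam by simp
    then show "B * lam ^ cls x \<le> real (lo x)" "real (lo x) \<le> B * lam ^ cls x + 1"
      unfolding lo_def by linarith+
  qed
  \<comment> \<open>A leeway of 5 leaves per vertex allows the number of uncovered vertices to be
    exactly \<open>u\<close>: as \<open>card X \<le> s \<le> 2 * card X\<close>, the totals that can
    be realised include the whole interval from \<open>(B + 2) * s\<close> to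
    \<open>(B + 3) * s\<close>.\<close>
  have uV: "u \<le> card V" "real (card X) + (\<Sum>x\<in>X. real (lo x)) \<le> real (card V) - real u"
    "real (card V) - real u \<le> real (card X) + (\<Sum>x\<in>X. real (lo x) + 5)"
  proof -
    have BX: "(\<Sum>x\<in>X. B * lam ^ cls x) = B * s" unfolding sX[symmetric] sum_distrib_left ..
    have "(\<Sum>x\<in>X. real (lo x)) \<le> (\<Sum>x\<in>X. B * lam ^ cls x + 1)" using lo by (intro sum_mono) auto
    also have "\<dots> = B * s + card X" unfolding sum.distrib BX by simp
    finally show "real (card X) + (\<Sum>x\<in>X. real (lo x)) \<le> real (card V) - real u"
      using cX(1) u(1) by (simp add: algebra_simps)
    have "B * s \<le> (\<Sum>x\<in>X. real (lo x))" unfolding BX[symmetric] using lo by (intro sum_mono) auto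
    moreover have "(\<Sum>x\<in>X. real (lo x) + 5) = (\<Sum>x\<in>X. real (lo x)) + 5 * card X" by (simp add: sum.distrib)
    ultimately show "real (card V) - real u \<le> real (card X) + (\<Sum>x\<in>X. real (lo x) + 5)"
      using cX(2) u(2) by (simp add: algebra_simps)
    have "0 \<le> (B + 2) * s" using Bpos cX(1) by (intro mult_nonneg_nonneg) auto
    then show "u \<le> card V" using u(1) by simp
  qed
  define N where "N = card V - u - card X"
  have ge: "real (card X) \<le> real (card V) - real u"
    using uV(2) sum_nonneg[of X "\<lambda>x. real (lo x)"] by linarith
  then have NN: "real N = real (card V) - real u - real (card X)" "card X + N + u = card V"
    using uV(1) unfolding N_def by linarith+
  have "real (\<Sum>x\<in>X. lo x) \<le> real N" "real N \<le> real (\<Sum>x\<in>X. lo x + 5)" using uV(2,3) NN(1) by simp_all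
  then have "(\<Sum>x\<in>X. lo x) \<le> N" "N \<le> (\<Sum>x\<in>X. lo x + 5)" by (simp_all only: of_nat_le_iff)
  then obtain a where a: "\<And>x. x \<in> X \<Longrightarrow> lo x \<le> a x \<and> a x \<le> lo x + 5" and aN: "sum a X = N"
    using sum_between[OF finX, of lo "\<lambda>x. lo x + 5" N] by auto
  have aA: "a x \<le> A" if x: "x \<in> X" for x
  proof -
    have "B * lam ^ cls x \<le> B * 2" using lc(2)[OF x] Bpos by simp
    then have "real (a x) \<le> real A" using a[OF x] lo[OF x] A by linarith
    then show ?thesis by simp
  qed
  have sumA: "sum a J \<le> A * card J" if "J \<subseteq> X" for J
    using sum_bounded_above[of J a A] aA that by (auto simp: mult.commute)
  have finN: "finite (\<Union>x\<in>J. nbr E x - X)" "finite (\<Union>x\<in>J. nbr E x \<inter> H)" if "J \<subseteq> X" for J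
    using finite_subset[OF that finX] finite_nbr[OF E fin] by auto
  \<comment> \<open>Hall's condition comes from the embedding invariant for small \<open>J\<close>, from the expansion of a subset of size \<open>m\<close>
    for \<open>J\<close> of medium size, and from density for large \<open>J\<close>.\<close>
  have hallJ: "sum a J \<le> card (\<Union>x\<in>J. nbr E x - X)" if J: "J \<subseteq> X" for J
  proof -
    have JH: "J \<subseteq> H" using J XH by blast
    have finJ: "finite J" by (rule finite_subset[OF J finX])
    consider "card J \<le> m" | "m < card J" "real (card J) < q" | "m < card J" "q \<le> real (card J)" by linarith
    then show ?thesis
    proof cases
      case 1
      have "sum a J \<le> A * card J" by (rule sumA[OF J])
      also have "\<dots> = sum (demand (\<lambda>_. A) d X) J"
        using J by (subst sum.cong[of J J "demand (\<lambda>_. A) d X" "\<lambda>_. A"]) (auto simp: demand_def)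
      also have "\<dots> \<le> card ((\<Union>x\<in>J. nbr E x \<inter> H) - X)" using ext JH 1 unfolding extendable_def by blast
      also have "\<dots> \<le> card (\<Union>x\<in>J. nbr E x - X)" by (rule card_mono[OF finN(1)[OF J]]) auto
      finally show ?thesis .
    next
      case 2
      obtain J0 where J0: "J0 \<subseteq> J" "card J0 = m" using 2(1) by (meson less_imp_le obtain_subset_with_card_n)
      have J0H: "J0 \<subseteq> H" "J0 \<subseteq> X" using J0 JH J by auto
      have "real (sum a J) \<le> real (A * card J)" using sumA[OF J] by (simp only: of_nat_le_iff)
      also have "\<dots> \<le> real A * q" using 2(2) by (simp add: mult_left_mono)
      finally have "real (sum a J) + real (card X) \<le> real (k * m)" using mid cX(1) by linarith
      then have "sum a J + card X \<le> k * m" by (simp only: of_nat_le_iff flip: of_nat_add)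
      also have "\<dots> \<le> card (\<Union>x\<in>J0. nbr E x \<inter> H)" using expand[OF J0H(1)] J0(2) by simp
      also have "\<dots> \<le> card ((\<Union>x\<in>J. nbr E x - X) \<union> X)"
        using finN(1)[OF J] finX J0 by (intro card_mono) auto
      also have "\<dots> \<le> card (\<Union>x\<in>J. nbr E x - X) + card X" by (rule card_Un_le)
      finally show ?thesis by simp
    next
      case 3
      \<comment> \<open>Fewer than \<open>u\<close> vertices outside \<open>X\<close> can miss all
        of \<open>J\<close>, so more than \<open>N\<close> of them are hit, and \<open>N\<close> is
        the demand of all of \<open>X\<close>.\<close>
      define M where "M = (\<Union>x\<in>J. nbr E x - X)"
      define P where "P = V - X - M"
      have MV: "M \<subseteq> V - X" using nbr_subset(1)[OF E] by (auto simp: M_def)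
      have "card P < u"
      proof (rule ccontr)
        assume "\<not> card P < u"
        then have "J \<subseteq> V \<and> P \<subseteq> V \<and> J \<inter> P = {} \<and> q \<le> real (card J) \<and> real u \<le> real (card P)"
          using 3 J XV by (auto simp: P_def)
        then have "b * real (card J) \<le> real (card (E \<inter> between J P))"
          using dense(1) unfolding dense_def by blast
        moreover have "E \<inter> between J P = {}"
          by (auto simp: between_def P_def M_def nbr_def)
        moreover have "0 < b * real (card J)" using dense(2) 3(1) by simp
        ultimately show False by simp
      qed
      moreover have "card P = card V - card X - card M"
        using MV XV fin finX unfolding P_def
        by (simp add: card_Diff_subset finite_subset[of M] finite_subset[of "V - X"])
      moreover have "card M \<le> card V - card X"
        using card_mono[OF _ MV] fin XV finX by (simp add: card_Diff_subset)
      moreover have "sum a J \<le> N" unfolding aN[symmetric] using finX J by (intro sum_mono2) auto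
      ultimately show ?thesis using NN(2) unfolding M_def[symmetric] by linarith
    qed
  qed
  have "finite (nbr E x - X)" for x using finite_nbr[OF E fin] by blast
  then obtain Lf own where Lf: "Lf \<subseteq> (\<Union>x\<in>X. nbr E x - X)" "own ` Lf \<subseteq> X" "\<forall>v\<in>Lf. v \<in> nbr E (own v) - X"
    and fib: "\<And>x. x \<in> X \<Longrightarrow> card {v\<in>Lf. own v = x} = a x"
    using hall_demands[of X "\<lambda>x. nbr E x - X" a] finX hallJ by auto
  have LfV: "Lf \<subseteq> V" using Lf(1) nbr_subset(1)[OF E] by blast
  have finL: "finite Lf" by (rule finite_subset[OF LfV fin])
  have dj: "X \<inter> Lf = {}" using Lf(1) by blast
  have "card Lf = (\<Sum>x\<in>X. card {v\<in>Lf. own v = x})"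
    using sum.group[OF finL finX Lf(2), of "\<lambda>_. 1::nat"] by simp
  then have cL: "card Lf = N" using fib aN by simp
  have "V - X - Lf = V - (X \<union> Lf)" by blast
  then have cU: "card (V - X - Lf) = u"
    using card_Diff_subset[of "X \<union> Lf" V] card_Un_disjoint[OF finX finL dj] finX finL XV LfV cL NN(2) by simp
  have win: "\<exists>R w'. finite R \<and> card R \<le> r \<and> reach E w w' \<and> {v. 0 < w' v} \<subseteq> R \<union> ({v. 0 < w v} - X)"
    if w: "\<And>x. x \<in> X \<Longrightarrow> a x \<le> w x \<and> w x \<le> a x + 6" for w
  proof -
    \<comment> \<open>The window has length at least 13. Rounding up costs 1, the leeway 5 and the
      absorbed vertices 6, so the upper end remains strict.\<close>
    have "B * lam ^ cls x \<le> real (w x) \<and> real (w x) < B * lam ^ (cls x + 1)" if x: "x \<in> X" for x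
    proof -
      have "13 * 1 \<le> B * (lam - 1) * lam ^ cls x" using B lc(1)[OF x] by (intro mult_mono) auto
      then have "B * lam ^ cls x + 13 \<le> B * lam ^ (cls x + 1)" by (simp add: algebra_simps)
      moreover have "real (lo x) \<le> real (w x)" "real (w x) \<le> real (lo x) + 11" using a[OF x] w[OF x] by linarith+
      ultimately show ?thesis using lo[OF x] by linarith
    qed
    from forest_collapse[OF fo R(2) lam Bpos this] show ?thesis using R by blast
  qed
  have "5 \<le> a x" if x: "x \<in> X" for x
  proof -
    have "lam - 1 \<le> 1"
    proof -
      have "lam ^ 1 \<le> lam ^ h" using lam h by (intro power_increasing) auto
      then show ?thesis using lamh by simp
    qed
    then have "B * (lam - 1) \<le> B * 1" using Bpos by (intro mult_left_mono) auto
    moreover have "B * 1 \<le> B * lam ^ cls x" using lc(1)[OF x] Bpos by (intro mult_left_mono) auto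
    ultimately have "5 \<le> real (a x)" using B lo(1)[OF x] a[OF x] by linarith
    then show ?thesis by simp
  qed
  then have "core_structure E V r u A X Lf own"
    unfolding core_structure_def using XV LfV dj cU Lf(2,3) fib aA win
    by (auto simp: nbr_def insert_commute)
  then show ?thesis using cX by (intro exI[of _ X] exI[of _ Lf] exI[of _ own]) auto
qed

section \<open>Deterministic reduction of the upper bound to counting exceptional vertices\<close>

definition well_attached :: "'a set set \<Rightarrow> 'a set \<Rightarrow> 'a set \<Rightarrow> 'a set \<Rightarrow> real \<Rightarrow> 'a set" where
  "well_attached E X Lf Y \<gamma> = {y\<in>Y. \<gamma> \<le> deg_in E y X \<and> \<gamma> \<le> deg_in E y Lf}"

text \<open>Three matchings feed \<open>absorb_uncovered\<close>. The choices of
  \<open>\<tau>\<close> and \<open>\<rho>\<close> follow from sparseness alone. For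
  \<open>\<psi>\<close>, from \<open>U - D\<close> into \<open>Yg\<close>, sparseness serves the
  small sets and density the large ones. Vertices of \<open>D \<union> (Y - Yg)\<close> with enough
  targets are moved by \<open>\<tau>\<close> as well, and the others are simply counted.\<close>

lemma total_acquisition_number_le_exceptional:
  fixes \<gamma> \<gamma>' b' s s' \<epsilon> \<epsilon>' r' :: real and Yg D U :: "'a set"
  assumes fin: "finite V" "finite Y" "V \<inter> Y = {}" and E: "E \<subseteq> all_edges (V \<union> Y)" and E1: "E1 \<subseteq> E"
    and core: "core_structure E1 V r u A X Lf own"
    and sparse: "sparse E (V \<union> Y) s \<epsilon>" "0 \<le> \<epsilon>" "2 * \<epsilon> * (2 + real A) < \<gamma>"
    and s: "(real u + real (card Y)) * (2 + real A) \<le> s"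
    and sparse': "sparse E (V \<union> Y) s' \<epsilon>'" "0 \<le> \<epsilon>'" "4 * \<epsilon>' < \<gamma>'"
    and dense: "dense E (V \<union> Y) (s' / 2) r' b'" "0 < b'" "0 < s'"
    and Yg: "Yg = well_attached E X Lf Y \<gamma>" and U: "U = V - X - Lf"
    and D: "D = {v\<in>U. deg_in E v Yg < \<gamma>'}"
    and many: "real u + r' \<le> real (card Yg)"
  shows "total_acquisition_number (V \<union> Y) E \<le>
     r + card {v\<in>D \<union> (Y - Yg). deg_in E v (X \<union> Lf \<union> (U - D)) < \<gamma>}"
proof -
  let ?W = "V \<union> Y"
  have finW: "finite ?W" using fin by simp
  have core': "X \<subseteq> V" "Lf \<subseteq> V" "X \<inter> Lf = {}" "card U = u"
    and own: "\<And>v. v \<in> Lf \<Longrightarrow> own v \<in> X \<and> {v, own v} \<in> E1"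
    and fib: "\<And>x. x \<in> X \<Longrightarrow> 5 \<le> card {v\<in>Lf. own v = x} \<and> card {v\<in>Lf. own v = x} \<le> A"
    and collapse: "\<And>w. (\<forall>x\<in>X. card {v\<in>Lf. own v = x} \<le> w x \<and> w x \<le> card {v\<in>Lf. own v = x} + 6) \<Longrightarrow>
        (\<exists>R w'. finite R \<and> card R \<le> r \<and> reach E1 w w' \<and> {v. 0 < w' v} \<subseteq> R \<union> ({v. 0 < w v} - X))"
    using core unfolding core_structure_def U by auto
  have UV: "U \<subseteq> V" and YgY: "Yg \<subseteq> Y" and DU: "D \<subseteq> U" by (auto simp: U Yg D well_attached_def)
  have finX: "finite X" "finite Lf" "finite U" "finite Yg" "finite D"
    using finite_subset[OF core'(1) fin(1)] finite_subset[OF core'(2) fin(1)] finite_subset[OF UV fin(1)]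
      finite_subset[OF YgY fin(2)] finite_subset[OF DU] finite_subset[OF UV fin(1)] by auto
  define F where "F = {v\<in>D \<union> (Y - Yg). \<gamma> \<le> deg_in E v (X \<union> Lf \<union> (U - D))}"
  define T where "T v = (if v \<in> Yg then nbr E v \<inter> Lf else nbr E v \<inter> (X \<union> Lf \<union> (U - D)))" for v
  define I where "I = F \<union> Yg"
  define g where "g v = (if v \<in> Lf then own v else v)" for v
  have FY: "v \<notin> Yg" if "v \<in> F" for v using that DU UV YgY fin(3) by (auto simp: F_def)
  have IW: "I \<subseteq> U \<union> Y" using DU YgY by (auto simp: I_def F_def)
  have cI: "card I \<le> u + card Y"
  proof -
    have "card I \<le> card (U \<union> Y)" using IW finX fin by (intro card_mono) auto
    also have "\<dots> \<le> card U + card Y" by (rule card_Un_le)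
    finally show ?thesis using core'(4) by simp
  qed
  obtain \<tau> where tau: "inj_on (\<lambda>i. g (\<tau> i)) I" "\<And>i. i \<in> I \<Longrightarrow> \<tau> i \<in> T i"
  proof -
    have "\<exists>\<tau>. inj_on (\<lambda>i. g (\<tau> i)) I \<and> (\<forall>i\<in>I. \<tau> i \<in> T i)"
    \<comment> \<open>An owner group consists of the owner and at most \<open>A\<close> leaves,
      hence \<open>a = Suc A\<close>.\<close>
    proof (rule matching_sparse[OF finW E sparse(1,2), where a = "Suc A" and \<gamma> = \<gamma>])
      show "I \<subseteq> ?W" using IW UV by blast
      have "real (card I) * (1 + real (Suc A)) \<le> (real u + real (card Y)) * (2 + real A)"
        using cI by (intro mult_mono) auto
      then show "real (card I) * (1 + real (Suc A)) \<le> s" using s by linarith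
      show "T i \<subseteq> nbr E i" for i by (auto simp: T_def)
      show "\<gamma> \<le> real (card (T i))" if i: "i \<in> I" for i
      proof (cases "i \<in> Yg")
        case True
        then have "\<gamma> \<le> deg_in E i Lf" unfolding Yg well_attached_def by simp
        then show ?thesis using True by (simp add: T_def)
      next
        case False
        then show ?thesis using i by (simp add: T_def I_def F_def)
      qed
      show "card {v\<in>\<Union>(T ` I). g v = z} \<le> Suc A" for z
      proof -
        have "{v\<in>\<Union>(T ` I). g v = z} \<subseteq> insert z {v\<in>Lf. own v = z}" by (auto simp: g_def split: if_splits)
        then have "card {v\<in>\<Union>(T ` I). g v = z} \<le> card (insert z {v\<in>Lf. own v = z})"
          using finX by (intro card_mono) auto
        also have "\<dots> \<le> Suc (card {v\<in>Lf. own v = z})" using finX by (simp add: card_insert_if)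
        also have "card {v\<in>Lf. own v = z} \<le> A"
        proof (cases "z \<in> X")
          case False
          then have none: "{v\<in>Lf. own v = z} = {}" using own by blast
          show ?thesis unfolding none by simp
        qed (use fib in simp)
        finally show ?thesis by simp
      qed
      show "2 * \<epsilon> * (1 + real (Suc A)) < \<gamma>" using sparse(3) by simp
    qed
    then show thesis using that by blast
  qed
  obtain \<rho> where rho: "inj_on \<rho> Yg" "\<And>i. i \<in> Yg \<Longrightarrow> \<rho> i \<in> nbr E i \<inter> X"
  proof -
    have "\<exists>\<tau>. inj_on (\<lambda>i. id (\<tau> i)) Yg \<and> (\<forall>i\<in>Yg. \<tau> i \<in> nbr E i \<inter> X)"
    proof (rule matching_sparse[OF finW E sparse(1,2), where a = 1 and \<gamma> = \<gamma>])
      show "Yg \<subseteq> ?W" using YgY by blast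
      have "real (card Yg) * (1 + real 1) \<le> (real u + real (card Y)) * (2 + real A)"
        using card_mono[OF fin(2) YgY] by (intro mult_mono) auto
      then show "real (card Yg) * (1 + real 1) \<le> s" using s by linarith
      show "\<gamma> \<le> deg_in E i X" if "i \<in> Yg" for i
        using that unfolding Yg well_attached_def by simp
      show "card {v\<in>\<Union>((\<lambda>i. nbr E i \<inter> X) ` Yg). id v = z} \<le> 1" for z
        using card_mono[of "{z}" "{v\<in>\<Union>((\<lambda>i. nbr E i \<inter> X) ` Yg). id v = z}"] by auto
      have "2 * \<epsilon> * (1 + real 1) \<le> 2 * \<epsilon> * (2 + real A)" using sparse(2) by (intro mult_left_mono) auto
      then show "2 * \<epsilon> * (1 + real 1) < \<gamma>" using sparse(3) by linarith
    qed auto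
    then show thesis using that by auto
  qed
  obtain \<psi> where psi: "inj_on \<psi> (U - D)" "\<And>i. i \<in> U - D \<Longrightarrow> \<psi> i \<in> nbr E i \<inter> Yg"
  proof -
    have gam: "\<gamma>' \<le> deg_in E i Yg" if "i \<in> U - D" for i using that by (auto simp: D)
    have "card J \<le> card (\<Union>i\<in>J. nbr E i \<inter> Yg)" if J: "J \<subseteq> U - D" for J
    proof (cases "real (card J) * 2 \<le> s'")
      case True
      have JW: "J \<subseteq> ?W" using J UV by blast
      have "card J \<le> card (id ` (\<Union>i\<in>J. nbr E i \<inter> Yg))"
      proof (rule match_sparse[OF finW E sparse'(1,2) JW, where a = 1 and \<gamma> = \<gamma>'])
        show "card {v\<in>\<Union>((\<lambda>i. nbr E i \<inter> Yg) ` J). id v = z} \<le> 1" for z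
          using card_mono[of "{z}" "{v\<in>\<Union>((\<lambda>i. nbr E i \<inter> Yg) ` J). id v = z}"] by auto
      qed (use True gam J sparse' in auto)
      then show ?thesis by simp
    next
      case False
      \<comment> \<open>By density fewer than \<open>r'\<close> vertices of \<open>Yg\<close> miss
        \<open>J\<close>, and \<open>Yg\<close> is larger than \<open>U\<close> by at least
        \<open>r'\<close>.\<close>
      define M where "M = (\<Union>i\<in>J. nbr E i \<inter> Yg)"
      have MY: "M \<subseteq> Yg" by (auto simp: M_def)
      have "real (card (Yg - M)) < r'"
      proof (rule ccontr)
        assume "\<not> ?thesis"
        then have "J \<subseteq> ?W \<and> Yg - M \<subseteq> ?W \<and> J \<inter> (Yg - M) = {} \<and> s' / 2 \<le> real (card J) \<and> r' \<le> real (card (Yg - M))"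
          using False J UV YgY fin(3) by auto
        then have "b' * real (card J) \<le> real (card (E \<inter> between J (Yg - M)))"
          using dense(1) unfolding dense_def by blast
        moreover have "E \<inter> between J (Yg - M) = {}" by (auto simp: between_def M_def nbr_def)
        moreover have "0 < b' * real (card J)" using dense(2,3) False by simp
        ultimately show False by simp
      qed
      moreover have "real (card (Yg - M)) = real (card Yg) - real (card M)"
        using card_Diff_subset[OF finite_subset[OF MY finX(4)] MY] card_mono[OF finX(4) MY] by simp
      moreover have "card J \<le> u" using card_mono[OF finX(3), of J] J core'(4) by auto
      ultimately have "real (card J) \<le> real (card M)" using many by linarith
      then show ?thesis by (simp add: M_def)
    qed
    then have "\<exists>f. inj_on f (U - D) \<and> (\<forall>i\<in>U-D. f i \<in> nbr E i \<inter> Yg)"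
      using finX by (intro hall) auto
    then show thesis using that by blast
  qed
  have tauF: "{v, \<tau> v} \<in> E \<and> \<tau> v \<in> X \<union> Lf \<union> (U - D)" if "v \<in> F" for v
    using tau(2)[of v] that FY[OF that] by (simp add: I_def T_def nbr_def)
  have tauY: "{y, \<tau> y} \<in> E \<and> \<tau> y \<in> Lf" if "y \<in> Yg" for y
    using tau(2)[of y] that by (simp add: I_def T_def nbr_def)
  have "\<exists>w. reach E (initial_weight ?W) w \<and>
    (\<forall>x\<in>X. card {v\<in>Lf. own v = x} \<le> w x \<and> w x \<le> card {v\<in>Lf. own v = x} + 6) \<and>
    {v. 0 < w v} \<subseteq> X \<union> ((D \<union> (Y - Yg)) - F)"
  proof (rule absorb_uncovered[where U = U and \<tau> = \<tau> and \<psi> = \<psi> and \<rho> = \<rho>])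
    show "?W = X \<union> Lf \<union> U \<union> Y" using core' by (auto simp: U)
    show "F \<subseteq> D \<union> (Y - Yg)" by (auto simp: F_def)
    show "inj_on (\<lambda>v. if \<tau> v \<in> Lf then own (\<tau> v) else \<tau> v) (F \<union> Yg)"
      using tau(1) unfolding I_def g_def .
    show "X \<inter> Y = {}" "Lf \<inter> Y = {}" "U \<inter> Y = {}" using fin(3) core' UV by blast+
    show "own v \<in> X \<and> {v, own v} \<in> E" if "v \<in> Lf" for v using own[OF that] E1 by blast
    show "{u, \<psi> u} \<in> E \<and> \<psi> u \<in> Yg" if "u \<in> U - D" for u using psi(2)[OF that] by (simp add: nbr_def)
    show "{y, \<rho> y} \<in> E \<and> \<rho> y \<in> X" if "y \<in> Yg" for y using rho(2)[OF that] by (simp add: nbr_def)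
  qed (use finW core' YgY DU fib tauF tauY psi(1) rho(1) in \<open>auto simp: U\<close>)
  then obtain w where w: "reach E (initial_weight ?W) w" "{v. 0 < w v} \<subseteq> X \<union> ((D \<union> (Y - Yg)) - F)"
    and wX: "\<forall>x\<in>X. card {v\<in>Lf. own v = x} \<le> w x \<and> w x \<le> card {v\<in>Lf. own v = x} + 6" by blast
  from collapse[OF wX] obtain R w' where R: "finite R" "card R \<le> r" "reach E1 w w'"
    "{v. 0 < w' v} \<subseteq> R \<union> ({v. 0 < w v} - X)" by blast
  define Ex where "Ex = {v\<in>D \<union> (Y - Yg). deg_in E v (X \<union> Lf \<union> (U - D)) < \<gamma>}"
  have "(D \<union> (Y - Yg)) - F \<subseteq> Ex" by (auto simp: Ex_def F_def)
  then have sub: "{v. 0 < w' v} \<subseteq> R \<union> Ex" using R(4) w(2) by blast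
  have finEx: "finite Ex" unfolding Ex_def using finX fin(2) by auto
  have "total_acquisition_number ?W E \<le> card {v. 0 < w' v}"
    by (rule total_acquisition_number_le[OF finW reach_trans[OF w(1) reach_mono[OF E1 R(3)]]])
  also have "\<dots> \<le> card (R \<union> Ex)" using R(1) finEx by (intro card_mono[OF _ sub]) auto
  also have "\<dots> \<le> r + card Ex" using card_Un_le[of R Ex] R(2) by linarith
  finally show ?thesis unfolding Ex_def .
qed

subsection \<open>Random subsets\<close>

text \<open>The ground set is arbitrary because the two rounds of exposure sample disjoint sets of
  edges.\<close>

definition random_subset :: "'a set \<Rightarrow> real \<Rightarrow> 'a set pmf" where
  "random_subset A p = map_pmf (\<lambda>X. {e \<in> A. X e}) (Pi_pmf A False (\<lambda>_. bernoulli_pmf p))"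

lemma binomial_random_graph_eq: "binomial_random_graph n p = random_subset (all_edges {1..n}) p"
  by (simp add: binomial_random_graph_def random_subset_def)

lemma finite_all_edges: "finite V \<Longrightarrow> finite (all_edges V)"
  by (rule finite_subset[of _ "Pow V"]) (auto simp: all_edges_def)

lemma set_random_subset: "set_pmf (random_subset A p) \<subseteq> Pow A"
  by (auto simp: random_subset_def)

text \<open>A Chernoff bound for both tails at once: the condition on \<open>z\<close> says that
  \<open>E \<inter> F\<close> is large if \<open>z > 1\<close> and small if \<open>z < 1\<close>.
  The elements of \<open>F0\<close> must be present and, being disjoint from \<open>F\<close>,
  contribute an independent factor \<open>p\<close> each.\<close>

lemma random_subset_tail:
  fixes a z p :: real
  assumes fin: "finite A" and F: "F0 \<subseteq> A" "F \<subseteq> A" "F0 \<inter> F = {}" and p: "0 \<le> p" "p \<le> 1" and z: "0 < z"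
  shows "measure_pmf.prob (random_subset A p) {E. F0 \<subseteq> E \<and> z powr a \<le> z ^ card (E \<inter> F)} \<le>
     p ^ card F0 * exp (real (card F) * p * (z - 1)) * z powr (- a)"
proof -
  let ?M = "Pi_pmf A False (\<lambda>_. bernoulli_pmf p)"
  \<comment> \<open>The integrand as a product over single elements: an indicator on
    \<open>F0\<close>, the exponential weight on \<open>F\<close>.\<close>
  define h where "h e b = (if e \<in> F0 then of_bool b else if e \<in> F \<and> b then z else 1)" for e :: 'a and b :: bool
  have h0: "0 \<le> h e b" for e b using z by (auto simp: h_def)
  have finF: "finite F0" "finite F" using finite_subset[OF F(1) fin] finite_subset[OF F(2) fin] by auto
  have prodh: "(\<Prod>e\<in>A. h e (X e)) = of_bool (F0 \<subseteq> {e\<in>A. X e}) * z ^ card ({e\<in>A. X e} \<inter> F)" for X :: "'a \<Rightarrow> bool"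
  proof -
    have "(\<Prod>e\<in>A. h e (X e)) = (\<Prod>e\<in>A - F0. h e (X e)) * (\<Prod>e\<in>F0. h e (X e))"
      by (rule prod.subset_diff[OF F(1) fin])
    also have "(\<Prod>e\<in>A - F0. h e (X e)) = (\<Prod>e\<in>(A - F0) - F. h e (X e)) * (\<Prod>e\<in>F. h e (X e))"
      using F fin by (intro prod.subset_diff) auto
    also have "(\<Prod>e\<in>(A - F0) - F. h e (X e)) = 1" by (rule prod.neutral) (auto simp: h_def)
    also have "(\<Prod>e\<in>F. h e (X e)) = (\<Prod>e\<in>F. if e \<in> {e\<in>A. X e} then z else 1)"
      using F by (intro prod.cong) (auto simp: h_def)
    also have "\<dots> = z ^ card ({e\<in>A. X e} \<inter> F)"
      using finF by (subst prod.inter_filter[symmetric]) (auto intro!: arg_cong[of _ _ "\<lambda>S. z ^ card S"])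
    also have "(\<Prod>e\<in>F0. h e (X e)) = (\<Prod>e\<in>F0. of_bool (X e))"
      by (intro prod.cong) (auto simp: h_def)
    also have "\<dots> = of_bool (F0 \<subseteq> {e\<in>A. X e})"
    proof (cases "F0 \<subseteq> {e\<in>A. X e}")
      case True
      then show ?thesis by (auto intro!: prod.neutral)
    next
      case False
      then obtain e where "e \<in> F0" "\<not> X e" using F(1) by auto
      then have "(\<Prod>e\<in>F0. of_bool (X e) :: real) = 0" using finF by (intro prod_zero) auto
      then show ?thesis using False by simp
    qed
    finally show ?thesis by simp
  qed
  let ?S = "{X. F0 \<subseteq> {e\<in>A. X e} \<and> z powr a \<le> z ^ card ({e\<in>A. X e} \<inter> F)}"
  have finM: "finite (set_pmf ?M)"
    by (rule finite_subset[OF set_Pi_pmf_subset'[OF fin]]) (use fin in auto)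
  have "measure_pmf.prob (random_subset A p) {E. F0 \<subseteq> E \<and> z powr a \<le> z ^ card (E \<inter> F)} * z powr a =
     measure_pmf.expectation ?M (indicator ?S) * z powr a"
    by (simp add: random_subset_def vimage_def)
  also have "\<dots> = measure_pmf.expectation ?M (\<lambda>X. indicator ?S X * z powr a)" by simp
  also have "\<dots> \<le> measure_pmf.expectation ?M (\<lambda>X. \<Prod>e\<in>A. h e (X e))"
    by (intro integral_mono integrable_measure_pmf_finite finM)
      (unfold prodh, use z in \<open>auto simp: indicator_def\<close>)
  also have "\<dots> = (\<Prod>e\<in>A. measure_pmf.expectation (bernoulli_pmf p) (h e))"
    by (intro expectation_prod_Pi_pmf fin integrable_measure_pmf_finite) (use h0 in auto)
  also have "\<dots> = (\<Prod>e\<in>A. h e True * p + h e False * (1 - p))" using p by simp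
  also have "\<dots> \<le> (\<Prod>e\<in>A. if e \<in> F0 then p else if e \<in> F then exp (p * (z - 1)) else 1)"
  proof (rule prod_mono, rule conjI)
    fix e assume "e \<in> A"
    show "0 \<le> h e True * p + h e False * (1 - p)" using h0 p by simp
    have "z * p + (1 - p) \<le> exp (p * (z - 1))"
      using exp_ge_add_one_self[of "p * (z - 1)"] by (simp add: algebra_simps)
    then show "h e True * p + h e False * (1 - p) \<le> (if e \<in> F0 then p else if e \<in> F then exp (p * (z - 1)) else 1)"
      by (simp add: h_def)
  qed
  also have "\<dots> = (\<Prod>e\<in>A - F0. if e \<in> F then exp (p * (z - 1)) else 1) * (\<Prod>e\<in>F0. p)"
    by (subst prod.subset_diff[OF F(1) fin]) (auto intro!: arg_cong2[of _ _ _ _ "(*)"] prod.cong)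
  also have "(\<Prod>e\<in>A - F0. if e \<in> F then exp (p * (z - 1)) else 1) = (\<Prod>e\<in>F. exp (p * (z - 1)))"
    using F fin by (intro prod.mono_neutral_cong_right) auto
  also have "\<dots> = exp (real (card F) * p * (z - 1))"
    by (simp add: exp_of_nat_mult[symmetric] mult.assoc)
  finally have "measure_pmf.prob (random_subset A p) {E. F0 \<subseteq> E \<and> z powr a \<le> z ^ card (E \<inter> F)} * z powr a \<le>
    exp (real (card F) * p * (z - 1)) * p ^ card F0" by simp
  then show ?thesis using z by (simp add: powr_minus field_simps)
qed

lemma prob_card_ge:
  fixes a z p :: real
  assumes "finite A" "F0 \<subseteq> A" "F \<subseteq> A" "F0 \<inter> F = {}" "0 \<le> p" "p \<le> 1" "1 \<le> z"
  shows "measure_pmf.prob (random_subset A p) {E. F0 \<subseteq> E \<and> a \<le> real (card (E \<inter> F))} \<le>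
     p ^ card F0 * exp (real (card F) * p * (z - 1)) * z powr (- a)"
proof -
  have "measure_pmf.prob (random_subset A p) {E. F0 \<subseteq> E \<and> a \<le> real (card (E \<inter> F))} \<le>
    measure_pmf.prob (random_subset A p) {E. F0 \<subseteq> E \<and> z powr a \<le> z ^ card (E \<inter> F)}"
  proof (intro measure_pmf.finite_measure_mono Collect_mono impI)
    fix E assume "F0 \<subseteq> E \<and> a \<le> real (card (E \<inter> F))"
    then show "F0 \<subseteq> E \<and> z powr a \<le> z ^ card (E \<inter> F)"
      using assms(7) powr_mono[of a "real (card (E \<inter> F))" z] by (simp add: powr_realpow)
  qed simp
  also have "\<dots> \<le> p ^ card F0 * exp (real (card F) * p * (z - 1)) * z powr (- a)"
    using assms by (intro random_subset_tail) auto
  finally show ?thesis .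
qed

lemma prob_card_le:
  fixes a z p :: real
  assumes "finite A" "F0 \<subseteq> A" "F \<subseteq> A" "F0 \<inter> F = {}" "0 \<le> p" "p \<le> 1" "0 < z" "z \<le> 1"
  shows "measure_pmf.prob (random_subset A p) {E. F0 \<subseteq> E \<and> real (card (E \<inter> F)) \<le> a} \<le>
     p ^ card F0 * exp (real (card F) * p * (z - 1)) * z powr (- a)"
proof -
  have "measure_pmf.prob (random_subset A p) {E. F0 \<subseteq> E \<and> real (card (E \<inter> F)) \<le> a} \<le>
    measure_pmf.prob (random_subset A p) {E. F0 \<subseteq> E \<and> z powr a \<le> z ^ card (E \<inter> F)}"
  proof (intro measure_pmf.finite_measure_mono Collect_mono impI)
    fix E assume "F0 \<subseteq> E \<and> real (card (E \<inter> F)) \<le> a"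
    then show "F0 \<subseteq> E \<and> z powr a \<le> z ^ card (E \<inter> F)"
      using assms(7,8) powr_mono'[of "real (card (E \<inter> F))" a z] by (simp add: powr_realpow)
  qed simp
  also have "\<dots> \<le> p ^ card F0 * exp (real (card F) * p * (z - 1)) * z powr (- a)"
    using assms by (intro random_subset_tail) auto
  finally show ?thesis .
qed

lemma random_subset_union:
  assumes "finite A" "finite B" "A \<inter> B = {}"
  shows "random_subset (A \<union> B) p = map_pmf (\<lambda>(x, y). x \<union> y) (pair_pmf (random_subset A p) (random_subset B p))"
proof -
  have eq: "{e \<in> A \<union> B. if e \<in> A then f e else g e} = {e\<in>A. f e} \<union> {e\<in>B. g e}" for f g
    using assms(3) by auto
  show ?thesis
    unfolding random_subset_def Pi_pmf_union[OF assms] map_pair[symmetric] pmf.map_comp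
    by (intro pmf.map_cong refl) (use eq in fastforce)
qed

lemma random_subset_restrict:
  assumes "finite A" "finite B" "A \<inter> B = {}"
  shows "map_pmf (\<lambda>E. E \<inter> A) (random_subset (A \<union> B) p) = random_subset A p"
proof -
  have "map_pmf (\<lambda>E. E \<inter> A) (random_subset (A \<union> B) p) =
     map_pmf fst (pair_pmf (random_subset A p) (random_subset B p))"
    unfolding random_subset_union[OF assms] pmf.map_comp
  proof (intro pmf.map_cong refl)
    fix z assume "z \<in> set_pmf (pair_pmf (random_subset A p) (random_subset B p))"
    then have "fst z \<in> set_pmf (random_subset A p)" "snd z \<in> set_pmf (random_subset B p)" by auto
    then have "fst z \<subseteq> A" "snd z \<subseteq> B"
      using set_random_subset[of A p] set_random_subset[of B p] by blast+
    then show "((\<lambda>E. E \<inter> A) \<circ> (\<lambda>(x, y). x \<union> y)) z = fst z"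
      using assms(3) by (cases z) auto
  qed
  then show ?thesis by (simp add: map_fst_pair_pmf)
qed

text \<open>The second round is independent of the first, so it may be analysed for each fixed good
  outcome \<open>E1\<close>. Objects constructed from the first round thereby become
  deterministic.\<close>

lemma two_round_exposure:
  assumes AB: "finite A" "finite B" "A \<inter> B = {}" and b: "0 \<le> b"
    and second: "\<And>E1. E1 \<subseteq> A \<Longrightarrow> good E1 \<Longrightarrow> measure_pmf.prob (random_subset B p) {E2. \<not> Q (E1 \<union> E2)} \<le> b"
  shows "measure_pmf.prob (random_subset (A \<union> B) p) {E. \<not> Q E} \<le>
    measure_pmf.prob (random_subset (A \<union> B) p) {E. \<not> good (E \<inter> A)} + b"
proof -
  let ?A = "random_subset A p" and ?B = "random_subset B p"
  have first: "measure_pmf.prob (random_subset (A \<union> B) p) {E. \<not> good (E \<inter> A)} = measure_pmf.prob ?A {E. \<not> good E}"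
    by (subst random_subset_restrict[OF AB, symmetric]) (simp add: vimage_def)
  have bind: "random_subset (A \<union> B) p = bind_pmf ?A (\<lambda>x. map_pmf (\<lambda>y. x \<union> y) ?B)"
    unfolding random_subset_union[OF AB] pair_pmf_def map_bind_pmf
    by (simp add: map_pmf_def bind_assoc_pmf bind_return_pmf)
  have "ennreal (measure_pmf.prob (random_subset (A \<union> B) p) {E. \<not> Q E}) =
      emeasure (measure_pmf (random_subset (A \<union> B) p)) {E. \<not> Q E}"
    by (simp add: measure_pmf.emeasure_eq_measure)
  also have "\<dots> =
      (\<integral>\<^sup>+ x. emeasure (measure_pmf (map_pmf (\<lambda>y. x \<union> y) ?B)) {E. \<not> Q E} \<partial>measure_pmf ?A)"
    unfolding bind by (rule emeasure_bind_pmf)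
  also have "\<dots> \<le> (\<integral>\<^sup>+ x. indicator {E. \<not> good E} x + ennreal b \<partial>measure_pmf ?A)"
  proof (rule nn_integral_mono_AE, rule AE_pmfI)
    fix x assume "x \<in> set_pmf ?A"
    then have x: "x \<subseteq> A" using set_random_subset[of A p] by auto
    show "emeasure (measure_pmf (map_pmf (\<lambda>y. x \<union> y) ?B)) {E. \<not> Q E} \<le> indicator {E. \<not> good E} x + ennreal b"
    proof (cases "good x")
      case True
      have "emeasure (measure_pmf (map_pmf (\<lambda>y. x \<union> y) ?B)) {E. \<not> Q E} =
          ennreal (measure_pmf.prob ?B {E2. \<not> Q (x \<union> E2)})"
        by (simp add: measure_pmf.emeasure_eq_measure vimage_def)
      also have "\<dots> \<le> ennreal b" using second[OF x True] by (rule ennreal_leI)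
      finally show ?thesis by (simp add: add_increasing)
    next
      case False
      have "emeasure (measure_pmf (map_pmf (\<lambda>y. x \<union> y) ?B)) {E. \<not> Q E} \<le> 1"
        by (rule measure_pmf.emeasure_le_1)
      then show ?thesis using False by (simp add: add_increasing2)
    qed
  qed
  also have "\<dots> = emeasure (measure_pmf ?A) {E. \<not> good E} + ennreal b"
    by (subst nn_integral_add) (auto simp: measure_pmf.emeasure_space_1)
  also have "\<dots> = ennreal (measure_pmf.prob ?A {E. \<not> good E}) + ennreal b"
    by (simp add: measure_pmf.emeasure_eq_measure)
  finally show ?thesis unfolding first using b
    by (subst (asm) ennreal_plus[symmetric]) (auto simp del: ennreal_plus)
qed

lemma prob_UN_le:
  assumes "finite I"
  shows "measure_pmf.prob M {x. \<exists>i\<in>I. P i x} \<le> (\<Sum>i\<in>I. measure_pmf.prob M {x. P i x})"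
proof -
  have "{x. \<exists>i\<in>I. P i x} = (\<Union>i\<in>I. {x. P i x})" by auto
  then show ?thesis using measure_pmf.finite_measure_subadditive_finite[OF assms, of "\<lambda>i. {x. P i x}" M] by simp
qed

text \<open>Markov's inequality, with the expected number obtained by linearity.\<close>

lemma prob_count_ge:
  fixes b t :: real
  assumes fin: "finite I" and t: "0 < t" and b: "\<And>i. i \<in> I \<Longrightarrow> measure_pmf.prob M {x. P i x} \<le> b"
  shows "measure_pmf.prob M {x. t \<le> real (card {i\<in>I. P i x})} \<le> real (card I) * b / t"
proof -
  let ?f = "\<lambda>x. \<Sum>i\<in>I. indicator {x. P i x} x :: real"
  have cnt: "real (card {i\<in>I. P i x}) = ?f x" for x
    using fin by (simp add: indicator_def sum.If_cases Int_def)
  have int: "integrable (measure_pmf M) (\<lambda>x. indicator {x. P i x} x :: real)" for i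
    by (rule measure_pmf.integrable_const_bound[where B = 1]) auto
  have "measure_pmf.prob M {x. t \<le> ?f x} \<le> measure_pmf.expectation M ?f / t"
    using integral_Markov_inequality_measure[of "measure_pmf M" ?f "{}" t] int t
    by (auto simp: sum_nonneg)
  also have "measure_pmf.expectation M ?f = (\<Sum>i\<in>I. measure_pmf.prob M {x. P i x})"
    using int by (simp add: Bochner_Integration.integral_sum)
  also have "\<dots> \<le> (\<Sum>i\<in>I. b)" using b by (intro sum_mono)
  finally show ?thesis using t by (simp add: cnt divide_right_mono)
qed

section \<open>Union bounds over vertex sets\<close>

lemma sum_Pow_power_card:
  fixes x :: real
  assumes "finite V"
  shows "(\<Sum>W\<in>Pow V. x ^ card W) = (1 + x) ^ card V"
  using assms
proof (induction V rule: finite_induct)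
  case (insert v V)
  have "(\<Sum>W\<in>Pow (insert v V). x ^ card W) = (\<Sum>W\<in>Pow V. x ^ card W) + (\<Sum>W\<in>insert v ` Pow V. x ^ card W)"
    unfolding Pow_insert using insert.hyps by (intro sum.union_disjoint) auto
  also have "(\<Sum>W\<in>insert v ` Pow V. x ^ card W) = (\<Sum>W\<in>Pow V. x ^ card (insert v W))"
    using insert.hyps by (subst sum.reindex) (auto simp: inj_on_def)
  also have "\<dots> = (\<Sum>W\<in>Pow V. x * x ^ card W)"
  proof (rule sum.cong[OF refl])
    fix W assume "W \<in> Pow V"
    then have "finite W" "v \<notin> W" using insert.hyps finite_subset[of W V] by auto
    then show "x ^ card (insert v W) = x * x ^ card W" by simp
  qed
  finally show ?case using insert by (simp add: sum_distrib_left[symmetric] algebra_simps)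
qed simp

text \<open>Each counted set has weight \<open>y ^ card T\<close> at least \<open>y powr t\<close>,
  while all subsets together weigh \<open>(1 + y) ^ card V\<close>. The choice
  \<open>y = t / card V\<close> recovers the familiar bound
  \<open>(exp 1 * card V / t) powr t\<close>.\<close>

lemma card_small_subsets:
  fixes y t :: real
  assumes "finite V" "0 < y" "y \<le> 1"
  shows "real (card {T. T \<subseteq> V \<and> real (card T) \<le> t}) \<le> exp (real (card V) * y) * y powr (- t)"
proof -
  let ?S = "{T. T \<subseteq> V \<and> real (card T) \<le> t}"
  have fin: "finite ?S" using assms(1) by simp
  have "real (card ?S) * y powr t = (\<Sum>T\<in>?S. y powr t)" by simp
  also have "\<dots> \<le> (\<Sum>T\<in>?S. y ^ card T)"
  proof (rule sum_mono)
    fix T assume "T \<in> ?S"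
    then show "y powr t \<le> y ^ card T"
      using assms powr_mono'[of "real (card T)" t y] by (simp add: powr_realpow)
  qed
  also have "\<dots> \<le> (\<Sum>T\<in>Pow V. y ^ card T)"
    using assms by (intro sum_mono2) auto
  also have "\<dots> = (1 + y) ^ card V" by (rule sum_Pow_power_card[OF assms(1)])
  also have "\<dots> \<le> exp y ^ card V" using assms(2) by (intro power_mono exp_ge_add_one_self) auto
  also have "\<dots> = exp (real (card V) * y)" by (simp add: exp_of_nat_mult)
  finally show ?thesis using assms(2) by (simp add: powr_minus field_simps)
qed

text \<open>At most \<open>n ^ k\<close> sets have size \<open>k\<close>, so a failure probability
  of \<open>n powr (- 3 * k)\<close> for each of them leaves a total of order
  \<open>n powr (- 2)\<close>.\<close>

lemma prob_subsets_le:
  fixes n :: nat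
  assumes V: "finite V" "card V = n" and n: "2 \<le> n"
    and P: "\<And>W. W \<subseteq> V \<Longrightarrow> W \<noteq> {} \<Longrightarrow> measure_pmf.prob M {x. P W x} \<le> exp (- 3 * real (card W) * ln (real n))"
  shows "measure_pmf.prob M {x. \<exists>W\<subseteq>V. W \<noteq> {} \<and> P W x} \<le> 2 / real n"
proof -
  let ?x = "1 / real n ^ 3"
  have e: "exp (- 3 * real k * ln (real n)) = ?x ^ k" for k
  proof -
    have "exp (- 3 * real k * ln (real n)) = exp (real k * (- (3 * ln (real n))))" by (simp add: mult_ac)
    also have "\<dots> = exp (- (3 * ln (real n))) ^ k" by (rule exp_of_nat_mult)
    also have "exp (- (3 * ln (real n))) = ?x"
      using n by (simp add: exp_minus exp_of_nat_mult[of 3, simplified] divide_simps)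
    finally show ?thesis .
  qed
  have "{x. \<exists>W\<subseteq>V. W \<noteq> {} \<and> P W x} = {x. \<exists>W\<in>Pow V - {{}}. P W x}" by auto
  then have "measure_pmf.prob M {x. \<exists>W\<subseteq>V. W \<noteq> {} \<and> P W x} \<le> (\<Sum>W\<in>Pow V - {{}}. measure_pmf.prob M {x. P W x})"
    using V prob_UN_le[of "Pow V - {{}}" M P] by simp
  also have "\<dots> \<le> (\<Sum>W\<in>Pow V - {{}}. ?x ^ card W)"
    using P unfolding e by (intro sum_mono) auto
  also have "\<dots> = (1 + ?x) ^ n - 1"
    using V sum_Pow_power_card[OF V(1), of ?x] by (simp add: sum_diff1)
  also have "(1 + ?x) ^ n \<le> exp ?x ^ n" by (intro power_mono exp_ge_add_one_self) auto
  also have "exp ?x ^ n = exp (real n * ?x)" by (rule exp_of_nat_mult[symmetric])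
  also have "\<dots> \<le> 1 + real n * ?x + (real n * ?x)\<^sup>2"
  proof (rule exp_bound)
    have "1 * 1 \<le> real n * real n" using n by (intro mult_mono) auto
    then show "real n * ?x \<le> 1" using n by (simp add: divide_simps power3_eq_cube)
  qed simp
  also have "1 + real n * ?x + (real n * ?x)\<^sup>2 - 1 \<le> 2 / real n"
  proof -
    have a: "real n * ?x = 1 / real n * (1 / real n)" using n by (simp add: power3_eq_cube)
    have "1 / real n * (1 / real n) \<le> 1 / real n * 1" using n by (intro mult_left_mono) auto
    then have b: "real n * ?x \<le> 1 / real n" unfolding a by simp
    have "(real n * ?x)\<^sup>2 \<le> (1 / real n)\<^sup>2" using b by (intro power_mono) auto
    also have "\<dots> \<le> 1 / real n" using n by (simp add: divide_simps power2_eq_square)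
    finally show ?thesis using b by simp
  qed
  finally show ?thesis by simp
qed

subsection \<open>Random graphs of logarithmic average degree\<close>

text \<open>Here \<open>\<alpha>\<close> is the limiting average degree in units of
  \<open>ln n\<close>; the theorem is the case \<open>\<alpha> = c / ln 2\<close>.\<close>

locale random_graph_regime =
  fixes p :: "nat \<Rightarrow> real" and \<alpha> :: real
  assumes p01: "\<And>n. 0 \<le> p n \<and> p n \<le> 1" and \<alpha>: "0 < \<alpha>"
    and lim: "(\<lambda>n. real n * p n / ln (real n)) \<longlonglongrightarrow> \<alpha>"
begin

abbreviation "\<G> n \<equiv> binomial_random_graph n (p n)"

lemma ev_upper: "\<alpha> < C \<Longrightarrow> \<forall>\<^sub>F n in sequentially. real n * p n \<le> C * ln (real n)"
proof -
  assume "\<alpha> < C"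
  then have "\<forall>\<^sub>F n in sequentially. real n * p n / ln (real n) < C" using lim order_tendstoD(2) by blast
  then show ?thesis using eventually_ge_at_top[of 3]
    by eventually_elim (simp add: divide_simps less_imp_le)
qed

lemma ev_lower: "C < \<alpha> \<Longrightarrow> \<forall>\<^sub>F n in sequentially. C * ln (real n) \<le> real n * p n"
proof -
  assume "C < \<alpha>"
  then have "\<forall>\<^sub>F n in sequentially. C < real n * p n / ln (real n)" using lim order_tendstoD(1) by blast
  then show ?thesis using eventually_ge_at_top[of 3]
    by eventually_elim (simp add: divide_simps less_imp_le)
qed

definition whp :: "(nat \<Rightarrow> nat set set \<Rightarrow> bool) \<Rightarrow> bool" where
  "whp P \<longleftrightarrow> (\<lambda>n. measure_pmf.prob (\<G> n) {E. \<not> P n E}) \<longlonglongrightarrow> 0"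

lemma whpI:
  assumes "\<forall>\<^sub>F n in sequentially. measure_pmf.prob (\<G> n) {E. \<not> P n E} \<le> b n" "b \<longlonglongrightarrow> 0"
  shows "whp P"
  unfolding whp_def
  by (rule tendsto_sandwich[OF _ assms(1) tendsto_const assms(2)]) simp

lemma AE_subset: "AE E in measure_pmf (binomial_random_graph n q). E \<subseteq> all_edges {1..n}"
  using set_random_subset[of "all_edges {1..n}" q] by (auto simp: AE_measure_pmf_iff binomial_random_graph_eq)

lemma whp_conj: "whp P \<Longrightarrow> whp Q \<Longrightarrow> whp (\<lambda>n E. P n E \<and> Q n E)"
proof -
  assume "whp P" "whp Q"
  then have "(\<lambda>n. measure_pmf.prob (\<G> n) {E. \<not> P n E} +
     measure_pmf.prob (\<G> n) {E. \<not> Q n E}) \<longlonglongrightarrow> 0 + 0"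
    unfolding whp_def by (rule tendsto_add)
  then show ?thesis
  proof (intro whpI[OF always_eventually])
    show "\<forall>n. measure_pmf.prob (\<G> n) {E. \<not> (P n E \<and> Q n E)} \<le>
      measure_pmf.prob (\<G> n) {E. \<not> P n E} +
      measure_pmf.prob (\<G> n) {E. \<not> Q n E}"
    proof
      fix n
      have "{E. \<not> (P n E \<and> Q n E)} = {E. \<not> P n E} \<union> {E. \<not> Q n E}" by auto
      then show "measure_pmf.prob (\<G> n) {E. \<not> (P n E \<and> Q n E)} \<le>
      measure_pmf.prob (\<G> n) {E. \<not> P n E} +
      measure_pmf.prob (\<G> n) {E. \<not> Q n E}"
        by (simp add: measure_Un_le)
    qed
  qed simp
qed

lemma whp_mono:
  assumes "whp P" "\<forall>\<^sub>F n in sequentially. \<forall>E\<subseteq>all_edges {1..n}. P n E \<longrightarrow> Q n E"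
  shows "whp Q"
proof (rule whpI[OF _ assms(1)[unfolded whp_def]])
  show "\<forall>\<^sub>F n in sequentially. measure_pmf.prob (\<G> n) {E. \<not> Q n E} \<le>
      measure_pmf.prob (\<G> n) {E. \<not> P n E}"
    using assms(2)
  proof eventually_elim
    case (elim n)
    show ?case
    proof (rule measure_pmf.finite_measure_mono_AE)
      show "AE E in measure_pmf (\<G> n). E \<in> {E. \<not> Q n E} \<longrightarrow> E \<in> {E. \<not> P n E}"
        using AE_subset[of n "p n"] by (rule AE_mp) (rule AE_I2, use elim in blast)
    qed simp
  qed
qed

text \<open>Sets of at most \<open>\<delta> * n\<close> vertices expect only a small multiple of
  \<open>ln n\<close> inner edges per vertex, so \<open>\<epsilon> * ln n\<close> per vertex is a
  large deviation.\<close>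

lemma whp_sparse:
  assumes "0 < \<epsilon>"
  shows "\<exists>\<delta>>0. whp (\<lambda>n E. sparse E {1..n} (\<delta> * real n) (\<epsilon> * ln (real n)))"
proof -
  define C where "C = \<alpha> + 1"
  have C: "\<alpha> < C" "0 < C" using \<alpha> by (auto simp: C_def)
  \<comment> \<open>The tail gains \<open>exp (- (C + 4) * ln n)\<close> per vertex of the set, and
    \<open>\<delta> = 1 / z\<close> keeps the loss at \<open>exp (C * ln n)\<close>. The remainder
    is better than the \<open>exp (- 3 * ln n)\<close> that \<open>prob_subsets_le\<close> asks
    for.\<close>
  define z where "z = exp ((C + 4) / \<epsilon>)"
  define \<delta> where "\<delta> = 1 / z"
  have z1: "1 \<le> z" "0 < z" using C assms by (auto simp: z_def)
  have "whp (\<lambda>n E. sparse E {1..n} (\<delta> * real n) (\<epsilon> * ln (real n)))"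
  proof (rule whpI)
    show "(\<lambda>n. 2 / real n) \<longlonglongrightarrow> 0" by real_asymp
    show "\<forall>\<^sub>F n in sequentially. measure_pmf.prob (\<G> n)
       {E. \<not> sparse E {1..n} (\<delta> * real n) (\<epsilon> * ln (real n))} \<le> 2 / real n"
      using ev_upper[OF C(1)] eventually_ge_at_top[of 2]
    proof eventually_elim
      case (elim n)
      let ?L = "ln (real n)"
      have L: "0 \<le> ?L" using elim by simp
      let ?B = "\<lambda>W E. real (card W) \<le> \<delta> * real n \<and> \<epsilon> * ?L * real (card W) < real (card (E \<inter> all_edges W))"
      have "measure_pmf.prob (\<G> n) {E. \<not> sparse E {1..n} (\<delta> * real n) (\<epsilon> * ?L)} \<le>
          measure_pmf.prob (\<G> n) {E. \<exists>W\<subseteq>{1..n}. W \<noteq> {} \<and> ?B W E}"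
      proof (intro measure_pmf.finite_measure_mono Collect_mono impI)
        fix E assume "\<not> sparse E {1..n} (\<delta> * real n) (\<epsilon> * ?L)"
        then obtain W where W: "W \<subseteq> {1..n}" "?B W E" by (auto simp: sparse_def not_le)
        have "W \<noteq> {}"
        proof
          assume "W = {}"
          then have "all_edges W = {}" by (auto simp: all_edges_def)
          then show False using W(2) \<open>W = {}\<close> by simp
        qed
        then show "\<exists>W\<subseteq>{1..n}. W \<noteq> {} \<and> ?B W E" using W by blast
      qed simp
      also have "\<dots> \<le> 2 / real n"
      proof (rule prob_subsets_le)
        fix W :: "nat set" assume W: "W \<subseteq> {1..n}" "W \<noteq> {}"
        have finW: "finite W" using W(1) finite_subset by blast
        let ?w = "real (card W)"
        show "measure_pmf.prob (\<G> n) {E. ?B W E} \<le> exp (- 3 * ?w * ?L)"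
        proof (cases "?w \<le> \<delta> * real n")
          case True
          have cF: "real (card (all_edges W)) \<le> ?w * ?w"
          proof -
            have "all_edges W \<subseteq> (\<lambda>(x, y). {x, y}) ` (W \<times> W)"
              by (auto simp: all_edges_def card_2_iff)
            then have "card (all_edges W) \<le> card (W \<times> W)"
              using finW by (intro surj_card_le) auto
            then show ?thesis by (simp add: card_cartesian_product flip: of_nat_mult)
          qed
          have "measure_pmf.prob (\<G> n) {E. ?B W E} \<le>
             measure_pmf.prob (\<G> n) {E. {} \<subseteq> E \<and> \<epsilon> * ?L * ?w \<le> real (card (E \<inter> all_edges W))}"
            by (intro measure_pmf.finite_measure_mono) auto
          also have "\<dots> \<le> p n ^ card ({} :: nat set set) * exp (real (card (all_edges W)) * p n * (z - 1)) * z powr (- (\<epsilon> * ?L * ?w))"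
            unfolding binomial_random_graph_eq
            using W z1 p01 by (intro prob_card_ge finite_all_edges) (auto simp: all_edges_def)
          also have "z powr (- (\<epsilon> * ?L * ?w)) = exp (- ((C + 4) * ?L * ?w))"
            using assms by (simp add: powr_def z_def field_simps)
          also have "real (card (all_edges W)) * p n * (z - 1) \<le> C * ?L * ?w"
          proof -
            have "real (card (all_edges W)) * (p n * (z - 1)) \<le> (?w * (\<delta> * real n)) * (p n * z)"
              using cF True p01[of n] z1 by (intro mult_mono order.trans[OF cF] mult_left_mono) auto
            also have "\<dots> = ?w * (real n * p n)" using z1 by (simp add: \<delta>_def)
            also have "\<dots> \<le> ?w * (C * ?L)" using elim by (intro mult_left_mono) auto
            finally show ?thesis by (simp add: mult_ac)
          qed
          also have "p n ^ card ({} :: nat set set) * exp (C * ?L * ?w) * exp (- ((C + 4) * ?L * ?w)) = exp (- 4 * ?w * ?L)"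
            by (simp add: exp_add[symmetric] algebra_simps)
          also have "\<dots> \<le> exp (- 3 * ?w * ?L)" using L by (simp add: mult_right_mono)
          finally show ?thesis by (simp add: mult_left_mono mult_right_mono)
        qed simp
      qed (use elim in auto)
      finally show ?case .
    qed
  qed
  moreover have "0 < \<delta>" using z1 by (simp add: \<delta>_def)
  ultimately show ?thesis by blast
qed

text \<open>Let \<open>t = b * ln n * card U\<close>. There are about \<open>(n / t) powr t\<close>
  sets \<open>T\<close>, and each receives that many edges with probability about
  \<open>(t / n) powr (b' * ln n * card U)\<close>, up to factors exponential in \<open>t\<close>.
  The excess \<open>b' - b\<close> in the exponent wins once \<open>t / n\<close> is below a
  constant.\<close>

lemma whp_scattered:
  assumes b: "0 < b" "b < b'"
  shows "\<exists>\<kappa>>0. whp (\<lambda>n E. scattered E {1..n} (\<kappa> * real n) (b * ln (real n)) (b' * ln (real n)))"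
proof -
  define C where "C = \<alpha> + 1"
  have C: "\<alpha> < C" "0 < C" using \<alpha> by (auto simp: C_def)
  \<comment> \<open>The solution of \<open>b + C + (b' - b) * ln \<kappa> = - 3\<close>, where the
    left side is the exponent per vertex of \<open>U\<close> in units of
    \<open>ln n\<close>.\<close>
  define \<kappa> where "\<kappa> = exp (- (b + C + 3) / (b' - b))"
  have \<kappa>: "0 < \<kappa>" "\<kappa> \<le> 1" using b C by (auto simp: \<kappa>_def intro!: divide_nonpos_pos)
  have "whp (\<lambda>n E. scattered E {1..n} (\<kappa> * real n) (b * ln (real n)) (b' * ln (real n)))"
  proof (rule whpI)
    show "(\<lambda>n. 2 / real n) \<longlonglongrightarrow> 0" by real_asymp
    show "\<forall>\<^sub>F n in sequentially. measure_pmf.prob (\<G> n)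
       {E. \<not> scattered E {1..n} (\<kappa> * real n) (b * ln (real n)) (b' * ln (real n))} \<le> 2 / real n"
      using ev_upper[OF C(1)] eventually_ge_at_top[of 2]
    proof eventually_elim
      case (elim n)
      let ?L = "ln (real n)" and ?M = "\<G> n"
      have L: "0 < ?L" using elim by simp
      let ?B = "\<lambda>U E. \<exists>T\<in>{T. T \<subseteq> {1..n} \<and> real (card T) \<le> b * ?L * real (card U)}.
         b * ?L * real (card U) \<le> \<kappa> * real n \<and> U \<inter> T = {} \<and> b' * ?L * real (card U) < real (card (E \<inter> between U T))"
      have "measure_pmf.prob ?M {E. \<not> scattered E {1..n} (\<kappa> * real n) (b * ?L) (b' * ?L)} \<le>
          measure_pmf.prob ?M {E. \<exists>U\<subseteq>{1..n}. U \<noteq> {} \<and> ?B U E}"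
      proof (intro measure_pmf.finite_measure_mono Collect_mono impI)
        fix E assume "\<not> scattered E {1..n} (\<kappa> * real n) (b * ?L) (b' * ?L)"
        then obtain U T where UT: "U \<subseteq> {1..n}" "T \<subseteq> {1..n}" "U \<inter> T = {}" "U \<noteq> {}"
          "b * ?L * real (card U) \<le> \<kappa> * real n" "real (card T) \<le> b * ?L * real (card U)"
          "\<not> real (card (E \<inter> between U T)) \<le> b' * ?L * real (card U)"
          unfolding scattered_def by blast
        then have "?B U E" unfolding not_le by blast
        then show "\<exists>U\<subseteq>{1..n}. U \<noteq> {} \<and> ?B U E" using UT(1,4) by blast
      qed simp
      also have "\<dots> \<le> 2 / real n"
      proof (rule prob_subsets_le)
        fix U :: "nat set" assume U: "U \<subseteq> {1..n}" "U \<noteq> {}"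
        have finU: "finite U" using U(1) finite_subset by blast
        let ?u = "real (card U)" and ?\<T> = "{T. T \<subseteq> {1..n} \<and> real (card T) \<le> b * ?L * real (card U)}"
        have u0: "0 < ?u" using U finU by (simp add: card_gt_0_iff)
        show "measure_pmf.prob ?M {E. ?B U E} \<le> exp (- 3 * ?u * ?L)"
        proof (cases "b * ?L * ?u \<le> \<kappa> * real n")
          case True
          define t where "t = b * ?L * ?u"
          have t0: "0 < t" using b L u0 by (simp add: t_def)
          define y where "y = t / real n"
          have y: "0 < y" "y \<le> \<kappa>" using t0 elim True by (auto simp: y_def t_def[symmetric] divide_simps)
          then have y1: "y \<le> 1" using \<kappa> by linarith
          define K where "K = exp (C * ?L * ?u) * y powr (b' * ?L * ?u)"
          have each: "measure_pmf.prob ?M {E. b * ?L * ?u \<le> \<kappa> * real n \<and> U \<inter> T = {} \<and> b' * ?L * ?u < real (card (E \<inter> between U T))} \<le> K"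
            if T: "T \<in> ?\<T>" for T
          proof (cases "U \<inter> T = {}")
            case disj: True
            have "measure_pmf.prob ?M {E. b * ?L * ?u \<le> \<kappa> * real n \<and> U \<inter> T = {} \<and> b' * ?L * ?u < real (card (E \<inter> between U T))} \<le>
               measure_pmf.prob ?M {E. {} \<subseteq> E \<and> b' * ?L * ?u \<le> real (card (E \<inter> between U T))}"
              by (intro measure_pmf.finite_measure_mono) auto
            also have "\<dots> \<le> p n ^ card ({} :: nat set set) * exp (real (card (between U T)) * p n * (1 / y - 1)) *
                (1 / y) powr (- (b' * ?L * ?u))"
              unfolding binomial_random_graph_eq using T U y y1 p01 disj
              by (intro prob_card_ge finite_all_edges between_subset) auto
            also have "(1 / y) powr (- (b' * ?L * ?u)) = y powr (b' * ?L * ?u)"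
              using y by (simp add: powr_minus powr_divide)
            also have "real (card (between U T)) * p n * (1 / y - 1) \<le> C * ?L * ?u"
            proof -
              have "real (card (between U T)) * (p n * (1 / y - 1)) \<le> (?u * t) * (p n * (1 / y))"
                using T p01[of n] y y1 by (intro mult_mono) (auto simp: card_between[OF disj] t_def mult_left_mono)
              also have "\<dots> = ?u * (real n * p n)" using t0 by (simp add: y_def)
              also have "\<dots> \<le> ?u * (C * ?L)" using elim by (intro mult_left_mono) auto
              finally show ?thesis by (simp add: mult_ac)
            qed
            finally show ?thesis by (simp add: K_def mult_right_mono)
          qed (simp add: K_def)
          have "measure_pmf.prob ?M {E. ?B U E} \<le> (\<Sum>T\<in>?\<T>. K)"
            by (rule order.trans[OF prob_UN_le sum_mono[OF each]]) auto
          also have "\<dots> = real (card ?\<T>) * K" by simp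
          also have "\<dots> \<le> (exp (real n * y) * y powr (- t)) * K"
            using card_small_subsets[of "{1..n}" y t] y y1 by (intro mult_right_mono) (auto simp: t_def K_def)
          also have "\<dots> = exp (t - t * ln y + C * ?L * ?u + b' * ?L * ?u * ln y)"
            using y elim t0 by (simp add: K_def powr_def y_def flip: exp_add)
          also have "t - t * ln y + C * ?L * ?u + b' * ?L * ?u * ln y = ?L * ?u * (b + C + (b' - b) * ln y)"
            by (simp add: t_def algebra_simps)
          also have "\<dots> \<le> ?L * ?u * (- 3)"
          proof (intro mult_left_mono)
            have "ln y \<le> ln \<kappa>" using y \<kappa> by simp
            also have "ln \<kappa> = - (b + C + 3) / (b' - b)" by (simp add: \<kappa>_def)
            finally show "b + C + (b' - b) * ln y \<le> - 3" using b by (simp add: field_simps)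
          qed (use L in auto)
          finally show ?thesis by (simp add: mult_ac)
        qed simp
      qed (use elim in auto)
      finally show ?case .
    qed
  qed
  then show ?thesis using \<kappa> by blast
qed

text \<open>The positive quantity is the exponent in the lower tail bound for a degree into a set of \<open>\<mu> n\<close> vertices.\<close>

lemma low_degree_rate:
  fixes b \<mu> :: real
  assumes "0 < b" "b < \<alpha> * \<mu>" "0 < \<mu>"
  shows "\<exists>z C. 0 < z \<and> z < 1 \<and> 0 < C \<and> C < \<alpha> \<and> 0 < \<mu> * C * (1 - z) + b * ln z"
proof -
  have "b / \<mu> < \<alpha>" using assms by (simp add: divide_simps)
  then obtain C where C: "b / \<mu> < C" "C < \<alpha>" using dense by blast
  then have bC: "b < \<mu> * C" using assms(3) by (simp add: divide_simps mult.commute)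
  have C0: "0 < C" using C(1) assms by (smt (verit) divide_pos_pos)
  have "b / (\<mu> * C) < 1" using bC C0 assms(3) by simp
  \<comment> \<open>As a function of \<open>z\<close> the rate vanishes at 1 and is strictly
    decreasing to the right of \<open>b / (\<mu> * C)\<close>, so it is positive in between.\<close>
  then obtain z where z: "b / (\<mu> * C) < z" "z < 1" using dense by blast
  have z0: "0 < z" using z(1) assms C0 by (smt (verit) divide_pos_pos mult_pos_pos)
  have "b < \<mu> * C * z" using z(1) C0 assms(3) by (simp add: divide_simps mult_ac)
  have "- ln z \<le> 1 / z - 1" using ln_le_minus_one[of "1 / z"] z0 by (simp add: ln_div)
  then have "b * (- ln z) \<le> b * (1 / z - 1)" using assms(1) by (intro mult_left_mono) auto
  also have "\<dots> = b * (1 - z) / z" using z0 by (simp add: field_simps)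
  also have "\<dots> < \<mu> * C * z * (1 - z) / z"
    using \<open>b < \<mu> * C * z\<close> z z0 by (intro divide_strict_right_mono mult_strict_right_mono) auto
  also have "\<dots> = \<mu> * C * (1 - z)" using z0 by simp
  finally have "0 < \<mu> * C * (1 - z) + b * ln z" by simp
  then show ?thesis using C C0 z z0 by blast
qed

text \<open>There are only \<open>4 ^ n\<close> pairs of sets, and a pair with at least
  \<open>\<eta> * n\<close> vertices in \<open>Q\<close> fails with probability exponentially small
  in \<open>n * ln n\<close>.\<close>

lemma whp_dense:
  fixes b \<mu> \<eta> :: real
  assumes b: "0 < b" "b < \<alpha> * \<mu>" and \<mu>: "0 < \<mu>" and \<eta>: "0 < \<eta>"
  shows "whp (\<lambda>n E. dense E {1..n} (\<eta> * real n) (\<mu> * real n) (b * ln (real n)))"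
proof -
  obtain z C where z: "0 < z" "z < 1" and C: "0 < C" "C < \<alpha>" and rate: "0 < \<mu> * C * (1 - z) + b * ln z"
    using low_degree_rate[OF b \<mu>] by blast
  define \<theta> where "\<theta> = \<mu> * C * (1 - z) + b * ln z"
  have \<theta>: "0 < \<theta>" using rate by (simp add: \<theta>_def)
  show ?thesis
  proof (rule whpI)
    show "(\<lambda>n. exp (real n * (2 * ln 2 - \<eta> * \<theta> * ln (real n)))) \<longlonglongrightarrow> 0"
      using \<theta> \<eta> by real_asymp
    show "\<forall>\<^sub>F n in sequentially. measure_pmf.prob (\<G> n)
       {E. \<not> dense E {1..n} (\<eta> * real n) (\<mu> * real n) (b * ln (real n))} \<le> exp (real n * (2 * ln 2 - \<eta> * \<theta> * ln (real n)))"
      using ev_lower[OF C(2)] eventually_ge_at_top[of 2]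
    proof eventually_elim
      case (elim n)
      let ?L = "ln (real n)" and ?M = "\<G> n"
      have L: "0 < ?L" using elim by simp
      let ?I = "Pow {1..n} \<times> Pow {1..n}"
      let ?B = "\<lambda>(Q, P) E. Q \<inter> P = {} \<and> \<eta> * real n \<le> real (card Q) \<and> \<mu> * real n \<le> real (card P) \<and>
          real (card (E \<inter> between Q P)) < b * ?L * real (card Q)"
      let ?K = "exp (- (\<eta> * real n * ?L * \<theta>))"
      have each: "measure_pmf.prob ?M {E. ?B i E} \<le> ?K" if i: "i \<in> ?I" for i
      proof -
        obtain Q P where i': "i = (Q, P)" by (cases i)
        then have QP: "Q \<subseteq> {1..n}" "P \<subseteq> {1..n}" using i by auto
        show ?thesis
        proof (cases "Q \<inter> P = {} \<and> \<eta> * real n \<le> real (card Q) \<and> \<mu> * real n \<le> real (card P)")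
          case True
          let ?q = "real (card Q)"
          have "measure_pmf.prob ?M {E. ?B i E} \<le> measure_pmf.prob ?M {E. {} \<subseteq> E \<and> real (card (E \<inter> between Q P)) \<le> b * ?L * ?q}"
            by (intro measure_pmf.finite_measure_mono) (auto simp: i')
          also have "\<dots> \<le> p n ^ card ({} :: nat set set) * exp (real (card (between Q P)) * p n * (z - 1)) * z powr (- (b * ?L * ?q))"
            unfolding binomial_random_graph_eq using QP True z p01
            by (intro prob_card_le finite_all_edges between_subset) auto
          also have "\<dots> = exp (- (real (card (between Q P)) * p n * (1 - z)) - b * ?L * ?q * ln z)"
            using z by (simp add: powr_def algebra_simps flip: exp_add)
          also have "\<dots> \<le> ?K"
          proof -
            have "(?q * (\<mu> * (C * ?L))) * (1 - z) \<le> (?q * (\<mu> * (real n * p n))) * (1 - z)"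
              using elim z \<mu> by (intro mult_right_mono mult_left_mono) auto
            also have "\<dots> = ?q * (\<mu> * real n) * (p n * (1 - z))" by simp
            also have "\<dots> \<le> ?q * real (card P) * (p n * (1 - z))"
              using True p01[of n] z by (intro mult_right_mono mult_left_mono) auto
            also have "\<dots> = real (card (between Q P)) * p n * (1 - z)" using True by (simp add: card_between)
            finally have "- (real (card (between Q P)) * p n * (1 - z)) - b * ?L * ?q * ln z \<le> - (?q * (?L * \<theta>))"
              by (simp add: \<theta>_def algebra_simps)
            also have "\<dots> \<le> - (\<eta> * real n * (?L * \<theta>))"
              using True L \<theta> by (intro le_imp_neg_le mult_right_mono) auto
            finally show ?thesis by (simp add: mult.assoc)
          qed
          finally show ?thesis .
        next
          case False
          then have none: "{E. ?B i E} = {}" unfolding i' by blast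
          show ?thesis unfolding none by simp
        qed
      qed
      have "measure_pmf.prob ?M {E. \<not> dense E {1..n} (\<eta> * real n) (\<mu> * real n) (b * ?L)} \<le>
          measure_pmf.prob ?M {E. \<exists>i\<in>?I. ?B i E}"
      proof (intro measure_pmf.finite_measure_mono Collect_mono impI)
        fix E assume "\<not> dense E {1..n} (\<eta> * real n) (\<mu> * real n) (b * ?L)"
        then obtain Q P where QP: "Q \<subseteq> {1..n}" "P \<subseteq> {1..n}" "Q \<inter> P = {}"
          "\<eta> * real n \<le> real (card Q)" "\<mu> * real n \<le> real (card P)"
          "\<not> b * ?L * real (card Q) \<le> real (card (E \<inter> between Q P))"
          unfolding dense_def by blast
        then have "?B (Q, P) E" unfolding not_le by simp
        then show "\<exists>i\<in>?I. ?B i E" using QP(1,2) by blast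
      qed simp
      also have "\<dots> \<le> (\<Sum>i\<in>?I. ?K)"
        by (rule order.trans[OF prob_UN_le sum_mono[OF each]]) auto
      also have "\<dots> = exp (2 * real n * ln 2) * ?K"
      proof -
        have "real (card ?I) = 2 ^ n * 2 ^ n" by (simp add: card_cartesian_product card_Pow)
        also have "\<dots> = exp (real n * ln 2) * exp (real n * ln 2)" by (simp add: exp_of_nat_mult)
        also have "\<dots> = exp (2 * real n * ln 2)" by (simp flip: exp_add)
        finally show ?thesis by simp
      qed
      also have "\<dots> = exp (real n * (2 * ln 2 - \<eta> * \<theta> * ?L))" by (simp add: algebra_simps flip: exp_add)
      finally show ?case .
    qed
  qed
qed

end

section \<open>Stars whose outer vertices all have atypical degree\<close>

lemma prob_stars_le:
  fixes w \<beta> :: real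
  assumes fin: "finite I" and w: "\<And>u. u \<in> I \<Longrightarrow> finite (W u) \<and> real (card (W u)) \<le> w" and \<beta>: "0 \<le> \<beta>"
    and each: "\<And>u S. u \<in> I \<Longrightarrow> S \<subseteq> W u \<Longrightarrow> card S = k \<Longrightarrow> measure_pmf.prob M {x. P u S x} \<le> \<beta>"
  shows "measure_pmf.prob M {x. \<exists>u\<in>I. \<exists>S\<subseteq>W u. card S = k \<and> P u S x} \<le> real (card I) * (w ^ k * \<beta>)"
proof -
  have "measure_pmf.prob M {x. \<exists>u\<in>I. \<exists>S\<subseteq>W u. card S = k \<and> P u S x} \<le>
     (\<Sum>u\<in>I. measure_pmf.prob M {x. \<exists>S\<in>{S. S \<subseteq> W u \<and> card S = k}. P u S x})"
    using prob_UN_le[OF fin, of M "\<lambda>u x. \<exists>S\<subseteq>W u. card S = k \<and> P u S x"] by (simp add: Bex_def conj_assoc)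
  also have "\<dots> \<le> (\<Sum>u\<in>I. w ^ k * \<beta>)"
  proof (rule sum_mono)
    fix u assume u: "u \<in> I"
    let ?S = "{S. S \<subseteq> W u \<and> card S = k}"
    have finS: "finite ?S" using w[OF u] by simp
    have "measure_pmf.prob M {x. \<exists>S\<in>?S. P u S x} \<le> (\<Sum>S\<in>?S. \<beta>)"
      by (rule order.trans[OF prob_UN_le[OF finS] sum_mono]) (use each[OF u] in auto)
    also have "\<dots> = real (card (W u) choose k) * \<beta>" using w[OF u] by (simp add: n_subsets)
    also have "\<dots> \<le> w ^ k * \<beta>"
    proof (rule mult_right_mono[OF _ \<beta>])
      have w0: "0 \<le> w" using w[OF u] by (meson of_nat_0_le_iff order.trans)
      show "real (card (W u) choose k) \<le> w ^ k"
      proof (cases "k \<le> card (W u)")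
        case True
        then have "real (card (W u) choose k) \<le> real (card (W u)) ^ k"
          using binomial_le_pow[OF True] by (metis of_nat_le_iff of_nat_power)
        also have "\<dots> \<le> w ^ k" using w[OF u] by (intro power_mono) auto
        finally show ?thesis .
      qed (use w0 in \<open>simp add: binomial_eq_0\<close>)
    qed
    finally show "measure_pmf.prob M {x. \<exists>S\<in>?S. P u S x} \<le> w ^ k * \<beta>" .
  qed
  finally show ?thesis by simp
qed

context random_graph_regime
begin

text \<open>Low degrees of all vertices of \<open>S\<close> into \<open>P\<close> force a low total,
  for which one tail bound suffices; its exponent is \<open>card S\<close> times that of a single
  vertex. The sets are quantified inside the \<open>eventually\<close> because they will be produced
  by the first round.\<close>

lemma star_tail:
  fixes b \<mu> z C :: real
  assumes z: "0 < z" "z < 1" and C: "0 < C" "C < \<alpha>" and \<mu>: "0 < \<mu>"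
  shows "\<forall>\<^sub>F n in sequentially. \<forall>B F0 (S :: nat set) P. finite B \<longrightarrow> F0 \<subseteq> B \<longrightarrow> between S P \<subseteq> B \<longrightarrow>
     F0 \<inter> between S P = {} \<longrightarrow> S \<inter> P = {} \<longrightarrow> finite S \<longrightarrow> finite P \<longrightarrow> \<mu> * real n \<le> real (card P) \<longrightarrow>
     measure_pmf.prob (random_subset B (p n))
       {E. F0 \<subseteq> E \<and> (\<forall>s\<in>S. deg_in E s P \<le> b * ln (real n))} \<le>
     p n ^ card F0 * exp (- ((\<mu> * C * (1 - z) + b * ln z) * ln (real n) * real (card S)))"
  using ev_lower[OF C(2)] eventually_ge_at_top[of 2]
proof eventually_elim
  case (elim n)
  let ?L = "ln (real n)"
  show ?case
  proof (intro allI impI)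
    fix B F0 :: "nat set set" and S P :: "nat set"
    assume a: "finite B" "F0 \<subseteq> B" "between S P \<subseteq> B" "F0 \<inter> between S P = {}" "S \<inter> P = {}"
      "finite S" "finite P" "\<mu> * real n \<le> real (card P)"
    let ?s = "real (card S)"
    have "measure_pmf.prob (random_subset B (p n))
       {E. F0 \<subseteq> E \<and> (\<forall>s\<in>S. deg_in E s P \<le> b * ?L)} \<le>
       measure_pmf.prob (random_subset B (p n)) {E. F0 \<subseteq> E \<and> real (card (E \<inter> between S P)) \<le> b * ?L * ?s}"
    proof (intro measure_pmf.finite_measure_mono Collect_mono impI)
      fix E assume E: "F0 \<subseteq> E \<and> (\<forall>s\<in>S. deg_in E s P \<le> b * ?L)"
      have "real (card (E \<inter> between S P)) = (\<Sum>s\<in>S. deg_in E s P)"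
        by (subst sum_nbr_between[OF a(6,7,5), symmetric]) simp
      also have "\<dots> \<le> (\<Sum>s\<in>S. b * ?L)" using E by (intro sum_mono) auto
      finally show "F0 \<subseteq> E \<and> real (card (E \<inter> between S P)) \<le> b * ?L * ?s" using E by (simp add: mult_ac)
    qed simp
    also have "\<dots> \<le> p n ^ card F0 * exp (real (card (between S P)) * p n * (z - 1)) * z powr (- (b * ?L * ?s))"
      using a z p01 by (intro prob_card_le) auto
    also have "\<dots> = p n ^ card F0 * exp (- (real (card (between S P)) * p n * (1 - z)) - b * ?L * ?s * ln z)"
      using z by (simp add: powr_def algebra_simps flip: exp_add)
    also have "\<dots> \<le> p n ^ card F0 * exp (- ((\<mu> * C * (1 - z) + b * ln z) * ?L * ?s))"
    proof (rule mult_left_mono)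
      have "(?s * (\<mu> * (C * ?L))) * (1 - z) \<le> (?s * (\<mu> * (real n * p n))) * (1 - z)"
        using elim z \<mu> by (intro mult_right_mono mult_left_mono) auto
      also have "\<dots> = ?s * (\<mu> * real n) * (p n * (1 - z))" by simp
      also have "\<dots> \<le> ?s * real (card P) * (p n * (1 - z))"
        using a(8) p01[of n] z by (intro mult_right_mono mult_left_mono) auto
      also have "\<dots> = real (card (between S P)) * p n * (1 - z)" using a(5) by (simp add: card_between)
      finally show "exp (- (real (card (between S P)) * p n * (1 - z)) - b * ?L * ?s * ln z) \<le>
          exp (- ((\<mu> * C * (1 - z) + b * ln z) * ?L * ?s))"
        by (simp add: algebra_simps)
    qed (use p01[of n] in simp)
    finally show "measure_pmf.prob (random_subset B (p n))
       {E. F0 \<subseteq> E \<and> (\<forall>s\<in>S. deg_in E s P \<le> b * ?L)} \<le>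
       p n ^ card F0 * exp (- ((\<mu> * C * (1 - z) + b * ln z) * ?L * ?s))" .
  qed
qed

lemma whp_max_degree: "\<exists>C>0. whp (\<lambda>n E. \<forall>v\<in>{1..n}. real (card (nbr E v)) \<le> C * ln (real n))"
proof -
  define C where "C = \<alpha> + 1"
  have C: "\<alpha> < C" "0 < C" using \<alpha> by (auto simp: C_def)
  \<comment> \<open>With Chernoff parameter \<open>exp 1 \<le> 3\<close> the upper tail is at most
    \<open>exp ((2 * C - C') * ln n)\<close>, and \<open>n powr (- 2)\<close> is wanted for each
    vertex.\<close>
  define C' where "C' = 2 * C + 2"
  have "whp (\<lambda>n E. \<forall>v\<in>{1..n}. real (card (nbr E v)) \<le> C' * ln (real n))"
  proof (rule whpI)
    show "(\<lambda>n. real n * exp (- 2 * ln (real n))) \<longlonglongrightarrow> 0" by real_asymp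
    show "\<forall>\<^sub>F n in sequentially. measure_pmf.prob (\<G> n)
       {E. \<not> (\<forall>v\<in>{1..n}. real (card (nbr E v)) \<le> C' * ln (real n))} \<le> real n * exp (- 2 * ln (real n))"
      using ev_upper[OF C(1)] eventually_ge_at_top[of 2]
    proof eventually_elim
      case (elim n)
      let ?L = "ln (real n)" and ?M = "\<G> n"
      have each: "measure_pmf.prob ?M {E. C' * ?L < deg_in E v ({1..n} - {v})} \<le> exp (- 2 * ?L)" if v: "v \<in> {1..n}" for v
      proof -
        let ?P = "{1..n} - {v}"
        have "measure_pmf.prob ?M {E. C' * ?L < deg_in E v ?P} \<le>
          measure_pmf.prob ?M {E. {} \<subseteq> E \<and> C' * ?L \<le> real (card (E \<inter> between {v} ?P))}"
        proof (intro measure_pmf.finite_measure_mono Collect_mono impI)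
          fix E assume "C' * ?L < deg_in E v ?P"
          then show "{} \<subseteq> E \<and> C' * ?L \<le> real (card (E \<inter> between {v} ?P))"
            using sum_nbr_between[of "{v}" ?P E] by simp
        qed simp
        also have "\<dots> \<le> p n ^ card ({} :: nat set set) * exp (real (card (between {v} ?P)) * p n * (exp 1 - 1)) * exp 1 powr (- (C' * ?L))"
          unfolding binomial_random_graph_eq using v p01
          by (intro prob_card_ge finite_all_edges between_subset) auto
        also have "\<dots> = exp (real (card (between {v} ?P)) * p n * (exp 1 - 1) - C' * ?L)"
          by (simp add: powr_def flip: exp_add)
        also have "\<dots> \<le> exp (- 2 * ?L)"
        proof -
          have e: "exp 1 \<le> (3 :: real)" by (rule exp_le)
          have "real (card (between {v} ?P)) * p n * (exp 1 - 1) \<le> (real n * p n) * 2"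
            using e p01[of n] v by (intro mult_mono mult_right_mono) (auto simp: card_between)
          also have "\<dots> \<le> 2 * C * ?L" using elim by simp
          finally show ?thesis by (simp add: C'_def algebra_simps)
        qed
        finally show ?thesis .
      qed
      have "measure_pmf.prob ?M {E. \<not> (\<forall>v\<in>{1..n}. real (card (nbr E v)) \<le> C' * ?L)} \<le>
         measure_pmf.prob ?M {E. \<exists>v\<in>{1..n}. C' * ?L < deg_in E v ({1..n} - {v})}"
      proof (rule measure_pmf.finite_measure_mono_AE)
        show "AE E in measure_pmf ?M. E \<in> {E. \<not> (\<forall>v\<in>{1..n}. real (card (nbr E v)) \<le> C' * ?L)} \<longrightarrow>
          E \<in> {E. \<exists>v\<in>{1..n}. C' * ?L < deg_in E v ({1..n} - {v})}"
          using AE_subset[of n "p n"]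
        proof (rule AE_mp, intro AE_I2 impI)
          fix E :: "nat set set" assume E: "E \<subseteq> all_edges {1..n}"
          have "nbr E v \<inter> ({1..n} - {v}) = nbr E v" for v using nbr_subset[OF E, of v] by blast
          then show "E \<in> {E. \<exists>v\<in>{1..n}. C' * ?L < deg_in E v ({1..n} - {v})}"
            if "E \<in> {E. \<not> (\<forall>v\<in>{1..n}. real (card (nbr E v)) \<le> C' * ?L)}" using that by (simp add: not_le)
        qed
      qed simp
      also have "\<dots> \<le> (\<Sum>v\<in>{1..n}. exp (- 2 * ?L))"
        by (rule order.trans[OF prob_UN_le sum_mono[OF each]]) auto
      finally show ?case by simp
    qed
  qed
  then show ?thesis using C by (intro exI[of _ C']) (auto simp: C'_def)
qed

lemma star_union_bound_tendsto: "(\<lambda>n. real n * ((C * ln (real n)) ^ k * exp (- (2 * ln (real n))))) \<longlonglongrightarrow> 0"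
proof -
  have "(\<lambda>n. C ^ k * (ln (real n) ^ k / real n)) \<longlonglongrightarrow> C ^ k * 0"
  proof (rule tendsto_mult_left)
    have "filterlim (\<lambda>n. ln (real n)) at_top sequentially" by real_asymp
    then have "(\<lambda>n. ln (real n) ^ k / exp (ln (real n))) \<longlonglongrightarrow> 0"
      by (rule filterlim_compose[OF tendsto_power_div_exp_0])
    then show "(\<lambda>n. ln (real n) ^ k / real n) \<longlonglongrightarrow> 0"
      by (rule Lim_transform_eventually) (use eventually_gt_at_top[of 0] in eventually_elim, simp)
  qed
  moreover have "\<forall>\<^sub>F n in sequentially. C ^ k * (ln (real n) ^ k / real n) =
      real n * ((C * ln (real n)) ^ k * exp (- (2 * ln (real n))))"
    using eventually_gt_at_top[of 0]
  proof eventually_elim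
    case (elim n)
    have "exp (- (2 * ln (real n))) = 1 / (real n * real n)"
      using elim by (simp add: exp_minus exp_double power2_eq_square field_simps)
    then show ?case using elim by (simp add: power_mult_distrib)
  qed
  ultimately show ?thesis by (simp add: filterlim_cong)
qed

text \<open>A star with \<open>k\<close> outer vertices of high degree costs a factor
  \<open>n powr (- k * \<theta>)\<close>, and a large \<open>k\<close> makes this beat the choice of
  the centre. Choosing the outer vertices costs only \<open>(n * p) ^ k\<close>, a power of the
  average degree, because the edges to them must be present too.\<close>

lemma whp_few_high_neighbours:
  fixes b :: real
  assumes b: "\<alpha> < b"
  shows "\<exists>k. whp (\<lambda>n E. \<forall>v\<in>{1..n}. card {u\<in>nbr E v. b * ln (real n) < real (card (nbr E u))} < k)"
proof -
  obtain C where C: "\<alpha> < C" "C < b" using b dense by blast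
  \<comment> \<open>The step down from \<open>b\<close> to \<open>b'\<close> pays for the at most
    \<open>k\<close> neighbours that an outer vertex has within the star; those edges are left out
    of the count.\<close>
  obtain b' where b': "C < b'" "b' < b" using C(2) dense by blast
  have pos: "0 < C" "0 < b'" using C b' \<alpha> by auto
  \<comment> \<open>As a function of \<open>z\<close> the rate \<open>\<theta>\<close> of the upper
    tail vanishes at 1 and increases up to \<open>b' / C\<close>.\<close>
  obtain z where z: "1 < z" "z < b' / C" using b' pos dense[of 1 "b' / C"] by (auto simp: divide_simps)
  define \<theta> where "\<theta> = b' * ln z - C * (z - 1)"
  have \<theta>: "0 < \<theta>"
  proof -
    have "C * z < b'" using z pos by (simp add: divide_simps mult.commute)
    then have "C * z * (z - 1) < b' * (z - 1)" using z by (intro mult_strict_right_mono) auto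
    then have "C * (z - 1) < b' * ((z - 1) / z)" using z by (simp add: divide_simps mult_ac)
    also have "\<dots> \<le> b' * ln z"
    proof (rule mult_left_mono)
      have "- ln z \<le> 1 / z - 1" using ln_le_minus_one[of "1 / z"] z by (simp add: ln_div)
      then show "(z - 1) / z \<le> ln z" using z by (simp add: field_simps)
    qed (use pos in simp)
    finally show ?thesis by (simp add: \<theta>_def)
  qed
  obtain k :: nat where k: "2 / \<theta> \<le> real k" using real_arch_simple by blast
  have "whp (\<lambda>n E. \<forall>v\<in>{1..n}. card {u\<in>nbr E v. b * ln (real n) < real (card (nbr E u))} < k)"
  proof (rule whpI[OF _ star_union_bound_tendsto[of C k]])
    have "\<forall>\<^sub>F n in sequentially. b' * ln (real n) \<le> b * ln (real n) - real k"
      using b' by real_asymp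
    then show "\<forall>\<^sub>F n in sequentially. measure_pmf.prob (\<G> n)
       {E. \<not> (\<forall>v\<in>{1..n}. card {u\<in>nbr E v. b * ln (real n) < real (card (nbr E u))} < k)} \<le>
       real n * ((C * ln (real n)) ^ k * exp (- (2 * ln (real n))))"
      using ev_upper[OF C(1)] eventually_ge_at_top[of 2]
    proof eventually_elim
      case (elim n)
      let ?L = "ln (real n)" and ?M = "\<G> n" and ?V = "{1..n}"
      have L: "0 < ?L" using elim by simp
      let ?B = "\<lambda>v S E. between {v} S \<subseteq> E \<and> real k * (b' * ?L) \<le> real (card (E \<inter> between S (?V - S - {v})))"
      let ?\<beta> = "p n ^ k * exp (- (2 * ?L))"
      have each: "measure_pmf.prob ?M {E. ?B v S E} \<le> ?\<beta>"
        if v: "v \<in> ?V" and S: "S \<subseteq> ?V - {v}" "card S = k" for v S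
      proof -
        let ?P = "?V - S - {v}"
        have SV: "S \<subseteq> ?V" "finite S" using S(1) finite_subset[OF S(1)] by auto
        have vS: "{v} \<inter> S = {}" using S by auto
        have "measure_pmf.prob ?M {E. ?B v S E} \<le> p n ^ card (between {v} S) * exp (real (card (between S ?P)) * p n * (z - 1)) *
            z powr (- (real k * (b' * ?L)))"
          unfolding binomial_random_graph_eq
        proof (rule prob_card_ge)
          show "between {v} S \<inter> between S ?P = {}" using vS by (auto simp: between_def doubleton_eq_iff)
          show "between {v} S \<subseteq> all_edges ?V" using v SV vS by (intro between_subset) auto
          show "between S ?P \<subseteq> all_edges ?V" using SV by (intro between_subset) auto
        qed (use z p01 finite_all_edges in auto)
        also have "card (between {v} S) = k" using vS S by (simp add: card_between)
        also have "p n ^ k * exp (real (card (between S ?P)) * p n * (z - 1)) * z powr (- (real k * (b' * ?L))) =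
            p n ^ k * exp (real (card (between S ?P)) * p n * (z - 1) - real k * (b' * ?L) * ln z)"
          using z by (simp add: powr_def algebra_simps flip: exp_add)
        also have "\<dots> \<le> ?\<beta>"
        proof (rule mult_left_mono)
          have "S \<inter> ?P = {}" by blast
          then have cb: "real (card (between S ?P)) = real k * real (card ?P)" using S by (simp add: card_between)
          have "card ?P \<le> card ?V" by (rule card_mono) auto
          then have "real (card (between S ?P)) \<le> real k * real n"
            unfolding cb by (intro mult_left_mono) auto
          then have "real (card (between S ?P)) * p n * (z - 1) \<le> real k * real n * p n * (z - 1)"
            using z p01[of n] by (intro mult_right_mono) auto
          also have "\<dots> = real k * (real n * p n) * (z - 1)" by simp
          also have "\<dots> \<le> real k * (C * ?L) * (z - 1)" using elim z by (intro mult_right_mono mult_left_mono) auto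
          finally have "real (card (between S ?P)) * p n * (z - 1) - real k * (b' * ?L) * ln z \<le> - (real k * \<theta> * ?L)"
            by (simp add: \<theta>_def algebra_simps)
          also have "\<dots> \<le> - (2 * ?L)" using k \<theta> L by (simp add: divide_simps mult_right_mono)
          finally show "exp (real (card (between S ?P)) * p n * (z - 1) - real k * (b' * ?L) * ln z) \<le> exp (- (2 * ?L))" by simp
        qed (use p01[of n] in simp)
        finally show ?thesis .
      qed
      have "measure_pmf.prob ?M {E. \<not> (\<forall>v\<in>?V. card {u\<in>nbr E v. b * ?L < real (card (nbr E u))} < k)} \<le>
        measure_pmf.prob ?M {E. \<exists>v\<in>?V. \<exists>S\<subseteq>?V - {v}. card S = k \<and> ?B v S E}"
      proof (rule measure_pmf.finite_measure_mono_AE)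
        show "AE E in measure_pmf ?M. E \<in> {E. \<not> (\<forall>v\<in>?V. card {u\<in>nbr E v. b * ?L < real (card (nbr E u))} < k)} \<longrightarrow>
          E \<in> {E. \<exists>v\<in>?V. \<exists>S\<subseteq>?V - {v}. card S = k \<and> ?B v S E}"
          using AE_subset[of n "p n"]
        proof (rule AE_mp, intro AE_I2 impI)
          fix E :: "nat set set" assume E: "E \<subseteq> all_edges ?V"
          assume "E \<in> {E. \<not> (\<forall>v\<in>?V. card {u\<in>nbr E v. b * ?L < real (card (nbr E u))} < k)}"
          then obtain v where v: "v \<in> ?V" "k \<le> card {u\<in>nbr E v. b * ?L < real (card (nbr E u))}" by (auto simp: not_less)
          then obtain S where S: "S \<subseteq> {u\<in>nbr E v. b * ?L < real (card (nbr E u))}" "card S = k"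
            by (meson obtain_subset_with_card_n)
          have SV: "S \<subseteq> ?V - {v}" using S nbr_subset[OF E, of v] by blast
          have finS: "finite S" by (rule finite_subset[OF SV]) simp
          let ?P = "?V - S - {v}"
          have "b * ?L - real k \<le> deg_in E s ?P" if s: "s \<in> S" for s
          proof -
            have "nbr E s \<subseteq> (nbr E s \<inter> ?P) \<union> insert v (S - {s})" using nbr_subset[OF E, of s] by blast
            then have "card (nbr E s) \<le> card ((nbr E s \<inter> ?P) \<union> insert v (S - {s}))"
              using finS by (intro card_mono) auto
            also have "\<dots> \<le> card (nbr E s \<inter> ?P) + card (insert v (S - {s}))" by (rule card_Un_le)
            also have "card (insert v (S - {s})) \<le> Suc (card (S - {s}))" by (rule card_insert_le_m1) auto
            also have "Suc (card (S - {s})) = k" using card_Suc_Diff1[OF finS s] S(2) by simp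
            finally have "real (card (nbr E s)) \<le> deg_in E s ?P + real k" by linarith
            moreover have "b * ?L < real (card (nbr E s))" using S(1) s by blast
            ultimately show ?thesis by linarith
          qed
          then have "b' * ?L \<le> deg_in E s ?P" if "s \<in> S" for s using elim(1) that by force
          then have "(\<Sum>s\<in>S. b' * ?L) \<le> (\<Sum>s\<in>S. deg_in E s ?P)" by (intro sum_mono)
          also have "\<dots> = real (card (E \<inter> between S ?P))"
            by (subst sum_nbr_between[symmetric]) (use finS in auto)
          finally have "real k * (b' * ?L) \<le> real (card (E \<inter> between S ?P))" using S(2) by simp
          moreover have "between {v} S \<subseteq> E" using S(1) by (auto simp: between_def nbr_def)
          ultimately have "?B v S E" by blast
          then show "E \<in> {E. \<exists>v\<in>?V. \<exists>S\<subseteq>?V - {v}. card S = k \<and> ?B v S E}" using v(1) SV S(2) by blast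
        qed
      qed simp
      also have "\<dots> \<le> real (card ?V) * (real n ^ k * ?\<beta>)"
      proof (rule prob_stars_le)
        show "finite (?V - {v}) \<and> real (card (?V - {v})) \<le> real n" for v
          using card_mono[of ?V "?V - {v}"] by auto
        show "0 \<le> ?\<beta>" using p01[of n] by simp
      qed (use each in auto)
      also have "\<dots> = real n * ((real n * p n) ^ k * exp (- (2 * ?L)))" by (simp add: power_mult_distrib)
      also have "\<dots> \<le> real n * ((C * ?L) ^ k * exp (- (2 * ?L)))"
        using elim p01[of n] by (intro mult_left_mono mult_right_mono power_mono) auto
      finally show ?case .
    qed
  qed
  then show ?thesis by blast
qed

subsection \<open>The lower bound\<close>

lemma whp_lower_bound:
  fixes c \<epsilon> :: real
  assumes c: "\<alpha> = c / ln 2" and \<epsilon>: "0 < \<epsilon>"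
  shows "whp (\<lambda>n E. real n powr (1 - c - \<epsilon>) \<le> real (total_acquisition_number {1..n} E))"
proof -
  have c0: "0 < c" using c \<alpha> by (simp add: zero_less_divide_iff)
  \<comment> \<open>Chosen such that \<open>2 powr (b * ln n) = n powr (c + \<epsilon> / 2)\<close>.
    The other half of \<open>\<epsilon>\<close> absorbs the factors \<open>2 ^ k\<close> and
    \<open>C * ln n\<close>.\<close>
  define b where "b = \<alpha> + \<epsilon> / 2 / ln 2"
  have b: "\<alpha> < b" "0 < b" using \<epsilon> \<alpha> by (auto simp: b_def intro!: add_pos_pos)
  have b2: "b * ln 2 = c + \<epsilon> / 2" by (simp add: b_def c field_simps)
  obtain k where k: "whp (\<lambda>n E. \<forall>v\<in>{1..n}. card {u\<in>nbr E v. b * ln (real n) < real (card (nbr E u))} < k)"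
    using whp_few_high_neighbours[OF b(1)] by blast
  obtain C where C: "0 < C" and deg: "whp (\<lambda>n E. \<forall>v\<in>{1..n}. real (card (nbr E v)) \<le> C * ln (real n))"
    using whp_max_degree by blast
  have ev: "\<forall>\<^sub>F n in sequentially. real n powr (1 - c - \<epsilon>) * (2 ^ k * (1 + C * ln (real n) * real n powr (c + \<epsilon> / 2))) \<le> real n"
  proof -
    have "(\<lambda>n. 2 ^ k * (1 + C * ln (real n) * real n powr (c + \<epsilon> / 2)) / real n powr (c + \<epsilon>)) \<longlonglongrightarrow> 0"
      using c0 \<epsilon> C by real_asymp
    then have "\<forall>\<^sub>F n in sequentially. 2 ^ k * (1 + C * ln (real n) * real n powr (c + \<epsilon> / 2)) / real n powr (c + \<epsilon>) < 1"
      by (rule order_tendstoD) simp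
    then show ?thesis using eventually_gt_at_top[of 0]
    proof eventually_elim
      case (elim n)
      then have "2 ^ k * (1 + C * ln (real n) * real n powr (c + \<epsilon> / 2)) \<le> real n powr (c + \<epsilon>)"
        by (simp add: divide_simps split: if_splits)
      then have "real n powr (1 - c - \<epsilon>) * (2 ^ k * (1 + C * ln (real n) * real n powr (c + \<epsilon> / 2))) \<le>
          real n powr (1 - c - \<epsilon>) * real n powr (c + \<epsilon>)"
        by (intro mult_left_mono) auto
      also have "\<dots> = real n" using elim by (simp flip: powr_add)
      finally show ?case .
    qed
  qed
  show ?thesis
  proof (rule whp_mono[OF whp_conj[OF k deg]])
    show "\<forall>\<^sub>F n in sequentially. \<forall>E\<subseteq>all_edges {1..n}.
       (\<forall>v\<in>{1..n}. card {u\<in>nbr E v. b * ln (real n) < real (card (nbr E u))} < k) \<and>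
       (\<forall>v\<in>{1..n}. real (card (nbr E v)) \<le> C * ln (real n)) \<longrightarrow>
       real n powr (1 - c - \<epsilon>) \<le> real (total_acquisition_number {1..n} E)"
      using ev eventually_ge_at_top[of 2]
    proof (eventually_elim, intro allI impI, elim conjE)
      fix n and E :: "nat set set"
      assume ev: "real n powr (1 - c - \<epsilon>) * (2 ^ k * (1 + C * ln (real n) * real n powr (c + \<epsilon> / 2))) \<le> real n"
        and n: "2 \<le> n" and E: "E \<subseteq> all_edges {1..n}"
        and few: "\<forall>v\<in>{1..n}. card {u\<in>nbr E v. b * ln (real n) < real (card (nbr E u))} < k"
        and deg: "\<forall>v\<in>{1..n}. real (card (nbr E v)) \<le> C * ln (real n)"
      let ?L = "ln (real n)" and ?a = "total_acquisition_number {1..n} E"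
      have L: "0 < ?L" using n by simp
      define a where "a = nat \<lfloor>b * ?L\<rfloor>"
      define \<Delta> where "\<Delta> = nat \<lfloor>C * ?L\<rfloor>"
      have a: "real a \<le> b * ?L" "real \<Delta> \<le> C * ?L" using b C L by (auto simp: a_def \<Delta>_def)
      define Hi where "Hi = {u. b * ?L < real (card (nbr E u))}"
      have "card {1..n} \<le> ?a * (2 ^ k * (1 + \<Delta> * 2 ^ a))"
      proof (rule total_acquisition_number_ge[OF E])
        show "card (nbr E v) \<le> a" if "v \<notin> Hi" for v using that by (auto simp: Hi_def a_def le_nat_floor)
        show "card (nbr E v \<inter> Hi) \<le> k" if "v \<in> {1..n}" for v
        proof -
          have "nbr E v \<inter> Hi = {u\<in>nbr E v. b * ?L < real (card (nbr E u))}" by (auto simp: Hi_def)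
          then show ?thesis using few that by (simp add: less_imp_le)
        qed
        show "card (nbr E v) \<le> \<Delta>" if "v \<in> {1..n}" for v using deg that by (auto simp: \<Delta>_def le_nat_floor)
      qed simp
      then have "real n \<le> real (?a * (2 ^ k * (1 + \<Delta> * 2 ^ a)))" by (simp only: of_nat_le_iff card_atLeastAtMost diff_Suc_1)
      also have "\<dots> = real ?a * (2 ^ k * (1 + real \<Delta> * 2 ^ a))" by (simp add: algebra_simps)
      also have "\<dots> \<le> real ?a * (2 ^ k * (1 + C * ?L * real n powr (c + \<epsilon> / 2)))"
      proof -
        have "(2::real) ^ a = 2 powr real a" by (simp add: powr_realpow)
        also have "\<dots> \<le> 2 powr (b * ?L)" using a by (intro powr_mono) auto
        also have "\<dots> = exp ((b * ln 2) * ?L)" by (simp add: powr_def mult_ac)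
        also have "\<dots> = real n powr (c + \<epsilon> / 2)" using n unfolding b2 by (simp add: powr_def)
        finally have "(2::real) ^ a \<le> real n powr (c + \<epsilon> / 2)" .
        then show ?thesis using a C L by (intro mult_left_mono add_mono mult_mono) auto
      qed
      finally have "real n powr (1 - c - \<epsilon>) * (2 ^ k * (1 + C * ?L * real n powr (c + \<epsilon> / 2))) \<le>
          real ?a * (2 ^ k * (1 + C * ?L * real n powr (c + \<epsilon> / 2)))" using ev by linarith
      moreover have "0 < 2 ^ k * (1 + C * ?L * real n powr (c + \<epsilon> / 2))" using C L by (simp add: add_pos_nonneg)
      ultimately show "real n powr (1 - c - \<epsilon>) \<le> real ?a" by (rule mult_right_le_imp_le)
    qed
  qed
qed

subsection \<open>Two rounds of exposure\<close>

text \<open>Markov's inequality with the tail of single vertices. Here \<open>z\<close> and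
  \<open>C\<close> stay visible, since the resulting power of \<open>n\<close> will be compared with
  a given one, whereas the cluster bounds need only some positive rate.\<close>

lemma few_count_tail:
  fixes b \<mu> z C :: real
  assumes z: "0 < z" "z < 1" and C: "0 < C" "C < \<alpha>" and \<mu>: "0 < \<mu>"
  shows "\<forall>\<^sub>F n in sequentially. \<forall>B (Ys :: nat set) P t. finite B \<longrightarrow> finite Ys \<longrightarrow> (\<forall>y\<in>Ys. finite (P y) \<and> y \<notin> P y \<and>
       between {y} (P y) \<subseteq> B \<and> \<mu> * real n \<le> real (card (P y))) \<longrightarrow> 0 < t \<longrightarrow>
     measure_pmf.prob (random_subset B (p n))
       {E. t \<le> real (card {y\<in>Ys. real (card (nbr E y \<inter> P y)) \<le> b * ln (real n)})} \<le>
     real (card Ys) * exp (- ((\<mu> * C * (1 - z) + b * ln z) * ln (real n))) / t"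
  using star_tail[OF z C \<mu>, of b]
proof eventually_elim
  case (elim n)
  show ?case
  proof (intro allI impI)
    fix B :: "nat set set" and Ys :: "nat set" and P and t :: real
    assume a: "finite B" "finite Ys" "\<forall>y\<in>Ys. finite (P y) \<and> y \<notin> P y \<and>
       between {y} (P y) \<subseteq> B \<and> \<mu> * real n \<le> real (card (P y))" "0 < t"
    show "measure_pmf.prob (random_subset B (p n))
       {E. t \<le> real (card {y\<in>Ys. real (card (nbr E y \<inter> P y)) \<le> b * ln (real n)})} \<le>
     real (card Ys) * exp (- ((\<mu> * C * (1 - z) + b * ln z) * ln (real n))) / t"
    proof (rule prob_count_ge[OF a(2,4)])
      fix y assume y: "y \<in> Ys"
      show "measure_pmf.prob (random_subset B (p n)) {E. real (card (nbr E y \<inter> P y)) \<le> b * ln (real n)} \<le>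
         exp (- ((\<mu> * C * (1 - z) + b * ln z) * ln (real n)))"
        using elim[rule_format, of B "{}" "{y}" "P y"] a y by simp
    qed
  qed
qed

text \<open>The argument for neighbours of high degree, transferred to low degrees. The edges from
  \<open>u\<close> are still random, so they supply the factor \<open>p ^ k\<close> against the
  choice of \<open>k\<close> vertices of \<open>Ys\<close>.\<close>

lemma few_cluster_tail:
  fixes b \<mu> :: real
  assumes b: "0 < b" "b < \<alpha> * \<mu>" and \<mu>: "0 < \<mu>"
  shows "\<exists>k. \<forall>\<^sub>F n in sequentially. \<forall>B (Us :: nat set) Ys P. finite B \<longrightarrow> finite Us \<longrightarrow> finite Ys \<longrightarrow> finite P \<longrightarrow>
       card Us \<le> n \<longrightarrow> card Ys \<le> n \<longrightarrow> Us \<inter> Ys = {} \<longrightarrow> Us \<inter> P = {} \<longrightarrow> Ys \<inter> P = {} \<longrightarrow>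
       between Us Ys \<subseteq> B \<longrightarrow> between Ys P \<subseteq> B \<longrightarrow> \<mu> * real n \<le> real (card P) \<longrightarrow>
     measure_pmf.prob (random_subset B (p n))
       {E. \<exists>u\<in>Us. k \<le> card {y\<in>nbr E u \<inter> Ys. deg_in E y P \<le> b * ln (real n)}} \<le>
     real n * (((\<alpha> + 1) * ln (real n)) ^ k * exp (- (2 * ln (real n))))"
proof -
  obtain z C where z: "0 < z" "z < 1" and C: "0 < C" "C < \<alpha>" and rate: "0 < \<mu> * C * (1 - z) + b * ln z"
    using low_degree_rate[OF b \<mu>] by blast
  define \<theta> where "\<theta> = \<mu> * C * (1 - z) + b * ln z"
  have \<theta>: "0 < \<theta>" using rate by (simp add: \<theta>_def)
  obtain k :: nat where k: "2 / \<theta> \<le> real k" using real_arch_simple by blast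
  have "\<alpha> < \<alpha> + 1" by simp
  have "\<forall>\<^sub>F n in sequentially. \<forall>B (Us :: nat set) Ys P. finite B \<longrightarrow> finite Us \<longrightarrow> finite Ys \<longrightarrow> finite P \<longrightarrow>
       card Us \<le> n \<longrightarrow> card Ys \<le> n \<longrightarrow> Us \<inter> Ys = {} \<longrightarrow> Us \<inter> P = {} \<longrightarrow> Ys \<inter> P = {} \<longrightarrow>
       between Us Ys \<subseteq> B \<longrightarrow> between Ys P \<subseteq> B \<longrightarrow> \<mu> * real n \<le> real (card P) \<longrightarrow>
     measure_pmf.prob (random_subset B (p n))
       {E. \<exists>u\<in>Us. k \<le> card {y\<in>nbr E u \<inter> Ys. deg_in E y P \<le> b * ln (real n)}} \<le>
     real n * (((\<alpha> + 1) * ln (real n)) ^ k * exp (- (2 * ln (real n))))"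
    using star_tail[OF z C \<mu>, of b] ev_upper[OF \<open>\<alpha> < \<alpha> + 1\<close>] eventually_ge_at_top[of 2]
  proof eventually_elim
    case (elim n)
    let ?L = "ln (real n)"
    have L: "0 < ?L" using elim by simp
    let ?\<beta> = "p n ^ k * exp (- (2 * ?L))"
    show ?case
    proof (intro allI impI)
      fix B :: "nat set set" and Us Ys P :: "nat set"
      assume a: "finite B" "finite Us" "finite Ys" "finite P" "card Us \<le> n" "card Ys \<le> n"
        "Us \<inter> Ys = {}" "Us \<inter> P = {}" "Ys \<inter> P = {}" "between Us Ys \<subseteq> B" "between Ys P \<subseteq> B" "\<mu> * real n \<le> real (card P)"
      let ?M = "random_subset B (p n)"
      let ?B = "\<lambda>u S E. between {u} S \<subseteq> E \<and> (\<forall>s\<in>S. deg_in E s P \<le> b * ?L)"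
      have "measure_pmf.prob ?M {E. \<exists>u\<in>Us. k \<le> card {y\<in>nbr E u \<inter> Ys. deg_in E y P \<le> b * ?L}} \<le>
        measure_pmf.prob ?M {E. \<exists>u\<in>Us. \<exists>S\<subseteq>Ys. card S = k \<and> ?B u S E}"
      proof (intro measure_pmf.finite_measure_mono Collect_mono impI)
        fix E assume "\<exists>u\<in>Us. k \<le> card {y\<in>nbr E u \<inter> Ys. deg_in E y P \<le> b * ?L}"
        then obtain u where u: "u \<in> Us" "k \<le> card {y\<in>nbr E u \<inter> Ys. deg_in E y P \<le> b * ?L}" by blast
        then obtain S where S: "S \<subseteq> {y\<in>nbr E u \<inter> Ys. deg_in E y P \<le> b * ?L}" "card S = k"
          by (meson obtain_subset_with_card_n)
        then have "between {u} S \<subseteq> E" by (auto simp: between_def nbr_def)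
        then have "S \<subseteq> Ys" "?B u S E" using S(1) by blast+
        then show "\<exists>u\<in>Us. \<exists>S\<subseteq>Ys. card S = k \<and> ?B u S E" using u(1) S(2) by blast
      qed simp
      also have "\<dots> \<le> real (card Us) * (real n ^ k * ?\<beta>)"
      proof (rule prob_stars_le[OF a(2)])
        show "finite Ys \<and> real (card Ys) \<le> real n" using a by simp
        show "0 \<le> ?\<beta>" using p01[of n] by simp
        fix u S assume u: "u \<in> Us" and S: "S \<subseteq> Ys" "card S = k"
        have uS: "{u} \<inter> S = {}" using u S(1) a(7) by blast
        have "measure_pmf.prob ?M {E. ?B u S E} \<le> p n ^ card (between {u} S) * exp (- (\<theta> * ?L * real (card S)))"
          unfolding \<theta>_def
        proof (rule elim(1)[rule_format])
          show "between {u} S \<subseteq> B" using a(10) u S(1) by (auto simp: between_def)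
          show "between S P \<subseteq> B" using a(11) S(1) by (auto simp: between_def)
          have "u \<notin> S" "u \<notin> P" using uS a(8) u by auto
          then show "between {u} S \<inter> between S P = {}" by (auto simp: between_def doubleton_eq_iff)
          show "S \<inter> P = {}" using a(9) S(1) by blast
          show "finite S" by (rule finite_subset[OF S(1) a(3)])
        qed (use a in auto)
        also have "\<dots> = p n ^ k * exp (- (\<theta> * ?L * real k))" using uS S by (simp add: card_between)
        also have "\<dots> \<le> ?\<beta>"
        proof (rule mult_left_mono)
          have "2 * ?L \<le> (real k * \<theta>) * ?L" using k \<theta> L by (intro mult_right_mono) (auto simp: divide_simps)
          then show "exp (- (\<theta> * ?L * real k)) \<le> exp (- (2 * ?L))" by (simp add: mult_ac)
        qed (use p01[of n] in simp)
        finally show "measure_pmf.prob ?M {E. ?B u S E} \<le> ?\<beta>" .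
      qed
      also have "\<dots> \<le> real n * (real n ^ k * ?\<beta>)" using a p01[of n] by (intro mult_right_mono) auto
      also have "\<dots> = real n * ((real n * p n) ^ k * exp (- (2 * ?L)))" by (simp add: power_mult_distrib)
      also have "\<dots> \<le> real n * (((\<alpha> + 1) * ?L) ^ k * exp (- (2 * ?L)))"
        using elim p01[of n] by (intro mult_left_mono mult_right_mono power_mono) auto
      finally show "measure_pmf.prob ?M {E. \<exists>u\<in>Us. k \<le> card {y\<in>nbr E u \<inter> Ys. deg_in E y P \<le> b * ?L}} \<le>
        real n * (((\<alpha> + 1) * ?L) ^ k * exp (- (2 * ?L)))" .
    qed
  qed
  then show ?thesis by blast
qed

text \<open>The counterpart for neighbourhoods that are already exposed. Their edges supply no
  factor \<open>p\<close>, so the number of candidates has to be bounded beforehand, in the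
  application by the maximum degree.\<close>

lemma few_bounded_cluster_tail:
  fixes b \<mu> K :: real
  assumes b: "0 < b" "b < \<alpha> * \<mu>" and \<mu>: "0 < \<mu>" and K: "0 \<le> K"
  shows "\<exists>k. \<forall>\<^sub>F n in sequentially. \<forall>B (Us :: nat set) W P. finite B \<longrightarrow> finite Us \<longrightarrow> finite P \<longrightarrow>
       card Us \<le> n \<longrightarrow> Us \<inter> P = {} \<longrightarrow> (\<forall>u\<in>Us. W u \<subseteq> Us \<and> real (card (W u)) \<le> K * ln (real n)) \<longrightarrow>
       between Us P \<subseteq> B \<longrightarrow> \<mu> * real n \<le> real (card P) \<longrightarrow>
     measure_pmf.prob (random_subset B (p n))
       {E. \<exists>u\<in>Us. k \<le> card {v\<in>W u. deg_in E v P \<le> b * ln (real n)}} \<le>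
     real n * ((K * ln (real n)) ^ k * exp (- (2 * ln (real n))))"
proof -
  obtain z C where z: "0 < z" "z < 1" and C: "0 < C" "C < \<alpha>" and rate: "0 < \<mu> * C * (1 - z) + b * ln z"
    using low_degree_rate[OF b \<mu>] by blast
  define \<theta> where "\<theta> = \<mu> * C * (1 - z) + b * ln z"
  have \<theta>: "0 < \<theta>" using rate by (simp add: \<theta>_def)
  obtain k :: nat where k: "2 / \<theta> \<le> real k" using real_arch_simple by blast
  have "\<forall>\<^sub>F n in sequentially. \<forall>B (Us :: nat set) W P. finite B \<longrightarrow> finite Us \<longrightarrow> finite P \<longrightarrow>
       card Us \<le> n \<longrightarrow> Us \<inter> P = {} \<longrightarrow> (\<forall>u\<in>Us. W u \<subseteq> Us \<and> real (card (W u)) \<le> K * ln (real n)) \<longrightarrow>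
       between Us P \<subseteq> B \<longrightarrow> \<mu> * real n \<le> real (card P) \<longrightarrow>
     measure_pmf.prob (random_subset B (p n))
       {E. \<exists>u\<in>Us. k \<le> card {v\<in>W u. deg_in E v P \<le> b * ln (real n)}} \<le>
     real n * ((K * ln (real n)) ^ k * exp (- (2 * ln (real n))))"
    using star_tail[OF z C \<mu>, of b] eventually_ge_at_top[of 2]
  proof eventually_elim
    case (elim n)
    let ?L = "ln (real n)"
    have L: "0 < ?L" using elim by simp
    show ?case
    proof (intro allI impI)
      fix B :: "nat set set" and Us P :: "nat set" and W
      assume a: "finite B" "finite Us" "finite P" "card Us \<le> n" "Us \<inter> P = {}"
        "\<forall>u\<in>Us. W u \<subseteq> Us \<and> real (card (W u)) \<le> K * ?L" "between Us P \<subseteq> B" "\<mu> * real n \<le> real (card P)"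
      let ?M = "random_subset B (p n)"
      let ?B = "\<lambda>u S E. \<forall>s\<in>S. deg_in E s P \<le> b * ?L"
      have "measure_pmf.prob ?M {E. \<exists>u\<in>Us. k \<le> card {v\<in>W u. deg_in E v P \<le> b * ?L}} \<le>
        measure_pmf.prob ?M {E. \<exists>u\<in>Us. \<exists>S\<subseteq>W u. card S = k \<and> ?B u S E}"
      proof (intro measure_pmf.finite_measure_mono Collect_mono impI)
        fix E assume "\<exists>u\<in>Us. k \<le> card {v\<in>W u. deg_in E v P \<le> b * ?L}"
        then obtain u where u: "u \<in> Us" "k \<le> card {v\<in>W u. deg_in E v P \<le> b * ?L}" by blast
        then obtain S where S: "S \<subseteq> {v\<in>W u. deg_in E v P \<le> b * ?L}" "card S = k"
          by (meson obtain_subset_with_card_n)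
        then show "\<exists>u\<in>Us. \<exists>S\<subseteq>W u. card S = k \<and> ?B u S E" using u(1) by blast
      qed simp
      also have "\<dots> \<le> real (card Us) * ((K * ?L) ^ k * exp (- (2 * ?L)))"
      proof (rule prob_stars_le[OF a(2)])
        show "finite (W u) \<and> real (card (W u)) \<le> K * ?L" if "u \<in> Us" for u
          using a(6) that finite_subset[OF _ a(2)] by blast
        fix u S assume u: "u \<in> Us" and S: "S \<subseteq> W u" "card S = k"
        have SU: "S \<subseteq> Us" using a(6) u S(1) by blast
        have "measure_pmf.prob ?M {E. {} \<subseteq> E \<and> ?B u S E} \<le> p n ^ card ({} :: nat set set) * exp (- (\<theta> * ?L * real (card S)))"
          unfolding \<theta>_def
        proof (rule elim(1)[rule_format])
          show "between S P \<subseteq> B" using a(7) SU by (auto simp: between_def)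
          show "S \<inter> P = {}" using a(5) SU by blast
          show "finite S" by (rule finite_subset[OF SU a(2)])
        qed (use a in auto)
        then have "measure_pmf.prob ?M {E. ?B u S E} \<le> exp (- (\<theta> * ?L * real k))" using S by simp
        also have "\<dots> \<le> exp (- (2 * ?L))"
        proof -
          have "2 * ?L \<le> (real k * \<theta>) * ?L" using k \<theta> L by (intro mult_right_mono) (auto simp: divide_simps)
          then show ?thesis by (simp add: mult_ac)
        qed
        finally show "measure_pmf.prob ?M {E. ?B u S E} \<le> exp (- (2 * ?L))" .
      qed simp
      also have "\<dots> \<le> real n * ((K * ?L) ^ k * exp (- (2 * ?L)))"
        using a K L by (intro mult_right_mono) auto
      finally show "measure_pmf.prob ?M {E. \<exists>u\<in>Us. k \<le> card {v\<in>W u. deg_in E v P \<le> b * ?L}} \<le>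
        real n * ((K * ?L) ^ k * exp (- (2 * ?L)))" .
    qed
  qed
  then show ?thesis by blast
qed

end

text \<open>A vertex of \<open>Y\<close> with few neighbours in \<open>Lf\<close> may remain in the
  residual set, hence the bound \<open>s\<close>, later a small power of \<open>n\<close>. One with
  few neighbours in \<open>X\<close> can usually still be moved onto a leaf, so for \<open>t\<close>
  a small linear bound is enough. The other conditions say that atypical vertices do not
  cluster.\<close>

definition second_round ::
  "real \<Rightarrow> real \<Rightarrow> nat set \<Rightarrow> nat set \<Rightarrow> real \<Rightarrow> real \<Rightarrow> nat \<Rightarrow> nat set set \<Rightarrow> nat set \<Rightarrow> nat set \<Rightarrow> bool" where
  "second_round \<gamma> \<gamma>' V Y s t k E X Lf \<longleftrightarrow>
     real (card {y\<in>Y. deg_in E y Lf \<le> \<gamma>}) < s \<and>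
     real (card {y\<in>Y. deg_in E y X \<le> \<gamma>}) < t \<and>
     (\<forall>u\<in>V - X - Lf. card {y\<in>nbr E u \<inter> Y. deg_in E y X \<le> \<gamma>} < k \<and>
        card {y\<in>nbr E u \<inter> Y. deg_in E y Lf \<le> \<gamma>} < k \<and>
        card {v\<in>nbr E u \<inter> (V - X - Lf). deg_in E v Y \<le> \<gamma>'} < k)"

context random_graph_regime
begin

text \<open>For a fixed first round, \<open>X\<close>, \<open>Lf\<close> and the uncovered set are
  deterministic and the edges at \<open>{Suc (N n)..n}\<close> are independent of them. The five
  ways to fail then have the probabilities bounded before, and these add up to
  \<open>f n\<close>.\<close>

lemma whp_second_round:
  fixes \<gamma> \<gamma>' \<zeta> \<xi> \<mu> \<eta> \<tau> z C K :: real and N :: "nat \<Rightarrow> nat"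
  assumes N: "\<And>n. N n \<le> n" and Y: "\<forall>\<^sub>F n in sequentially. \<mu> * real n \<le> real n - real (N n)"
    and \<gamma>: "0 < \<gamma>" "\<gamma> < \<alpha> * \<zeta>" "0 < \<zeta>" "\<zeta> \<le> \<xi>" and \<gamma>': "0 < \<gamma>'" "\<gamma>' < \<alpha> * \<mu>" "0 < \<mu>"
    and z: "0 < z" "z < 1" and C: "0 < C" "C < \<alpha>" and rate: "1 < \<tau> + (\<xi> * C * (1 - z) + \<gamma> * ln z)"
    and \<eta>: "0 < \<eta>" and K: "0 \<le> K"
    and good: "\<forall>\<^sub>F n in sequentially. \<forall>E X Lf. good n E X Lf \<longrightarrow> X \<subseteq> {1..N n} \<and> Lf \<subseteq> {1..N n} \<and> X \<inter> Lf = {} \<and>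
      \<zeta> * real n \<le> real (card X) \<and> \<xi> * real n \<le> real (card Lf) \<and> (\<forall>u\<in>{1..N n}. real (card (nbr E u)) \<le> K * ln (real n))"
    and whp: "whp (\<lambda>n E. \<exists>X Lf. good n (E \<inter> all_edges {1..N n}) X Lf)"
  shows "\<exists>k. whp (\<lambda>n E. \<exists>X Lf. good n (E \<inter> all_edges {1..N n}) X Lf \<and>
      second_round (\<gamma> * ln (real n)) (\<gamma>' * ln (real n)) {1..N n} {Suc (N n)..n} (real n powr \<tau>) (\<eta> * real n) k E X Lf)"
proof -
  define \<rho> where "\<rho> = \<xi> * C * (1 - z) + \<gamma> * ln z"
  have \<xi>: "0 < \<xi>" using \<gamma> by simp
  obtain z' C' where z': "0 < z'" "z' < 1" and C': "0 < C'" "C' < \<alpha>" and rate': "0 < \<zeta> * C' * (1 - z') + \<gamma> * ln z'"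
    using low_degree_rate[OF \<gamma>(1-3)] by blast
  define \<theta> where "\<theta> = \<zeta> * C' * (1 - z') + \<gamma> * ln z'"
  have \<theta>: "0 < \<theta>" using rate' by (simp add: \<theta>_def)
  obtain k1 where k1: "\<forall>\<^sub>F n in sequentially. \<forall>B (Us :: nat set) Ys P. finite B \<longrightarrow> finite Us \<longrightarrow> finite Ys \<longrightarrow> finite P \<longrightarrow>
       card Us \<le> n \<longrightarrow> card Ys \<le> n \<longrightarrow> Us \<inter> Ys = {} \<longrightarrow> Us \<inter> P = {} \<longrightarrow> Ys \<inter> P = {} \<longrightarrow>
       between Us Ys \<subseteq> B \<longrightarrow> between Ys P \<subseteq> B \<longrightarrow> \<zeta> * real n \<le> real (card P) \<longrightarrow>
     measure_pmf.prob (random_subset B (p n))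
       {E. \<exists>u\<in>Us. k1 \<le> card {y\<in>nbr E u \<inter> Ys. deg_in E y P \<le> \<gamma> * ln (real n)}} \<le>
     real n * (((\<alpha> + 1) * ln (real n)) ^ k1 * exp (- (2 * ln (real n))))"
    using few_cluster_tail[OF \<gamma>(1-3)] by blast
  obtain k2 where k2: "\<forall>\<^sub>F n in sequentially. \<forall>B (Us :: nat set) W P. finite B \<longrightarrow> finite Us \<longrightarrow> finite P \<longrightarrow>
       card Us \<le> n \<longrightarrow> Us \<inter> P = {} \<longrightarrow> (\<forall>u\<in>Us. W u \<subseteq> Us \<and> real (card (W u)) \<le> K * ln (real n)) \<longrightarrow>
       between Us P \<subseteq> B \<longrightarrow> \<mu> * real n \<le> real (card P) \<longrightarrow>
     measure_pmf.prob (random_subset B (p n))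
       {E. \<exists>u\<in>Us. k2 \<le> card {v\<in>W u. deg_in E v P \<le> \<gamma>' * ln (real n)}} \<le>
     real n * ((K * ln (real n)) ^ k2 * exp (- (2 * ln (real n))))"
    using few_bounded_cluster_tail[OF \<gamma>' K] by blast
  define k where "k = max k1 k2"
  define good' where "good' n E \<longleftrightarrow> (\<exists>X Lf. good n E X Lf)" for n E
  define Q where "Q n E \<longleftrightarrow> (\<exists>X Lf. good n (E \<inter> all_edges {1..N n}) X Lf \<and>
      second_round (\<gamma> * ln (real n)) (\<gamma>' * ln (real n)) {1..N n} {Suc (N n)..n} (real n powr \<tau>) (\<eta> * real n) k E X Lf)" for n E
  define f where "f n = real n * exp (- (\<rho> * ln (real n))) / real n powr \<tau> + real n * exp (- (\<theta> * ln (real n))) / (\<eta> * real n) +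
      2 * (real n * (((\<alpha> + 1) * ln (real n)) ^ k1 * exp (- (2 * ln (real n))))) +
      real n * ((K * ln (real n)) ^ k2 * exp (- (2 * ln (real n))))" for n :: nat
  have f0: "f \<longlonglongrightarrow> 0"
  proof -
    have "(\<lambda>n. real n * exp (- (\<rho> * ln (real n))) / real n powr \<tau>) \<longlonglongrightarrow> 0"
    proof -
      have "1 - \<rho> - \<tau> < 0" using rate by (simp add: \<rho>_def)
      then have "(\<lambda>n. real n powr (1 - \<rho> - \<tau>)) \<longlonglongrightarrow> 0" by real_asymp
      then show ?thesis
      proof (rule Lim_transform_eventually)
        show "\<forall>\<^sub>F n in sequentially. real n powr (1 - \<rho> - \<tau>) = real n * exp (- (\<rho> * ln (real n))) / real n powr \<tau>"
          using eventually_gt_at_top[of 0]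
        proof eventually_elim
          case (elim n)
          have "real n powr (1 - \<rho> - \<tau>) = real n powr 1 * real n powr (- \<rho>) / real n powr \<tau>"
            by (simp add: powr_diff powr_minus divide_simps)
          then show ?case using elim by (simp add: powr_def)
        qed
      qed
    qed
    moreover have "(\<lambda>n. real n * exp (- (\<theta> * ln (real n))) / (\<eta> * real n)) \<longlonglongrightarrow> 0" using \<theta> \<eta> by real_asymp
    ultimately have "f \<longlonglongrightarrow> 0 + 0 + 2 * 0 + 0"
      unfolding f_def by (intro tendsto_add tendsto_mult_left star_union_bound_tendsto)
    then show ?thesis by simp
  qed
  have "whp Q"
  proof (rule whpI)
    show "(\<lambda>n. measure_pmf.prob (\<G> n) {E. \<not> good' n (E \<inter> all_edges {1..N n})} + f n) \<longlonglongrightarrow> 0"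
      using tendsto_add[OF whp[unfolded whp_def] f0] unfolding good'_def by simp
    show "\<forall>\<^sub>F n in sequentially. measure_pmf.prob (\<G> n) {E. \<not> Q n E} \<le>
       measure_pmf.prob (\<G> n) {E. \<not> good' n (E \<inter> all_edges {1..N n})} + f n"
      using k1 k2 few_count_tail[OF z C \<xi>, of \<gamma>] few_count_tail[OF z' C' \<gamma>(3), of \<gamma>] good Y eventually_ge_at_top[of 2]
    proof eventually_elim
      case (elim n)
      note k1 = elim(1)[rule_format] and k2 = elim(2)[rule_format] and few = elim(3)[rule_format]
        and few' = elim(4)[rule_format] and good = elim(5)[rule_format] and Yn = elim(6) and n2 = elim(7)
      let ?L = "ln (real n)" and ?V = "{1..N n}" and ?Y = "{Suc (N n)..n}"
      define A where "A = all_edges {1..N n}"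
      define B where "B = all_edges {1..n} - A"
      have sub: "A \<subseteq> all_edges {1..n}" using N[of n] by (auto simp: A_def all_edges_def)
      have fin: "finite A" "finite B" "A \<inter> B = {}" and AB: "all_edges {1..n} = A \<union> B"
        using sub finite_all_edges[of "{1..n}"] finite_subset[OF sub] by (auto simp: B_def)
      have cY: "card ?Y \<le> n" "\<mu> * real n \<le> real (card ?Y)" using Yn N[of n] by auto
      have btw: "between S P \<subseteq> B" if "S \<subseteq> ?Y" "P \<subseteq> ?V" for S P
      proof -
        have "between S P \<subseteq> all_edges {1..n}" using that N[of n] by (intro between_subset) fastforce+
        moreover have "between S P \<inter> A = {}" using that by (fastforce simp: between_def A_def all_edges_def)
        ultimately show ?thesis by (auto simp: B_def)
      qed
      have btw': "between P S \<subseteq> B" if "S \<subseteq> ?Y" "P \<subseteq> ?V" for S P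
      proof -
        have "between P S = between S P" by (auto simp: between_def insert_commute)
        then show ?thesis using btw[OF that] by simp
      qed
      show ?case
        unfolding binomial_random_graph_eq AB A_def[symmetric]
      proof (rule two_round_exposure[OF fin])
        show "0 \<le> f n" using \<alpha> \<eta> K n2 by (auto simp: f_def intro!: add_nonneg_nonneg mult_nonneg_nonneg divide_nonneg_nonneg zero_le_power)
        fix E1 assume E1: "E1 \<subseteq> A" "good' n E1"
        then obtain X Lf where g: "good n E1 X Lf" by (auto simp: good'_def)
        from good[OF g] have XL: "X \<subseteq> ?V" "Lf \<subseteq> ?V" "X \<inter> Lf = {}" and cX: "\<zeta> * real n \<le> real (card X)"
          and cL: "\<xi> * real n \<le> real (card Lf)" and deg: "\<And>u. u \<in> ?V \<Longrightarrow> real (card (nbr E1 u)) \<le> K * ?L" by auto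
        define U where "U = ?V - X - Lf"
        have UV: "U \<subseteq> ?V" "U \<inter> X = {}" "U \<inter> Lf = {}" by (auto simp: U_def)
        have finX: "finite X" "finite Lf" "finite U" using finite_subset[OF XL(1)] finite_subset[OF XL(2)] finite_subset[OF UV(1)] by auto
        have cU: "card U \<le> n" using card_mono[OF _ UV(1)] N[of n] by simp
        have cL': "\<zeta> * real n \<le> real (card Lf)" using cL mult_right_mono[OF \<gamma>(4), of "real n"] by linarith
        let ?M = "random_subset B (p n)"
        define B1 where "B1 = {E. real n powr \<tau> \<le> real (card {y\<in>?Y. deg_in E y Lf \<le> \<gamma> * ?L})}"
        define B2 where "B2 = {E. \<eta> * real n \<le> real (card {y\<in>?Y. deg_in E y X \<le> \<gamma> * ?L})}"
        define B3 where "B3 = {E. \<exists>u\<in>U. k1 \<le> card {y\<in>nbr E u \<inter> ?Y. deg_in E y X \<le> \<gamma> * ?L}}"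
        define B4 where "B4 = {E. \<exists>u\<in>U. k1 \<le> card {y\<in>nbr E u \<inter> ?Y. deg_in E y Lf \<le> \<gamma> * ?L}}"
        \<comment> \<open>Adjacency inside \<open>U\<close> was settled in the first round, hence
          \<open>nbr E1\<close>; only the degrees into the second vertex set are random.\<close>
        define B5 where "B5 = {E. \<exists>u\<in>U. k2 \<le> card {v\<in>nbr E1 u \<inter> U. deg_in E v ?Y \<le> \<gamma>' * ?L}}"
        have p1: "measure_pmf.prob ?M B1 \<le> real n * exp (- (\<rho> * ?L)) / real n powr \<tau>"
        proof -
          have "measure_pmf.prob ?M B1 \<le> real (card ?Y) * exp (- (\<rho> * ?L)) / real n powr \<tau>"
            unfolding B1_def \<rho>_def
          proof (rule few)
            fix y assume y: "y \<in> ?Y"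
            have "y \<notin> Lf" using y XL by auto
            then show "finite Lf \<and> y \<notin> Lf \<and> between {y} Lf \<subseteq> B \<and> \<xi> * real n \<le> real (card Lf)"
              using btw[of "{y}" Lf] y XL cL finX by auto
          qed (use fin n2 in auto)
          also have "\<dots> \<le> real n * exp (- (\<rho> * ?L)) / real n powr \<tau>"
            using cY by (intro divide_right_mono mult_right_mono) auto
          finally show ?thesis .
        qed
        have p2: "measure_pmf.prob ?M B2 \<le> real n * exp (- (\<theta> * ?L)) / (\<eta> * real n)"
        proof -
          have "measure_pmf.prob ?M B2 \<le> real (card ?Y) * exp (- (\<theta> * ?L)) / (\<eta> * real n)"
            unfolding B2_def \<theta>_def
          proof (rule few')
            fix y assume y: "y \<in> ?Y"
            have "y \<notin> X" using y XL by auto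
            then show "finite X \<and> y \<notin> X \<and> between {y} X \<subseteq> B \<and> \<zeta> * real n \<le> real (card X)"
              using btw[of "{y}" X] y XL cX finX by auto
          qed (use fin n2 \<eta> in auto)
          also have "\<dots> \<le> real n * exp (- (\<theta> * ?L)) / (\<eta> * real n)"
            using cY \<eta> by (intro divide_right_mono mult_right_mono) auto
          finally show ?thesis .
        qed
        have UY: "U \<inter> ?Y = {}" "?Y \<inter> X = {}" "?Y \<inter> Lf = {}" using UV XL by fastforce+
        have p3: "measure_pmf.prob ?M B3 \<le> real n * (((\<alpha> + 1) * ?L) ^ k1 * exp (- (2 * ?L)))"
          unfolding B3_def using fin finX cU cY UY UV btw' btw XL cX by (intro k1) auto
        have p4: "measure_pmf.prob ?M B4 \<le> real n * (((\<alpha> + 1) * ?L) ^ k1 * exp (- (2 * ?L)))"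
          unfolding B4_def using fin finX cU cY UY UV btw' btw XL cL' by (intro k1) auto
        have p5: "measure_pmf.prob ?M B5 \<le> real n * ((K * ?L) ^ k2 * exp (- (2 * ?L)))"
          unfolding B5_def
        proof (rule k2)
          fix u assume u: "u \<in> U"
          have "finite (nbr E1 u)" using E1(1) by (intro finite_nbr[of _ ?V]) (auto simp: A_def)
          then have "card (nbr E1 u \<inter> U) \<le> card (nbr E1 u)" by (intro card_mono) auto
          then show "nbr E1 u \<inter> U \<subseteq> U \<and> deg_in E1 u U \<le> K * ?L" using deg[of u] u UV by fastforce
        qed (use fin finX cU cY UY UV btw' in auto)
        have "measure_pmf.prob ?M {E2. \<not> Q n (E1 \<union> E2)} \<le> measure_pmf.prob ?M (B1 \<union> B2 \<union> B3 \<union> B4 \<union> B5)"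
        proof (rule measure_pmf.finite_measure_mono_AE)
          have "AE E2 in measure_pmf ?M. E2 \<subseteq> B" using set_random_subset[of B "p n"] by (auto simp: AE_measure_pmf_iff)
          then show "AE E2 in measure_pmf ?M. E2 \<in> {E2. \<not> Q n (E1 \<union> E2)} \<longrightarrow> E2 \<in> B1 \<union> B2 \<union> B3 \<union> B4 \<union> B5"
          proof (rule AE_mp, intro AE_I2 impI)
            fix E2 assume E2: "E2 \<subseteq> B" and nQ: "E2 \<in> {E2. \<not> Q n (E1 \<union> E2)}"
            let ?E = "E1 \<union> E2"
            have int: "?E \<inter> A = E1" using E1(1) E2 fin(3) by blast
            have nY: "nbr ?E y = nbr E2 y" if "y \<in> ?Y" for y
              using that E1(1) by (auto simp: nbr_def A_def all_edges_def)
            have nU: "nbr ?E u \<inter> ?Y = nbr E2 u \<inter> ?Y" for u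
              using E1(1) by (auto simp: nbr_def A_def all_edges_def)
            have nUU: "nbr ?E u \<inter> U = nbr E1 u \<inter> U" if u: "u \<in> U" for u
            proof -
              have "{u, v} \<notin> E2" if "v \<in> U" for v
              proof
                assume "{u, v} \<in> E2"
                then have "{u, v} \<in> all_edges {1..n}" "{u, v} \<notin> A" using E2 by (auto simp: B_def)
                then show False using u that UV(1) by (auto simp: A_def all_edges_def)
              qed
              then show ?thesis by (auto simp: nbr_def)
            qed
            show "E2 \<in> B1 \<union> B2 \<union> B3 \<union> B4 \<union> B5"
            proof (rule ccontr)
              assume nb: "E2 \<notin> B1 \<union> B2 \<union> B3 \<union> B4 \<union> B5"
              have "second_round (\<gamma> * ?L) (\<gamma>' * ?L) ?V ?Y (real n powr \<tau>) (\<eta> * real n) k ?E X Lf"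
                unfolding second_round_def U_def[symmetric]
              proof (intro conjI ballI)
                have eq: "{y\<in>?Y. deg_in ?E y P \<le> \<gamma> * ?L} = {y\<in>?Y. deg_in E2 y P \<le> \<gamma> * ?L}" for P
                  using nY by auto
                show "real (card {y\<in>?Y. deg_in ?E y Lf \<le> \<gamma> * ?L}) < real n powr \<tau>"
                  using nb unfolding eq by (simp add: B1_def)
                show "real (card {y\<in>?Y. deg_in ?E y X \<le> \<gamma> * ?L}) < \<eta> * real n"
                  using nb unfolding eq by (simp add: B2_def)
                fix u assume u: "u \<in> U"
                have eq': "{y\<in>nbr ?E u \<inter> ?Y. deg_in ?E y P \<le> \<gamma> * ?L} =
                    {y\<in>nbr E2 u \<inter> ?Y. deg_in E2 y P \<le> \<gamma> * ?L}" for P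
                  unfolding nU using nY by auto
                show "card {y\<in>nbr ?E u \<inter> ?Y. deg_in ?E y X \<le> \<gamma> * ?L} < k"
                  using nb u unfolding eq' by (auto simp: B3_def k_def not_le)
                show "card {y\<in>nbr ?E u \<inter> ?Y. deg_in ?E y Lf \<le> \<gamma> * ?L} < k"
                  using nb u unfolding eq' by (auto simp: B4_def k_def not_le)
                show "card {v\<in>nbr ?E u \<inter> U. deg_in ?E v ?Y \<le> \<gamma>' * ?L} < k"
                  using nb u unfolding nUU[OF u] nU by (auto simp: B5_def k_def not_le)
              qed
              then have "Q n ?E" unfolding Q_def A_def[symmetric] int using g by blast
              then show False using nQ by simp
            qed
          qed
        qed simp
        also have "\<dots> \<le> measure_pmf.prob ?M B1 + measure_pmf.prob ?M B2 + measure_pmf.prob ?M B3 + measure_pmf.prob ?M B4 + measure_pmf.prob ?M B5"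
          by (intro order.trans[OF measure_Un_le] add_mono order.refl) auto
        also have "\<dots> \<le> f n" using p1 p2 p3 p4 p5 by (simp add: f_def)
        finally show "measure_pmf.prob ?M {E2. \<not> Q n (E1 \<union> E2)} \<le> f n" .
      qed
    qed
  qed
  then show ?thesis unfolding Q_def by blast
qed

end

section \<open>First round: the constants and a core structure in the exposed graph\<close>

lemma exists_growth_rate:
  fixes x :: real
  assumes "x < ln 2"
  shows "\<exists>(h::nat) (lam::real). 0 < h \<and> 1 < lam \<and> lam ^ (h + 1) = lam + 1 \<and> x < real h * ln lam"
proof -
  have "(\<lambda>h. ln (1 + 2 powr (- 1 / real h))) \<longlonglongrightarrow> ln 2" by real_asymp
  then have "\<forall>\<^sub>F h in sequentially. x < ln (1 + 2 powr (- 1 / real h))"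
    using assms by (rule order_tendstoD)
  then obtain h :: nat where h: "x < ln (1 + 2 powr (- 1 / real h))" "0 < h"
    using eventually_conj[OF _ eventually_gt_at_top[of 0]] eventually_happens by (metis (mono_tags, lifting) sequentially_bot)
  have p2: "(2::real) \<le> 2 ^ h" using h(2) self_le_power[of "2::real" h] by simp
  have "\<exists>l\<ge>1. l \<le> 2 \<and> l ^ (h + 1) - l - 1 = (0::real)"
    by (rule IVT') (use p2 in \<open>auto intro!: continuous_intros\<close>)
  then obtain l :: real where l: "1 \<le> l" "l ^ (h + 1) - l - 1 = 0" by blast
  have l1: "1 < l" using l by (cases "l = 1") auto
  \<comment> \<open>This identity is used twice: it gives \<open>l ^ h \<le> 2\<close>, hence
    \<open>1 / l \<ge> 2 powr (- 1 / h)\<close>, and inserting this again shows that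
    \<open>l ^ h\<close> is close to 2 for large \<open>h\<close>.\<close>
  have lh: "l ^ h = 1 + 1 / l" using l l1 by (simp add: field_simps)
  have "l powr real h = l ^ h" using l1 by (simp add: powr_realpow)
  also have "\<dots> \<le> 2" unfolding lh using l1 by simp
  finally have "real h * ln l \<le> ln 2" using l1 ln_mono[of "l powr real h" 2] by (simp add: ln_powr)
  then have "ln l \<le> ln 2 / real h" using h(2) by (simp add: divide_simps mult.commute)
  then have "- ln 2 / real h \<le> - ln l" by simp
  then have "exp (- ln 2 / real h) \<le> exp (- ln l)" by simp
  then have "2 powr (- 1 / real h) \<le> 1 / l" using l1 by (simp add: powr_def exp_minus inverse_eq_divide)
  then have "ln (1 + 2 powr (- 1 / real h)) \<le> ln (1 + 1 / l)" using l1 by (intro ln_mono) (auto intro!: add_pos_nonneg)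
  also have "\<dots> = real h * ln l" unfolding lh[symmetric] using l1 by (simp add: ln_realpow)
  finally show ?thesis using h l l1 by (intro exI[of _ h] exI[of _ l]) auto
qed

lemma sparse_restrict: "sparse E V s b \<Longrightarrow> W \<subseteq> V \<Longrightarrow> sparse (E \<inter> all_edges W) W s b"
  unfolding sparse_def
proof (intro allI impI)
  fix T assume a: "\<forall>Wa\<subseteq>V. real (card Wa) \<le> s \<longrightarrow> real (card (E \<inter> all_edges Wa)) \<le> b * real (card Wa)" "W \<subseteq> V" "T \<subseteq> W" "real (card T) \<le> s"
  have "E \<inter> all_edges W \<inter> all_edges T = E \<inter> all_edges T" using a(3) by (auto simp: all_edges_def)
  then show "real (card (E \<inter> all_edges W \<inter> all_edges T)) \<le> b * real (card T)" using a by simp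
qed

lemma Int_between: "U \<subseteq> W \<Longrightarrow> T \<subseteq> W \<Longrightarrow> U \<inter> T = {} \<Longrightarrow> E \<inter> all_edges W \<inter> between U T = E \<inter> between U T"
  using between_subset[of U W T] by blast

lemma scattered_restrict: "scattered E V s b b' \<Longrightarrow> W \<subseteq> V \<Longrightarrow> scattered (E \<inter> all_edges W) W s b b'"
  unfolding scattered_def by (metis Int_between subset_trans)

lemma dense_restrict:
  assumes "dense E V q r b" "W \<subseteq> V" "q \<le> q'" "r \<le> r'"
  shows "dense (E \<inter> all_edges W) W q' r' b"
  unfolding dense_def
proof (intro allI impI, elim conjE)
  fix Q P assume a: "Q \<subseteq> W" "P \<subseteq> W" "Q \<inter> P = {}" "q' \<le> real (card Q)" "r' \<le> real (card P)"
  have "Q \<subseteq> V \<and> P \<subseteq> V \<and> Q \<inter> P = {} \<and> q \<le> real (card Q) \<and> r \<le> real (card P)" using a assms by auto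
  then have "b * real (card Q) \<le> real (card (E \<inter> between Q P))" using assms(1) unfolding dense_def by blast
  then show "b * real (card Q) \<le> real (card (E \<inter> all_edges W \<inter> between Q P))" using Int_between[OF a(1-3)] by simp
qed

context random_graph_regime
begin

text \<open>Roots of weight about \<open>n powr c'\<close> need about \<open>c0 * ln n\<close>
  children each, and \<open>c0 < \<alpha>\<close>. The constants \<open>A\<close> and
  \<open>\<zeta>\<close> come before \<open>\<eta>\<close> and \<open>N\<close>, because the second
  round must choose the sizes of the uncovered set and of \<open>Y\<close> depending on
  them.\<close>

lemma whp_first_round:
  fixes c \<epsilon> :: real
  assumes c: "\<alpha> = c / ln 2" "0 < c" "c < 1" and \<epsilon>: "0 < \<epsilon>" "\<epsilon> < c"
  shows "\<exists>A \<zeta> \<eta>0. 0 < \<zeta> \<and> 0 < \<eta>0 \<and> (\<forall>\<eta> N. 0 < \<eta> \<longrightarrow> \<eta> \<le> \<eta>0 \<longrightarrow> (\<forall>n. N n \<le> n) \<longrightarrow>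
     (\<forall>n. real n - 4 * \<eta> * real n \<le> real (N n)) \<longrightarrow>
     whp (\<lambda>n E. \<exists>r X Lf own. real r \<le> real n powr (1 - c + \<epsilon> / 2) \<and>
       core_structure (E \<inter> all_edges {1..N n}) {1..N n} r (nat \<lfloor>\<eta> * real n\<rfloor>) A X Lf own \<and>
       \<zeta> * real n \<le> real (card X) \<and> real (card X) \<le> real n / 40))"
proof -
  define c' where "c' = c - \<epsilon> / 2"
  have c': "0 < c'" "c' < c" "c' < 1" using c \<epsilon> by (auto simp: c'_def)
  have "ln 2 * c' / c < ln 2" using c' c by (simp add: divide_simps)
  then obtain h :: nat and lam :: real where h: "0 < h" and lam: "1 < lam" "lam ^ (h + 1) = lam + 1"
    and hl: "ln 2 * c' / c < real h * ln lam" using exists_growth_rate by blast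
  have lnl: "0 < ln lam" using lam by simp
  define c0 where "c0 = c' / (real h * ln lam)"
  have c0: "0 < c0" "c0 < \<alpha>" using hl c c' h lnl by (auto simp: c0_def divide_simps mult_ac)
  \<comment> \<open>An eighth of the available gap. In units of \<open>ln n\<close> the core will
    have minimum degree \<open>\<alpha> - e\<close> and expansion \<open>\<alpha> - 3 * e\<close>,
    and the demands are at most \<open>\<alpha> - 5 * e = c0 + 3 * e\<close>; the final
    \<open>3 * e\<close> has room for the \<open>A\<close> leaves.\<close>
  define e where "e = (\<alpha> - c0) / 8"
  have e: "0 < e" "\<alpha> = c0 + 8 * e" using c0 by (auto simp: e_def field_simps)
  define b1 where "b1 = \<alpha> - e / 2"
  have b1: "0 < b1" "b1 < \<alpha>" "15 / 16 * \<alpha> \<le> b1" using e c0 by (auto simp: b1_def)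
  define \<mu>1 where "\<mu>1 = (b1 / \<alpha> + 1) / 2"
  have mid: "y < (y + 1) / 2 \<and> (y + 1) / 2 < 1 \<and> 15 / 16 \<le> (y + 1) / 2" if "y < 1" "15 / 16 \<le> y" for y :: real
    using that by auto
  have "b1 / \<alpha> < 1" "15 / 16 \<le> b1 / \<alpha>" using b1 \<alpha> by (auto simp: divide_simps)
  then have \<mu>1: "b1 / \<alpha> < \<mu>1" "\<mu>1 < 1" "15 / 16 \<le> \<mu>1" using mid unfolding \<mu>1_def by blast+
  then have b\<mu>: "b1 < \<alpha> * \<mu>1" using \<alpha> by (simp add: divide_simps mult.commute)
  define \<eta>1 where "\<eta>1 = (1 - \<mu>1) / 2"
  have \<eta>1: "0 < \<eta>1" "\<mu>1 = 1 - 2 * \<eta>1" using \<mu>1 by (auto simp: \<eta>1_def field_simps)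
  have e2: "0 < e / 2" using e by simp
  obtain \<delta> where \<delta>: "0 < \<delta>" and sp: "whp (\<lambda>n E. sparse E {1..n} (\<delta> * real n) (e / 2 * ln (real n)))"
    using whp_sparse[OF e2] by blast
  have "0 < \<alpha> - 3 * e" "\<alpha> - 3 * e < \<alpha> - 5 / 2 * e" using e c0 by auto
  then obtain \<kappa> where \<kappa>: "0 < \<kappa>"
    and sc: "whp (\<lambda>n E. scattered E {1..n} (\<kappa> * real n) ((\<alpha> - 3 * e) * ln (real n)) ((\<alpha> - 5 / 2 * e) * ln (real n)))"
    using whp_scattered by blast
  define \<kappa>1 where "\<kappa>1 = min (\<kappa> / \<alpha>) (1 / (2 * \<alpha>))"
  have \<kappa>1: "0 < \<kappa>1" "\<alpha> * \<kappa>1 \<le> \<kappa>" "\<alpha> * \<kappa>1 \<le> 1 / 2"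
  proof -
    show "0 < \<kappa>1" using \<kappa> \<alpha> by (simp add: \<kappa>1_def)
    have "\<kappa>1 \<le> \<kappa> / \<alpha>" "\<kappa>1 \<le> 1 / (2 * \<alpha>)" by (auto simp: \<kappa>1_def)
    then show "\<alpha> * \<kappa>1 \<le> \<kappa>" "\<alpha> * \<kappa>1 \<le> 1 / 2" using \<alpha> by (simp_all add: pos_le_divide_eq mult_ac)
  qed
  \<comment> \<open>The first bound makes the windows wide enough. The other two keep the forest
    small, below a fortieth of the graph and below the surplus \<open>(k - d) * m\<close> of the
    expander.\<close>
  define B where "B = max (13 / (lam - 1)) (max 40 (16 / (e * \<kappa>1)))"
  have B: "13 \<le> B * (lam - 1)" "40 \<le> B" "16 \<le> B * (e * \<kappa>1)"
  proof -
    have "13 / (lam - 1) \<le> B" "16 / (e * \<kappa>1) \<le> B" by (auto simp: B_def)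
    then show "13 \<le> B * (lam - 1)" "16 \<le> B * (e * \<kappa>1)" using lam e \<kappa>1 by (auto simp: divide_simps split: if_splits)
    show "40 \<le> B" by (simp add: B_def)
  qed
  define A where "A = nat \<lceil>2 * B + 6\<rceil>"
  have A: "2 * B + 6 \<le> real A" "0 < real A" using B(2) unfolding A_def by linarith+
  \<comment> \<open>Fewer than \<open>\<beta> * n\<close> owners demand at most
    \<open>e * \<kappa>1 * n\<close> leaves, which the neighbours of \<open>m\<close> expanding
    vertices can supply.\<close>
  define \<beta> where "\<beta> = e * \<kappa>1 / real A"
  have \<beta>: "0 < \<beta>" "real A * \<beta> = e * \<kappa>1" using e \<kappa>1 A by (auto simp: \<beta>_def)
  define \<zeta> where "\<zeta> = 1 / (4 * (B + 3))"
  have \<zeta>: "0 < \<zeta>" using B by (simp add: \<zeta>_def)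
  define \<eta>0 where "\<eta>0 = min (\<eta>1 / 8) (1 / 10)"
  have \<eta>0: "0 < \<eta>0" using \<eta>1 by (simp add: \<eta>0_def)
  have "whp (\<lambda>n E. \<exists>r X Lf own. real r \<le> real n powr (1 - c + \<epsilon> / 2) \<and>
       core_structure (E \<inter> all_edges {1..N n}) {1..N n} r (nat \<lfloor>\<eta> * real n\<rfloor>) A X Lf own \<and>
       \<zeta> * real n \<le> real (card X) \<and> real (card X) \<le> real n / 40)"
    if \<eta>: "0 < \<eta>" "\<eta> \<le> \<eta>0" and N: "\<And>n. N n \<le> n" "\<And>n. real n - 4 * \<eta> * real n \<le> real (N n)" for \<eta> N
  proof -
    have \<eta>': "8 * \<eta> \<le> \<eta>1" "10 * \<eta> \<le> 1" using \<eta> by (auto simp: \<eta>0_def)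
    have \<mu>pos: "0 < \<mu>1" using \<mu>1 by simp
    have d1: "whp (\<lambda>n E. dense E {1..n} (\<eta>1 * real n) (\<mu>1 * real n) (b1 * ln (real n)))"
      by (rule whp_dense[OF b1(1) b\<mu> \<mu>pos \<eta>1(1)])
    have "0 < \<alpha> * \<eta> / 4" "\<alpha> * \<eta> / 4 < \<alpha> * (\<eta> / 2)" "0 < \<eta> / 2" using \<alpha> \<eta> by auto
    from whp_dense[OF this \<beta>(1)]
    have d2: "whp (\<lambda>n E. dense E {1..n} (\<beta> * real n) (\<eta> / 2 * real n) (\<alpha> * \<eta> / 4 * ln (real n)))" .
    have ev1: "\<forall>\<^sub>F n in sequentially. real A + 1 \<le> 3 * e * ln (real n)" using e by real_asymp
    have ev2: "\<forall>\<^sub>F n in sequentially. 1 \<le> e * ln (real n)" using e by real_asymp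
    have ev3: "\<forall>\<^sub>F n in sequentially. 3 \<le> \<kappa>1 * real n / ln (real n)" using \<kappa>1(1) by real_asymp
    have ev4: "\<forall>\<^sub>F n in sequentially. \<kappa>1 \<le> \<delta> * ln (real n)" using \<delta> by real_asymp
    have ev5: "\<forall>\<^sub>F n in sequentially. 2 \<le> \<eta>1 * real n" using \<eta>1(1) by real_asymp
    have ev6: "\<forall>\<^sub>F n in sequentially. 2 \<le> \<eta> * real n" using \<eta>(1) by real_asymp
    have ev7: "\<forall>\<^sub>F n in sequentially. (B + 3) * (B + 2) * lam * real n powr c' \<le> real n / 2"
    proof -
      have "0 < (B + 3) * (B + 2) * lam" using B(2) lam(1) by simp
      then show ?thesis using c' by real_asymp
    qed
    show ?thesis
    proof (rule whp_mono[OF whp_conj[OF whp_conj[OF sp sc] whp_conj[OF d1 d2]]])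
      show "\<forall>\<^sub>F n in sequentially. \<forall>E\<subseteq>all_edges {1..n}.
        ((sparse E {1..n} (\<delta> * real n) (e / 2 * ln (real n)) \<and>
          scattered E {1..n} (\<kappa> * real n) ((\<alpha> - 3 * e) * ln (real n)) ((\<alpha> - 5 / 2 * e) * ln (real n))) \<and>
         dense E {1..n} (\<eta>1 * real n) (\<mu>1 * real n) (b1 * ln (real n)) \<and>
         dense E {1..n} (\<beta> * real n) (\<eta> / 2 * real n) (\<alpha> * \<eta> / 4 * ln (real n))) \<longrightarrow>
        (\<exists>r X Lf own. real r \<le> real n powr (1 - c + \<epsilon> / 2) \<and>
         core_structure (E \<inter> all_edges {1..N n}) {1..N n} r (nat \<lfloor>\<eta> * real n\<rfloor>) A X Lf own \<and>
         \<zeta> * real n \<le> real (card X) \<and> real (card X) \<le> real n / 40)"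
        using ev1 ev2 ev3 ev4 ev5 ev6 ev7 eventually_ge_at_top[of 2]
      proof (eventually_elim, intro allI impI, elim conjE)
        fix n and E :: "nat set set"
        assume ev1: "real A + 1 \<le> 3 * e * ln (real n)" and ev2: "1 \<le> e * ln (real n)" and ev3: "3 \<le> \<kappa>1 * real n / ln (real n)"
          and ev4: "\<kappa>1 \<le> \<delta> * ln (real n)" and ev5: "2 \<le> \<eta>1 * real n" and ev6: "2 \<le> \<eta> * real n"
          and ev7: "(B + 3) * (B + 2) * lam * real n powr c' \<le> real n / 2" and n2: "2 \<le> n" and "E \<subseteq> all_edges {1..n}"
          and sp: "sparse E {1..n} (\<delta> * real n) (e / 2 * ln (real n))"
          and sc: "scattered E {1..n} (\<kappa> * real n) ((\<alpha> - 3 * e) * ln (real n)) ((\<alpha> - 5 / 2 * e) * ln (real n))"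
          and d1: "dense E {1..n} (\<eta>1 * real n) (\<mu>1 * real n) (b1 * ln (real n))"
          and d2: "dense E {1..n} (\<beta> * real n) (\<eta> / 2 * real n) (\<alpha> * \<eta> / 4 * ln (real n))"
        define L where "L = ln (real n)"
        have L: "0 < L" using n2 by (simp add: L_def)
        note ev = ev1[folded L_def] ev2[folded L_def] ev3[folded L_def] ev4[folded L_def]
        have x0: "0 < real n" using n2 by simp
        define V where "V = {1..N n}"
        define E1 where "E1 = E \<inter> all_edges V"
        have V: "finite V" "card V = N n" "V \<subseteq> {1..n}" using N(1)[of n] by (auto simp: V_def)
        have E1: "E1 \<subseteq> all_edges V" by (simp add: E1_def)
        note sp' = sparse_restrict[OF sp V(3), folded E1_def L_def]
        note sc' = scattered_restrict[OF sc V(3), folded E1_def L_def]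
        have Nn: "real n - 4 * \<eta> * real n \<le> real (N n)" by (rule N(2))
        have \<eta>n: "8 * (\<eta> * real n) \<le> \<eta>1 * real n" "10 * (\<eta> * real n) \<le> real n"
          using mult_right_mono[OF \<eta>'(1), of "real n"] mult_right_mono[OF \<eta>'(2), of "real n"] by auto
        define q where "q = nat \<lceil>\<eta>1 * real n\<rceil>"
        have q: "\<eta>1 * real n \<le> real q" "real q \<le> \<eta>1 * real n + 1" unfolding q_def using ev5 by linarith+
        have \<mu>n: "\<mu>1 * real n \<le> real (card V) - real q"
        proof -
          have "\<mu>1 * real n = real n - 2 * (\<eta>1 * real n)" by (simp add: \<eta>1(2) algebra_simps)
          then show ?thesis using q(2) Nn \<eta>n(1) ev5 V(2) by linarith
        qed
        have \<mu>n': "15 / 16 * real n \<le> \<mu>1 * real n" using \<mu>1 by (intro mult_right_mono) auto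
        have dd: "dense E1 V (real q) (real (card V) - real q) (b1 * L)"
          unfolding E1_def L_def by (rule dense_restrict[OF d1 V(3) q(1) \<mu>n])
        have qq: "0 < q" "q \<le> card V" using q(1) ev5 \<mu>n \<mu>n' x0 by linarith+
        have kk: "(\<alpha> - e) * L < b1 * L" using L e by (intro mult_strict_right_mono) (auto simp: b1_def)
        from dense_core[OF V(1) E1 dd qq kk] obtain H where H: "H \<subseteq> V" "card (V - H) < q" "\<And>v. v \<in> H \<Longrightarrow> (\<alpha> - e) * L \<le> deg_in E1 v H"
          by blast
        have cH: "15 / 16 * real n \<le> real (card H)"
        proof -
          have "card (V - H) = card V - card H" using H V finite_subset[OF H(1) V(1)] by (simp add: card_Diff_subset)
          moreover have "card H \<le> card V" using H V by (intro card_mono) auto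
          ultimately have "real (card V) - real (card H) \<le> real q" using H(2) by linarith
          then show ?thesis using \<mu>n \<mu>n' by linarith
        qed
        \<comment> \<open>The natural limit of expansion by a factor of order \<open>ln n\<close>:
          the neighbourhoods of \<open>m\<close> vertices have linear size.\<close>
        define m where "m = nat \<lfloor>\<kappa>1 * real n / L\<rfloor>"
        have m: "real m \<le> \<kappa>1 * real n / L" "\<kappa>1 * real n / L - 1 \<le> real m" "2 \<le> m" unfolding m_def using ev(3) by linarith+
        have mL: "real m * L \<le> \<kappa>1 * real n" using m(1) L by (simp add: divide_simps)
        have mL': "\<kappa>1 * real n \<le> 2 * (real m * L)"
        proof -
          have "\<kappa>1 * real n / L \<le> 2 * real m" using m(2) ev(3) by linarith
          then show ?thesis using L by (simp add: divide_simps mult_ac)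
        qed
        define k where "k = nat \<lfloor>(\<alpha> - 3 * e) * L\<rfloor>"
        define d where "d = nat \<lfloor>(\<alpha> - 5 * e) * L\<rfloor>"
        have \<alpha>L: "\<alpha> * L = c0 * L + 8 * (e * L)" by (simp add: e(2) algebra_simps)
        have c0L: "0 < c0 * L" using c0 L by simp
        have pos: "0 \<le> (\<alpha> - 3 * e) * L" "0 \<le> (\<alpha> - 5 * e) * L"
          using c0L ev(2) \<alpha>L by (simp_all only: left_diff_distrib)
        have k: "real k \<le> \<alpha> * L - 3 * (e * L)" "\<alpha> * L - 3 * (e * L) - 1 \<le> real k"
          using pos unfolding k_def by (simp_all only: left_diff_distrib mult.assoc) linarith+
        have d: "real d \<le> \<alpha> * L - 5 * (e * L)" "\<alpha> * L - 5 * (e * L) - 1 \<le> real d"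
          using pos unfolding d_def by (simp_all only: left_diff_distrib mult.assoc) linarith+
        have dk: "d \<le> k" using k d ev(2) by linarith
        have kd: "e * L \<le> real (k - d)" using k d ev(2) dk by (simp add: of_nat_diff)
        have expand: "k * card U \<le> card (\<Union>u\<in>U. nbr E1 u \<inter> H)" if U: "U \<subseteq> H" "card U \<le> m" for U
        proof -
          have "(\<alpha> - 3 * e) * L * real (card U) \<le> real (card (\<Union>u\<in>U. nbr E1 u \<inter> H))"
          proof (rule core_expands[OF V(1) E1 H(1,3) sp' sc' _ U(1)])
            show "(\<alpha> - 5 / 2 * e) * L + 2 * (e / 2 * L) < (\<alpha> - e) * L"
              using ev(2) L by (simp add: algebra_simps)
            have "real (card U) * L \<le> real m * L" using U(2) L by (intro mult_right_mono) auto
            then have UL: "real (card U) * L \<le> \<kappa>1 * real n" using mL by linarith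
            note UL
            also have "\<kappa>1 * real n \<le> \<delta> * L * real n" using ev(4) by (intro mult_right_mono) auto
            finally have "real (card U) * L \<le> \<delta> * L * real n" .
            then show "real (card U) \<le> \<delta> * real n" using L by (simp add: mult_ac)
            have "(\<alpha> - 3 * e) * L * real (card U) \<le> \<alpha> * L * real (card U)"
              using L e by (intro mult_right_mono) auto
            also have "\<dots> = \<alpha> * (real (card U) * L)" by simp
            also have "\<dots> \<le> \<alpha> * (\<kappa>1 * real n)" using UL \<alpha> by (intro mult_left_mono) auto
            also have "\<dots> \<le> \<kappa> * real n" using mult_right_mono[OF \<kappa>1(2), of "real n"] by simp
            finally show "(\<alpha> - 3 * e) * L * real (card U) \<le> \<kappa> * real n" .
          qed
          moreover have "real k \<le> (\<alpha> - 3 * e) * L" using k(1) by (simp add: algebra_simps)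
          then have "real k * real (card U) \<le> (\<alpha> - 3 * e) * L * real (card U)" by (intro mult_right_mono) auto
          ultimately have "real (k * card U) \<le> real (card (\<Union>u\<in>U. nbr E1 u \<inter> H))" by simp
          then show ?thesis by (simp only: of_nat_le_iff)
        qed
        \<comment> \<open>The class of the roots: \<open>lam ^ t\<close> equals
          \<open>n powr c'\<close> up to a factor \<open>lam\<close>.\<close>
        define t where "t = nat \<lceil>c' * L / ln lam\<rceil>"
        have tpos: "0 < c' * L / ln lam" using c' L lnl by simp
        then have t: "c' * L / ln lam \<le> real t" "real t \<le> c' * L / ln lam + 1" "1 \<le> t" unfolding t_def by linarith+
        have lt: "real n powr c' \<le> lam ^ t" "lam ^ t \<le> lam * real n powr c'"
        proof -
          have ex: "lam ^ t = exp (real t * ln lam)" using lam(1) by (simp add: exp_of_nat_mult)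
          have "c' * L \<le> real t * ln lam" using t(1) lnl by (simp add: divide_simps)
          moreover have pn: "real n powr c' = exp (c' * L)" using x0 by (simp add: powr_def L_def)
          ultimately show "real n powr c' \<le> lam ^ t" unfolding ex by simp
          have "real t * ln lam \<le> c' * L + ln lam" using mult_right_mono[OF t(2), of "ln lam"] lnl by (simp add: algebra_simps)
          then have "exp (real t * ln lam) \<le> exp (c' * L + ln lam)" by simp
          also have "\<dots> = lam * real n powr c'" unfolding pn exp_add using lam(1) by simp
          finally show "lam ^ t \<le> lam * real n powr c'" unfolding ex .
        qed
        have lt0: "0 < lam ^ t" using lam(1) by simp
        have dA: "child_count h t + A \<le> d"
        proof -
          have "real (child_count h t) \<le> real (t - 1) / real h"
            unfolding child_count_def by (rule of_nat_div_le_of_nat)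
          also have "real (t - 1) / real h \<le> (c' * L / ln lam) / real h"
            using t by (intro divide_right_mono) auto
          also have "\<dots> = c0 * L" by (simp add: c0_def divide_simps)
          finally have "real (child_count h t) \<le> c0 * L" .
          moreover have "real A + 1 \<le> 3 * (e * L)" using ev(1) by (simp add: mult.assoc)
          ultimately have "real (child_count h t + A) \<le> real d" using d(2) \<alpha>L by (simp only: of_nat_add)
          then show ?thesis by (simp only: of_nat_le_iff)
        qed
        define u where "u = nat \<lfloor>\<eta> * real n\<rfloor>"
        have u: "real u \<le> \<eta> * real n" "\<eta> * real n - 1 \<le> real u" unfolding u_def using ev6 by linarith+
        define M where "M = real (card V) - real u"
        have M: "real n / 2 \<le> M" "M \<le> real n" using Nn u(1) \<eta>n(2) N(1)[of n] V(2) unfolding M_def by linarith+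
        \<comment> \<open>The largest number of roots for which the leaves suffice. Then
          \<open>s = r * lam ^ t\<close> lies between \<open>M / (B + 3)\<close> and
          \<open>M / (B + 2)\<close>, as \<open>exists_core_structure\<close> requires.\<close>
        define r where "r = nat \<lfloor>M / ((B + 2) * lam ^ t)\<rfloor>"
        have Bl: "0 < (B + 2) * lam ^ t" using B(2) lt0 by simp
        have M0: "0 \<le> M / ((B + 2) * lam ^ t)" using M x0 Bl by simp
        have r: "real r \<le> M / ((B + 2) * lam ^ t)" "M / ((B + 2) * lam ^ t) - 1 \<le> real r" unfolding r_def using M0 by linarith+
        define s where "s = real r * lam ^ t"
        have s1: "(B + 2) * s \<le> M"
          using r(1) Bl by (simp add: s_def pos_le_divide_eq mult_ac)
        have frac: "(a / K - 1) * K = a - K" if "0 < K" for a K :: real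
          using that by (simp add: left_diff_distrib)
        have s2: "M \<le> (B + 3) * s"
        proof -
          have "(M / ((B + 2) * lam ^ t) - 1) * ((B + 2) * lam ^ t) \<le> real r * ((B + 2) * lam ^ t)"
            using r(2) Bl by (intro mult_right_mono) auto
          moreover have "(M / ((B + 2) * lam ^ t) - 1) * ((B + 2) * lam ^ t) = M - (B + 2) * lam ^ t"
            using frac[OF Bl] .
          moreover have "real r * ((B + 2) * lam ^ t) = (B + 2) * s" by (simp add: s_def mult_ac)
          ultimately have sM: "M - (B + 2) * lam ^ t \<le> (B + 2) * s" by simp
          have "(B + 2) * lam ^ t \<le> s"
          proof -
            have b2: "0 < B + 2" using B(2) by simp
            have "(B + 3) * (B + 2) * lam ^ t \<le> (B + 3) * (B + 2) * (lam * real n powr c')"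
              using lt(2) B(2) by (intro mult_left_mono) auto
            also have "\<dots> \<le> M" using ev7 M(1) by (simp add: mult_ac)
            also have "\<dots> \<le> (B + 2) * s + (B + 2) * lam ^ t" using sM by linarith
            finally have "(B + 2) * ((B + 2) * lam ^ t) \<le> (B + 2) * s" by (simp add: algebra_simps)
            then show ?thesis using b2 by (rule mult_left_le_imp_le)
          qed
          then show ?thesis using sM by (simp add: algebra_simps)
        qed
        have s0: "0 \<le> s" using lt0 by (simp add: s_def)
        have sB: "B * s \<le> real n" using s1 s0 M(2) by (simp add: algebra_simps)
        have s40: "40 * s \<le> real n" using mult_right_mono[OF B(2) s0] sB by linarith
        have s16: "16 * s \<le> e * \<kappa>1 * real n"
        proof -
          have "16 * s \<le> B * (e * \<kappa>1) * s" using B(3) s0 by (rule mult_right_mono)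
          also have "\<dots> = (e * \<kappa>1) * (B * s)" by simp
          also have "\<dots> \<le> (e * \<kappa>1) * real n" using sB e \<kappa>1 by (intro mult_left_mono) auto
          finally show ?thesis .
        qed
        have ek: "0 < e * \<kappa>1 * real n" using e \<kappa>1 x0 by simp
        have emL: "e * \<kappa>1 * real n \<le> 2 * (e * L * real m)"
          using mult_left_mono[OF mL', of e] e by (simp add: mult_ac)
        have kdm: "e * L * real m \<le> real ((k - d) * m)" using mult_right_mono[OF kd, of "real m"] by simp
        have km: "4 * (e * L * real m) \<le> real (k * m)"
        proof -
          have "4 * (e * L) \<le> real k" using k(2) \<alpha>L c0L ev(2) by linarith
          then show ?thesis using mult_right_mono[of "4 * (e * L)" "real k" "real m"] by simp
        qed
        have dm: "real (d * m) \<le> real n / 2"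
        proof -
          have "real d \<le> \<alpha> * L" using d(1) ev(2) by linarith
          then have "real d * real m \<le> \<alpha> * L * real m" by (intro mult_right_mono) auto
          also have "\<dots> = \<alpha> * (real m * L)" by simp
          also have "\<dots> \<le> \<alpha> * (\<kappa>1 * real n)" using mL \<alpha> by (intro mult_left_mono) auto
          also have "\<dots> \<le> 1 / 2 * real n" using mult_right_mono[OF \<kappa>1(3), of "real n"] by simp
          finally show ?thesis by simp
        qed
        have "\<exists>X Lf own. core_structure E1 V r u A X Lf own \<and> s / 2 \<le> real (card X) \<and> real (card X) \<le> s"
        proof (rule exists_core_structure[OF V(1) E1 H(1) lam(2,1) h expand dk m(3) dA s_def])
          show "2 * s < real ((k - d) * m)" using s16 ek emL kdm by linarith
          show "2 * s + real (d * m) < 2 * real (card H)" using s40 dm cH x0 by linarith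
          show "13 \<le> B * (lam - 1)" "2 * B + 6 \<le> real A" using B(1) A(1) by auto
          show "(B + 2) * s \<le> real (card V) - real u" "real (card V) - real u \<le> (B + 3) * s"
            using s1 s2 by (auto simp: M_def)
          have "\<eta> / 2 * real n \<le> real u" using u(2) ev6 by simp
          then show "dense E1 V (\<beta> * real n) (real u) (\<alpha> * \<eta> / 4 * L)"
            unfolding E1_def L_def by (rule dense_restrict[OF d2 V(3) order.refl])
          show "0 < \<alpha> * \<eta> / 4 * L" using \<alpha> \<eta> L by simp
          have "real A * (\<beta> * real n) = e * \<kappa>1 * real n" using \<beta>(2) by (metis mult.assoc)
          then show "s + real A * (\<beta> * real n) \<le> real (k * m)" using s16 ek emL km by linarith
        qed
        then obtain X Lf own where X: "core_structure E1 V r u A X Lf own" "s / 2 \<le> real (card X)" "real (card X) \<le> s" by blast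
        have rn: "real r \<le> real n powr (1 - c + \<epsilon> / 2)"
        proof -
          have "real n powr c' * real r \<le> lam ^ t * real r" using lt(1) by (intro mult_right_mono) auto
          also have "\<dots> \<le> real n" using sB B(2) s0 mult_right_mono[of 1 B s] by (simp add: s_def mult.commute)
          finally have "real r \<le> real n / real n powr c'" using x0 by (simp add: divide_simps mult.commute)
          also have "\<dots> = real n powr (1 - c')" using x0 by (simp add: powr_diff)
          also have "1 - c' = 1 - c + \<epsilon> / 2" by (simp add: c'_def)
          finally show ?thesis .
        qed
        have "\<zeta> * real n \<le> s / 2"
        proof -
          have "real n \<le> 2 * ((B + 3) * s)" using s2 M(1) by linarith
          then show ?thesis using B(2) by (simp add: \<zeta>_def pos_divide_le_eq algebra_simps)
        qed
        then have "\<zeta> * real n \<le> real (card X)" "real (card X) \<le> real n / 40" using X(2,3) s40 by linarith+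
        then show "\<exists>r X Lf own. real r \<le> real n powr (1 - c + \<epsilon> / 2) \<and>
         core_structure (E \<inter> all_edges {1..N n}) {1..N n} r (nat \<lfloor>\<eta> * real n\<rfloor>) A X Lf own \<and>
         \<zeta> * real n \<le> real (card X) \<and> real (card X) \<le> real n / 40"
          using X(1) rn unfolding E1_def V_def u_def by blast
      qed
    qed
  qed
  then show ?thesis using \<zeta> \<eta>0 by blast
qed

subsection \<open>The upper bound\<close>

text \<open>What remains is bounded by three counts: the roots, the vertices of \<open>Y\<close>
  with few neighbours in \<open>Lf\<close>, and the vertices of \<open>V\<close> with few neighbours
  in \<open>V\<close>. Each is at most \<open>n powr \<tau>\<close>, with half of
  \<open>\<epsilon>\<close> to spare for their sum.\<close>

lemma whp_upper_bound:
  fixes c \<epsilon> :: real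
  assumes c: "\<alpha> = c / ln 2" "0 < c" "c < 1" and \<epsilon>: "0 < \<epsilon>" "\<epsilon> < c"
  shows "whp (\<lambda>n E. real (total_acquisition_number {1..n} E) \<le> real n powr (1 - c + \<epsilon>))"
proof -
  define \<tau> where "\<tau> = 1 - c + \<epsilon> / 2"
  have \<tau>: "0 < \<tau>" "\<tau> < 1" using c \<epsilon> by (auto simp: \<tau>_def)
  obtain A :: nat and \<zeta> \<eta>0 :: real where \<zeta>: "0 < \<zeta>" and \<eta>0: "0 < \<eta>0"
    and first: "\<And>\<eta> N. 0 < \<eta> \<Longrightarrow> \<eta> \<le> \<eta>0 \<Longrightarrow> (\<And>n. N n \<le> n) \<Longrightarrow> (\<And>n. real n - 4 * \<eta> * real n \<le> real (N n)) \<Longrightarrow>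
     whp (\<lambda>n E. \<exists>r X Lf own. real r \<le> real n powr \<tau> \<and>
       core_structure (E \<inter> all_edges {1..N n}) {1..N n} r (nat \<lfloor>\<eta> * real n\<rfloor>) A X Lf own \<and>
       \<zeta> * real n \<le> real (card X) \<and> real (card X) \<le> real n / 40)"
    using whp_first_round[OF c \<epsilon>] unfolding \<tau>_def by blast
  define \<zeta>' where "\<zeta>' = min \<zeta> (9 / 10)"
  have \<zeta>': "0 < \<zeta>'" "\<zeta>' \<le> \<zeta>" "\<zeta>' \<le> 9 / 10" using \<zeta> by (auto simp: \<zeta>'_def)
  \<comment> \<open>Small compared with \<open>c\<close>, so that degrees up to
    \<open>2 * \<gamma> * ln n\<close> are rare enough, and below the typical degree into
    \<open>X\<close>.\<close>
  define \<gamma> where "\<gamma> = min (c / 200) (\<alpha> * \<zeta>' / 2)"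
  have \<gamma>: "0 < \<gamma>" "\<gamma> < \<alpha> * \<zeta>'" "\<gamma> \<le> c / 200"
  proof -
    have half: "0 < min x (y / 2) \<and> min x (y / 2) < y \<and> min x (y / 2) \<le> x" if "0 < x" "0 < y" for x y :: real
      using that by (auto simp: min_def)
    show "0 < \<gamma>" "\<gamma> < \<alpha> * \<zeta>'" "\<gamma> \<le> c / 200"
      using half[of "c / 200" "\<alpha> * \<zeta>'"] \<alpha> \<zeta>'(1) c(2) unfolding \<gamma>_def by auto
  qed
  obtain K where K: "0 < K" and deg: "whp (\<lambda>n E. \<forall>v\<in>{1..n}. real (card (nbr E v)) \<le> K * ln (real n))"
    using whp_max_degree by blast
  define \<epsilon>3 where "\<epsilon>3 = \<gamma> / (4 * (2 + real A))"
  have \<epsilon>3: "0 < \<epsilon>3" "2 * \<epsilon>3 * (2 + real A) < \<gamma>"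
  proof -
    show "0 < \<epsilon>3" using \<gamma> by (simp add: \<epsilon>3_def)
    have "\<epsilon>3 * (4 * (2 + real A)) = \<gamma>" unfolding \<epsilon>3_def by simp
    then have "2 * \<epsilon>3 * (2 + real A) = \<gamma> / 2" by (simp add: field_simps)
    then show "2 * \<epsilon>3 * (2 + real A) < \<gamma>" using \<gamma> by simp
  qed
  obtain \<delta>3 where \<delta>3: "0 < \<delta>3" and sp3: "whp (\<lambda>n E. sparse E {1..n} (\<delta>3 * real n) (\<epsilon>3 * ln (real n)))"
    using whp_sparse[OF \<epsilon>3(1)] by blast
  \<comment> \<open>\<open>Y\<close> will have about \<open>4 * \<eta> * n\<close> vertices and
    \<open>U\<close> about \<open>\<eta> * n\<close>. Together with their targets, at most
    \<open>2 + A\<close> times as many, they must stay within the range of sparseness.\<close>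
  define \<eta> where "\<eta> = min \<eta>0 (min (\<delta>3 / (8 * (2 + real A))) (1 / 100))"
  have \<eta>: "0 < \<eta>" "\<eta> \<le> \<eta>0" "\<eta> \<le> 1 / 100" "5 * \<eta> * (2 + real A) \<le> \<delta>3"
  proof -
    show "0 < \<eta>" using \<eta>0 \<delta>3 by (auto simp: \<eta>_def)
    show "\<eta> \<le> \<eta>0" unfolding \<eta>_def by (rule min.cobounded1)
    show "\<eta> \<le> 1 / 100" unfolding \<eta>_def by (rule min.coboundedI2[OF min.cobounded2])
    have "\<eta> \<le> \<delta>3 / (8 * (2 + real A))" by (simp add: \<eta>_def)
    then have "\<eta> * (8 * (2 + real A)) \<le> \<delta>3" by (simp add: pos_le_divide_eq)
    moreover have "5 * (\<eta> * (2 + real A)) \<le> 8 * (\<eta> * (2 + real A))" using \<open>0 < \<eta>\<close> by simp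
    ultimately show "5 * \<eta> * (2 + real A) \<le> \<delta>3" by (simp add: mult_ac)
  qed
  \<comment> \<open>The threshold for neighbours in \<open>Yg\<close>. Even twice this value is
    below the typical degree into \<open>Y\<close>, so boundedly many neighbours in
    \<open>Y - Yg\<close> can be discarded.\<close>
  define \<gamma>1 where "\<gamma>1 = \<alpha> * \<eta>"
  have \<gamma>1: "0 < \<gamma>1" "2 * \<gamma>1 < \<alpha> * (3 * \<eta>)" "0 < 2 * \<gamma>1" using \<alpha> \<eta>(1) by (auto simp: \<gamma>1_def)
  have e4: "0 < \<gamma>1 / 8" using \<gamma>1 by simp
  obtain \<delta>4 where \<delta>4: "0 < \<delta>4" and sp4: "whp (\<lambda>n E. sparse E {1..n} (\<delta>4 * real n) (\<gamma>1 / 8 * ln (real n)))"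
    using whp_sparse[OF e4] by blast
  have "0 < \<alpha> * \<eta> / 4" "\<alpha> * \<eta> / 4 < \<alpha> * (\<eta> / 2)" "0 < \<eta> / 2" "0 < \<delta>4 / 2" using \<alpha> \<eta> \<delta>4 by auto
  from whp_dense[OF this]
  have de4: "whp (\<lambda>n E. dense E {1..n} (\<delta>4 / 2 * real n) (\<eta> / 2 * real n) (\<alpha> * \<eta> / 4 * ln (real n)))" .
  define N where "N n = n - nat \<lfloor>4 * \<eta> * real n\<rfloor>" for n
  have N: "N n \<le> n" "real n - 4 * \<eta> * real n \<le> real (N n)" "real n - real (N n) \<le> 4 * \<eta> * real n"
    "4 * \<eta> * real n - 1 \<le> real n - real (N n)" for n
  proof -
    have "4 * \<eta> * real n \<le> 1 * real n" "0 \<le> 4 * \<eta> * real n" using \<eta> by (intro mult_right_mono, auto)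
    then show "N n \<le> n" "real n - 4 * \<eta> * real n \<le> real (N n)" "real n - real (N n) \<le> 4 * \<eta> * real n"
    "4 * \<eta> * real n - 1 \<le> real n - real (N n)" unfolding N_def by linarith+
  qed
  \<comment> \<open>Here \<open>1 / ln 2 > 1\<close> enters, in the form
    \<open>7 / 5 < 1 / ln 2\<close>.\<close>
  define C where "C = 7 / 5 * c"
  have C: "0 < C" "C < \<alpha>"
  proof -
    show "0 < C" using c by (simp add: C_def)
    have "7 / 5 * ln 2 < (1::real)" using ln2_le_25_over_36 by simp
    then have "7 / 5 * c * ln 2 < c" using c mult_strict_right_mono[of "7 / 5 * ln 2" 1 c] by (simp add: mult_ac)
    then show "C < \<alpha>" unfolding c(1) C_def by (simp add: pos_less_divide_eq)
  qed
  have z: "(0::real) < 1 / 10" "(1::real) / 10 < 1" "(0::real) < 9 / 10" by auto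
  \<comment> \<open>The product \<open>9 / 10 * 7 / 5 * 9 / 10\<close> exceeds
    \<open>113 / 100\<close> and the logarithmic term costs at most \<open>9 / 100\<close>, so the
    rate is larger than \<open>c\<close>.\<close>
  have rate: "1 < \<tau> + (9 / 10 * C * (1 - 1 / 10) + g * ln (1 / 10))" if g: "0 < g" "g \<le> c / 100" for g
  proof -
    have "- ln (1 / 10 :: real) \<le> 9" using ln_le_minus_one[of "10 :: real"] by (simp add: ln_div)
    then have "g * (- ln (1 / 10 :: real)) \<le> c / 100 * 9" using g by (intro mult_mono) auto
    then show ?thesis using c \<epsilon> by (simp add: \<tau>_def C_def)
  qed
  \<comment> \<open>Twice the threshold \<open>\<gamma>\<close>, to leave room for boundedly many
    neighbours in \<open>D\<close>, which are unusable as targets.\<close>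
  define exc where "exc n E \<longleftrightarrow> real (card {v\<in>{1..N n}. deg_in E v ({1..N n} - {v}) \<le> 2 * \<gamma> * ln (real n)}) < real n powr \<tau>" for n and E :: "nat set set"
  have whp_exc: "whp exc"
  proof (rule whpI)
    define \<rho> where "\<rho> = 9 / 10 * C * (1 - 1 / 10) + 2 * \<gamma> * ln (1 / 10)"
    have "1 < \<tau> + \<rho>" unfolding \<rho>_def using \<gamma> by (intro rate) auto
    then have "1 - \<rho> - \<tau> < 0" by simp
    then show "(\<lambda>n. real n powr (1 - \<rho> - \<tau>)) \<longlonglongrightarrow> 0" by real_asymp
    have "\<forall>\<^sub>F n in sequentially. 9 / 10 * real n \<le> real n - 4 / 100 * real n - 1" by real_asymp
    then show "\<forall>\<^sub>F n in sequentially. measure_pmf.prob (\<G> n) {E. \<not> exc n E} \<le> real n powr (1 - \<rho> - \<tau>)"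
      using few_count_tail[OF z(1,2) C z(3), of "2 * \<gamma>"] eventually_ge_at_top[of 2]
    proof eventually_elim
      case (elim n)
      have "measure_pmf.prob (\<G> n) {E. real n powr \<tau> \<le>
          real (card {v\<in>{1..N n}. deg_in E v ({1..N n} - {v}) \<le> 2 * \<gamma> * ln (real n)})} \<le>
        real (card {1..N n}) * exp (- (\<rho> * ln (real n))) / real n powr \<tau>"
        unfolding binomial_random_graph_eq \<rho>_def
      proof (rule elim(2)[rule_format])
        fix v assume v: "v \<in> {1..N n}"
        have "4 * \<eta> * real n \<le> 4 / 100 * real n" using \<eta>(3) by (intro mult_right_mono) auto
        then have "9 / 10 * real n \<le> real (N n) - 1" using elim(1) N(2)[of n] by linarith
        moreover have "real (card ({1..N n} - {v})) = real (N n) - 1" using v by (simp add: of_nat_diff)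
        moreover have "between {v} ({1..N n} - {v}) \<subseteq> all_edges {1..n}"
          using v N(1)[of n] by (intro between_subset) auto
        ultimately show "finite ({1..N n} - {v}) \<and> v \<notin> {1..N n} - {v} \<and>
          between {v} ({1..N n} - {v}) \<subseteq> all_edges {1..n} \<and> 9 / 10 * real n \<le> real (card ({1..N n} - {v}))" by simp
      qed (use elim finite_all_edges[of "{1..n}"] in auto)
      also have "\<dots> \<le> real n * exp (- (\<rho> * ln (real n))) / real n powr \<tau>"
        using N(1)[of n] by (intro divide_right_mono mult_right_mono) auto
      also have "\<dots> = real n powr (1 - \<rho> - \<tau>)"
      proof -
        have "real n powr (1 - \<rho> - \<tau>) = real n powr 1 * real n powr (- \<rho>) / real n powr \<tau>"
          by (simp add: powr_diff powr_minus divide_simps)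
        then show ?thesis using elim by (simp add: powr_def)
      qed
      finally show ?case unfolding exc_def not_less .
    qed
  qed
  define good where "good n E1 X Lf \<longleftrightarrow> E1 \<subseteq> all_edges {1..N n} \<and> \<zeta>' * real n \<le> real (card X) \<and> 9 / 10 * real n \<le> real (card Lf) \<and>
      (\<forall>u\<in>{1..N n}. real (card (nbr E1 u)) \<le> K * ln (real n)) \<and>
      (\<exists>r own. real r \<le> real n powr \<tau> \<and> core_structure E1 {1..N n} r (nat \<lfloor>\<eta> * real n\<rfloor>) A X Lf own)"
    for n and E1 :: "nat set set" and X Lf
  have ge9: "\<forall>\<^sub>F n in sequentially. \<forall>E\<subseteq>all_edges {1..n}.
     (\<exists>r X Lf own. real r \<le> real n powr \<tau> \<and>
       core_structure (E \<inter> all_edges {1..N n}) {1..N n} r (nat \<lfloor>\<eta> * real n\<rfloor>) A X Lf own \<and>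
       \<zeta> * real n \<le> real (card X) \<and> real (card X) \<le> real n / 40) \<and>
     (\<forall>v\<in>{1..n}. real (card (nbr E v)) \<le> K * ln (real n)) \<longrightarrow>
     (\<exists>X Lf. good n (E \<inter> all_edges {1..N n}) X Lf)"
  proof (rule always_eventually, intro allI impI, elim conjE exE)
    fix n and E :: "nat set set" and r X Lf own
    assume E: "E \<subseteq> all_edges {1..n}" and deg: "\<forall>v\<in>{1..n}. real (card (nbr E v)) \<le> K * ln (real n)"
      and r: "real r \<le> real n powr \<tau>" and core: "core_structure (E \<inter> all_edges {1..N n}) {1..N n} r (nat \<lfloor>\<eta> * real n\<rfloor>) A X Lf own"
      and X: "\<zeta> * real n \<le> real (card X)" "real (card X) \<le> real n / 40"
    have core': "X \<subseteq> {1..N n}" "Lf \<subseteq> {1..N n}" "X \<inter> Lf = {}" "card ({1..N n} - X - Lf) = nat \<lfloor>\<eta> * real n\<rfloor>"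
      using core unfolding core_structure_def by auto
    have fin: "finite X" "finite Lf" using finite_subset[OF core'(1)] finite_subset[OF core'(2)] by auto
    have "{1..N n} = X \<union> Lf \<union> ({1..N n} - X - Lf)" using core' by blast
    then have "N n = card (X \<union> Lf \<union> ({1..N n} - X - Lf))" by (metis card_atLeastAtMost diff_Suc_1)
    also have "\<dots> \<le> card X + card Lf + nat \<lfloor>\<eta> * real n\<rfloor>"
      using card_Un_le[of "X \<union> Lf" "{1..N n} - X - Lf"] card_Un_le[of X Lf] core'(4) by linarith
    finally have "N n \<le> card X + card Lf + nat \<lfloor>\<eta> * real n\<rfloor>" .
    moreover have "real (nat \<lfloor>\<eta> * real n\<rfloor>) \<le> \<eta> * real n" using \<eta>(1) by (intro of_nat_floor) simp
    ultimately have "real (N n) \<le> real (card X) + real (card Lf) + \<eta> * real n" by linarith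
    moreover have "\<eta> * real n \<le> 1 / 100 * real n" "4 * \<eta> * real n \<le> 4 / 100 * real n"
      using mult_right_mono[OF \<eta>(3), of "real n"] by simp_all
    ultimately have "9 / 10 * real n \<le> real (card Lf)" using N(2)[of n] X(2) by linarith
    moreover have "\<zeta>' * real n \<le> real (card X)" using X(1) mult_right_mono[OF \<zeta>'(2), of "real n"] by linarith
    moreover have "real (card (nbr (E \<inter> all_edges {1..N n}) u)) \<le> K * ln (real n)" if u: "u \<in> {1..N n}" for u
    proof -
      have "nbr (E \<inter> all_edges {1..N n}) u \<subseteq> nbr E u" by (auto simp: nbr_def)
      then have "card (nbr (E \<inter> all_edges {1..N n}) u) \<le> card (nbr E u)" using finite_nbr[OF E] by (intro card_mono) auto
      moreover have "real (card (nbr E u)) \<le> K * ln (real n)" using deg u N(1)[of n] by auto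
      ultimately show ?thesis by linarith
    qed
    ultimately have "good n (E \<inter> all_edges {1..N n}) X Lf" unfolding good_def using r core by blast
    then show "\<exists>X Lf. good n (E \<inter> all_edges {1..N n}) X Lf" by blast
  qed
  have good_whp: "whp (\<lambda>n E. \<exists>X Lf. good n (E \<inter> all_edges {1..N n}) X Lf)"
    by (rule whp_mono[OF whp_conj[OF first[OF \<eta>(1,2) N(1,2)] deg] ge9])
  have "\<exists>k. whp (\<lambda>n E. \<exists>X Lf. good n (E \<inter> all_edges {1..N n}) X Lf \<and>
      second_round (\<gamma> * ln (real n)) (2 * \<gamma>1 * ln (real n)) {1..N n} {Suc (N n)..n} (real n powr \<tau>) (\<eta> * real n) k E X Lf)"
  proof (rule whp_second_round[OF N(1) _ \<gamma>(1,2) \<zeta>'(1,3) \<gamma>1(3,2) _ z(1,2) C _ \<eta>(1) _ _ good_whp])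
    have "\<forall>\<^sub>F n in sequentially. 1 \<le> \<eta> * real n" using \<eta>(1) by real_asymp
    then show "\<forall>\<^sub>F n in sequentially. 3 * \<eta> * real n \<le> real n - real (N n)"
    proof eventually_elim
      case (elim n)
      then show ?case using N(4)[of n] by linarith
    qed
    show "0 < 3 * \<eta>" "0 \<le> K" using \<eta> K by auto
    show "1 < \<tau> + (9 / 10 * C * (1 - 1 / 10) + \<gamma> * ln (1 / 10))" using \<gamma> by (intro rate) auto
    show "\<forall>\<^sub>F n in sequentially. \<forall>E X Lf. good n E X Lf \<longrightarrow> X \<subseteq> {1..N n} \<and> Lf \<subseteq> {1..N n} \<and> X \<inter> Lf = {} \<and>
      \<zeta>' * real n \<le> real (card X) \<and> 9 / 10 * real n \<le> real (card Lf) \<and> (\<forall>u\<in>{1..N n}. real (card (nbr E u)) \<le> K * ln (real n))"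
    proof (intro always_eventually allI impI)
      fix n E X Lf assume g: "good n E X Lf"
      then obtain r own where "core_structure E {1..N n} r (nat \<lfloor>\<eta> * real n\<rfloor>) A X Lf own"
        unfolding good_def by blast
      then have "X \<subseteq> {1..N n}" "Lf \<subseteq> {1..N n}" "X \<inter> Lf = {}"
        unfolding core_structure_def by - (elim conjE, assumption)+
      moreover have "\<zeta>' * real n \<le> real (card X)" "9 / 10 * real n \<le> real (card Lf)"
        "\<forall>u\<in>{1..N n}. real (card (nbr E u)) \<le> K * ln (real n)"
        using g unfolding good_def by - (elim conjE, assumption)+
      ultimately show "X \<subseteq> {1..N n} \<and> Lf \<subseteq> {1..N n} \<and> X \<inter> Lf = {} \<and>
        \<zeta>' * real n \<le> real (card X) \<and> 9 / 10 * real n \<le> real (card Lf) \<and>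
        (\<forall>u\<in>{1..N n}. real (card (nbr E u)) \<le> K * ln (real n))" by (intro conjI)
    qed
  qed
  then obtain k where second: "whp (\<lambda>n E. \<exists>X Lf. good n (E \<inter> all_edges {1..N n}) X Lf \<and>
      second_round (\<gamma> * ln (real n)) (2 * \<gamma>1 * ln (real n)) {1..N n} {Suc (N n)..n} (real n powr \<tau>) (\<eta> * real n) k E X Lf)" by blast
  have ev1: "\<forall>\<^sub>F n in sequentially. 2 * real k \<le> \<gamma>1 * ln (real n)" using \<gamma>1(1) by real_asymp
  have ev2: "\<forall>\<^sub>F n in sequentially. real k \<le> \<gamma> * ln (real n)" using \<gamma>(1) by real_asymp
  have ev3: "\<forall>\<^sub>F n in sequentially. real n powr \<tau> + 1 \<le> \<eta> / 2 * real n" using \<tau> \<eta>(1) by real_asymp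
  have ev4: "\<forall>\<^sub>F n in sequentially. 3 * real n powr \<tau> \<le> real n powr (1 - c + \<epsilon>)"
  proof -
    have "\<tau> < 1 - c + \<epsilon>" using \<epsilon> by (simp add: \<tau>_def)
    moreover have "0 < 1 - c + \<epsilon>" using c \<epsilon> by simp
    ultimately show ?thesis using \<tau>(1) by real_asymp
  qed
  show ?thesis
  proof (rule whp_mono[OF whp_conj[OF whp_conj[OF sp3 sp4] whp_conj[OF de4 whp_conj[OF whp_exc second]]]])
    show "\<forall>\<^sub>F n in sequentially. \<forall>E\<subseteq>all_edges {1..n}.
      (sparse E {1..n} (\<delta>3 * real n) (\<epsilon>3 * ln (real n)) \<and> sparse E {1..n} (\<delta>4 * real n) (\<gamma>1 / 8 * ln (real n))) \<and>
      dense E {1..n} (\<delta>4 / 2 * real n) (\<eta> / 2 * real n) (\<alpha> * \<eta> / 4 * ln (real n)) \<and> exc n E \<and>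
      (\<exists>X Lf. good n (E \<inter> all_edges {1..N n}) X Lf \<and>
      second_round (\<gamma> * ln (real n)) (2 * \<gamma>1 * ln (real n)) {1..N n} {Suc (N n)..n} (real n powr \<tau>) (\<eta> * real n) k E X Lf) \<longrightarrow>
      real (total_acquisition_number {1..n} E) \<le> real n powr (1 - c + \<epsilon>)"
      using ev1 ev2 ev3 ev4 eventually_ge_at_top[of 2]
    proof (eventually_elim, intro allI impI, elim conjE exE)
      fix n and E :: "nat set set" and X Lf
      assume ev: "2 * real k \<le> \<gamma>1 * ln (real n)" "real k \<le> \<gamma> * ln (real n)" "real n powr \<tau> + 1 \<le> \<eta> / 2 * real n"
        "3 * real n powr \<tau> \<le> real n powr (1 - c + \<epsilon>)" and n2: "2 \<le> n" and E: "E \<subseteq> all_edges {1..n}"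
        and sp3: "sparse E {1..n} (\<delta>3 * real n) (\<epsilon>3 * ln (real n))" and sp4: "sparse E {1..n} (\<delta>4 * real n) (\<gamma>1 / 8 * ln (real n))"
        and de4: "dense E {1..n} (\<delta>4 / 2 * real n) (\<eta> / 2 * real n) (\<alpha> * \<eta> / 4 * ln (real n))" and exc: "exc n E"
        and good: "good n (E \<inter> all_edges {1..N n}) X Lf"
        and second: "second_round (\<gamma> * ln (real n)) (2 * \<gamma>1 * ln (real n)) {1..N n} {Suc (N n)..n} (real n powr \<tau>) (\<eta> * real n) k E X Lf"
      define L where "L = ln (real n)"
      have L: "0 < L" using n2 by (simp add: L_def)
      have x0: "0 < real n" using n2 by simp
      define V where "V = {1..N n}"
      define Y where "Y = {Suc (N n)..n}"
      define u where "u = nat \<lfloor>\<eta> * real n\<rfloor>"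
      define E1 where "E1 = E \<inter> all_edges V"
      have VY: "V \<union> Y = {1..n}" "finite V" "finite Y" "V \<inter> Y = {}" using N(1)[of n] by (auto simp: V_def Y_def)
      obtain r own where r: "real r \<le> real n powr \<tau>" and core: "core_structure E1 V r u A X Lf own"
        using good unfolding good_def E1_def V_def u_def by blast
      define U where "U = V - X - Lf"
      define Yg where "Yg = well_attached E X Lf Y (\<gamma> * L)"
      define D where "D = {v\<in>U. deg_in E v Yg < \<gamma>1 * L}"
      define FL where "FL = {y\<in>Y. deg_in E y Lf \<le> \<gamma> * L}"
      define FX where "FX = {y\<in>Y. deg_in E y X \<le> \<gamma> * L}"
      note sec = second[unfolded second_round_def, folded L_def V_def Y_def, folded FL_def FX_def U_def]
      have cFL: "real (card FL) < real n powr \<tau>" and cFX: "real (card FX) < \<eta> * real n" using sec by auto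
      have secX: "card {y\<in>nbr E v \<inter> Y. deg_in E y X \<le> \<gamma> * L} < k"
        and secL: "card {y\<in>nbr E v \<inter> Y. deg_in E y Lf \<le> \<gamma> * L} < k"
        and secU: "card {w\<in>nbr E v \<inter> U. deg_in E w Y \<le> 2 * \<gamma>1 * L} < k" if "v \<in> U" for v
        using sec that by auto
      have finF: "finite FL" "finite FX" using VY by (auto simp: FL_def FX_def)
      have finn: "finite (nbr E v)" for v using finite_nbr[OF E] by simp
      have YgY: "Yg \<subseteq> Y" by (auto simp: Yg_def well_attached_def)
      have notg: "Y - Yg \<subseteq> FL \<union> FX" by (auto simp: Yg_def well_attached_def FL_def FX_def)
      have cY: "real (card Y) \<le> 4 * \<eta> * real n" "4 * \<eta> * real n - 1 \<le> real (card Y)"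
        using N(1,3,4)[of n] by (auto simp: Y_def of_nat_diff)
      have u: "real u \<le> \<eta> * real n" using \<eta>(1) unfolding u_def by (simp add: of_nat_floor)
      define Ex where "Ex = {v\<in>D \<union> (Y - Yg). deg_in E v (X \<union> Lf \<union> (U - D)) < \<gamma> * L}"
      define G where "G = {v\<in>V. deg_in E v (V - {v}) \<le> 2 * \<gamma> * L}"
      have cG: "real (card G) < real n powr \<tau>" using exc by (simp add: exc_def G_def V_def L_def)
      have "real (total_acquisition_number (V \<union> Y) E) \<le> real (r + card Ex)"
        unfolding Ex_def
      proof (intro of_nat_mono total_acquisition_number_le_exceptional[OF VY(2-4) _ _ core _ _ _ _ _ _ _ _ _ _ Yg_def U_def D_def])
        show "E \<subseteq> all_edges (V \<union> Y)" using E VY by simp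
        show "E1 \<subseteq> E" by (simp add: E1_def)
        show "sparse E (V \<union> Y) (\<delta>3 * real n) (\<epsilon>3 * L)" "sparse E (V \<union> Y) (\<delta>4 * real n) (\<gamma>1 / 8 * L)"
          "dense E (V \<union> Y) (\<delta>4 * real n / 2) (\<eta> / 2 * real n) (\<alpha> * \<eta> / 4 * L)"
          using sp3 sp4 de4 unfolding VY(1) L_def by simp_all
        show "0 \<le> \<epsilon>3 * L" "0 \<le> \<gamma>1 / 8 * L" "0 < \<alpha> * \<eta> / 4 * L" "0 < \<delta>4 * real n"
          using \<epsilon>3 \<gamma>1 L \<alpha> \<eta> \<delta>4 x0 by simp_all
        show "2 * (\<epsilon>3 * L) * (2 + real A) < \<gamma> * L" using mult_strict_right_mono[OF \<epsilon>3(2) L] by (simp add: mult_ac)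
        show "4 * (\<gamma>1 / 8 * L) < \<gamma>1 * L" using mult_pos_pos[OF \<gamma>1(1) L] by (simp add: mult.commute)
        have "(real u + real (card Y)) * (2 + real A) \<le> (5 * \<eta> * real n) * (2 + real A)"
          using u cY(1) by (intro mult_right_mono) auto
        also have "\<dots> \<le> \<delta>3 * real n" using mult_right_mono[OF \<eta>(4), of "real n"] by (simp add: mult_ac)
        finally show "(real u + real (card Y)) * (2 + real A) \<le> \<delta>3 * real n" .
        have "card Y \<le> card (Yg \<union> (FL \<union> FX))" using notg finF finite_subset[OF YgY VY(3)] by (intro card_mono) auto
        also have "\<dots> \<le> card Yg + (card FL + card FX)"
          using card_Un_le[of Yg "FL \<union> FX"] card_Un_le[of FL FX] by linarith
        finally have "real (card Y) \<le> real (card Yg) + (real (card FL) + real (card FX))" by linarith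
        then show "real u + \<eta> / 2 * real n \<le> real (card Yg)" using u cY(2) cFL cFX ev(3) by linarith
      qed
      \<comment> \<open>An exceptional vertex of \<open>Y\<close> has few neighbours in
        \<open>Lf\<close>. One in \<open>D\<close> has fewer than \<open>k\<close> neighbours in
        \<open>D\<close>, as all of \<open>D\<close> has low degree into \<open>Y\<close>; hence its
        degree within \<open>V\<close> is low as well.\<close>
      also have "Ex \<subseteq> FL \<union> G"
      proof
        fix v assume v: "v \<in> Ex"
        show "v \<in> FL \<union> G"
        proof (cases "v \<in> Y")
          case True
          have "card (nbr E v \<inter> Lf) \<le> card (nbr E v \<inter> (X \<union> Lf \<union> (U - D)))" using finn by (intro card_mono) auto
          then show ?thesis using v True by (simp add: Ex_def FL_def)
        next
          case False
          then have vD: "v \<in> D" "v \<in> U" "v \<in> V" using v by (auto simp: Ex_def D_def U_def)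
          \<comment> \<open>\<open>Yg\<close> depends on the second round, so low degree into
            \<open>Yg\<close> is translated into low degree into the fixed set \<open>Y\<close>.
            Fewer than \<open>2 * k\<close> neighbours are lost in this.\<close>
          have DS: "D \<subseteq> {w\<in>U. deg_in E w Y \<le> 2 * \<gamma>1 * L}"
          proof
            fix w assume w: "w \<in> D"
            then have wU: "w \<in> U" by (simp add: D_def)
            have "nbr E w \<inter> Y \<subseteq> (nbr E w \<inter> Yg) \<union> ({y\<in>nbr E w \<inter> Y. deg_in E y X \<le> \<gamma> * L} \<union>
               {y\<in>nbr E w \<inter> Y. deg_in E y Lf \<le> \<gamma> * L})"
              using notg by (auto simp: FL_def FX_def)
            then have "card (nbr E w \<inter> Y) \<le> card ((nbr E w \<inter> Yg) \<union> ({y\<in>nbr E w \<inter> Y. deg_in E y X \<le> \<gamma> * L} \<union>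
               {y\<in>nbr E w \<inter> Y. deg_in E y Lf \<le> \<gamma> * L}))"
              using finn by (intro card_mono) auto
            also have "\<dots> \<le> card (nbr E w \<inter> Yg) + (card {y\<in>nbr E w \<inter> Y. deg_in E y X \<le> \<gamma> * L} +
               card {y\<in>nbr E w \<inter> Y. deg_in E y Lf \<le> \<gamma> * L})"
              by (intro order.trans[OF card_Un_le] add_left_mono card_Un_le)
            finally have "deg_in E w Y \<le> deg_in E w Yg + 2 * real k"
              using secX[OF wU] secL[OF wU] by linarith
            moreover have "deg_in E w Yg < \<gamma>1 * L" using w by (simp add: D_def)
            ultimately have "deg_in E w Y \<le> 2 * (\<gamma>1 * L)" using ev(1)[folded L_def] by linarith
            then show "w \<in> {w\<in>U. deg_in E w Y \<le> 2 * \<gamma>1 * L}" using wU by (simp add: mult.assoc)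
          qed
          have "nbr E v \<inter> (V - {v}) \<subseteq> (nbr E v \<inter> (X \<union> Lf \<union> (U - D))) \<union> {w\<in>nbr E v \<inter> U. deg_in E w Y \<le> 2 * \<gamma>1 * L}"
            using DS by (auto simp: U_def)
          then have "card (nbr E v \<inter> (V - {v})) \<le> card ((nbr E v \<inter> (X \<union> Lf \<union> (U - D))) \<union>
              {w\<in>nbr E v \<inter> U. deg_in E w Y \<le> 2 * \<gamma>1 * L})"
            using finn by (intro card_mono) auto
          also have "\<dots> \<le> card (nbr E v \<inter> (X \<union> Lf \<union> (U - D))) + card {w\<in>nbr E v \<inter> U. deg_in E w Y \<le> 2 * \<gamma>1 * L}"
            by (rule card_Un_le)
          finally have "deg_in E v (V - {v}) \<le> deg_in E v (X \<union> Lf \<union> (U - D)) + real k"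
            using secU[OF vD(2)] by linarith
          moreover have "deg_in E v (X \<union> Lf \<union> (U - D)) < \<gamma> * L" using v by (simp add: Ex_def)
          ultimately have "deg_in E v (V - {v}) \<le> 2 * (\<gamma> * L)" using ev(2)[folded L_def] by linarith
          then show ?thesis using vD(3) by (simp add: G_def mult.assoc)
        qed
      qed
      then have "card Ex \<le> card (FL \<union> G)" using finF VY(2) by (intro card_mono) (auto simp: G_def)
      then have "real (r + card Ex) \<le> real r + (real (card FL) + real (card G))"
        using card_Un_le[of FL G] by linarith
      also have "\<dots> \<le> 3 * real n powr \<tau>" using r cFL cG by linarith
      also have "\<dots> \<le> real n powr (1 - c + \<epsilon>)" by (rule ev(4))
      finally show "real (total_acquisition_number {1..n} E) \<le> real n powr (1 - c + \<epsilon>)" unfolding VY(1) .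
    qed
  qed
qed

end

theorem theorem1p2:
  fixes p \<delta> :: "nat \<Rightarrow> real" and c \<epsilon> :: real
  assumes "0 < c" "c < 1"
    and "\<And>n. 0 \<le> p n \<and> p n \<le> 1"
    and "\<delta> \<longlonglongrightarrow> 0"
    and "\<forall>\<^sub>F n in sequentially. p n = (c + \<delta> n) / ln 2 * (ln (real n) / real n)"
    and "0 < \<epsilon>" "\<epsilon> < min c (1 - c)"
  shows "(\<lambda>n. measure_pmf.prob (binomial_random_graph n (p n))
            {E. real n powr (1 - c - \<epsilon>) \<le> real (total_acquisition_number {1..n} E) \<and>
                real (total_acquisition_number {1..n} E) \<le> real n powr (1 - c + \<epsilon>)})
         \<longlonglongrightarrow> 1"
proof -
  interpret random_graph_regime p "c / ln 2"
  proof
    show "0 \<le> p n \<and> p n \<le> 1" for n by (rule assms(3))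
    show "0 < c / ln 2" using assms(1) by simp
    have "(\<lambda>n. (c + \<delta> n) / ln 2) \<longlonglongrightarrow> (c + 0) / ln 2" by (intro tendsto_intros assms(4)) simp
    then have "(\<lambda>n. (c + \<delta> n) / ln 2) \<longlonglongrightarrow> c / ln 2" by simp
    then show "(\<lambda>n. real n * p n / ln (real n)) \<longlonglongrightarrow> c / ln 2"
    proof (rule Lim_transform_eventually)
      show "\<forall>\<^sub>F n in sequentially. (c + \<delta> n) / ln 2 = real n * p n / ln (real n)"
        using assms(5) eventually_ge_at_top[of 2]
      proof eventually_elim
        case (elim n)
        have "0 < ln (real n)" "0 < real n" using elim(2) by auto
        then show ?case unfolding elim(1) by (simp add: field_simps)
      qed
    qed
  qed
  define P where "P n E \<longleftrightarrow> real n powr (1 - c - \<epsilon>) \<le> real (total_acquisition_number {1..n} E) \<and>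
      real (total_acquisition_number {1..n} E) \<le> real n powr (1 - c + \<epsilon>)" for n E
  have "\<epsilon> < c" using assms(7) by simp
  then have "whp P"
    unfolding P_def
    by (intro whp_conj whp_lower_bound[OF refl assms(6)] whp_upper_bound[OF refl assms(1,2,6)])
  then have "(\<lambda>n. 1 - measure_pmf.prob (binomial_random_graph n (p n)) {E. \<not> P n E}) \<longlonglongrightarrow> 1 - 0"
    unfolding whp_def by (intro tendsto_diff tendsto_const)
  moreover have "1 - measure_pmf.prob (binomial_random_graph n (p n)) {E. \<not> P n E} =
      measure_pmf.prob (binomial_random_graph n (p n)) {E. P n E}" for n
    using measure_pmf.prob_compl[of "{E. P n E}" "binomial_random_graph n (p n)"]
    by (simp add: Compl_eq_Diff_UNIV[symmetric] Collect_neg_eq)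
  ultimately show ?thesis by (simp add: P_def)
qed

end
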